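(* Let $S$ be an F-finite regular ring of characteristic $p>0$, let $\mathfrak p\subseteq S$ be a prime ideal, and let $n\ge1$ and $e\ge0$ be integers. Then $\mathfrak p^{\{n,p^e\}}$ is the $\mathfrak p$-primary component of $\mathfrak p^n+\mathfrak p^{[p^e]}$, i.e. $\mathfrak p^{\{n,p^e\}}=(\mathfrak p^n+\mathfrak p^{[p^e]})S_{\mathfrak p}\cap S$.
   Context: Rings are commutative Noetherian. F-finite means that the Frobenius map is finite. $\mathfrak p^{[p^e]}$ is the ideal generated by $p^e$-th powers of elements of $\mathfrak p$. Differential operators: $D^0_S=\mathrm{Hom}_S(S,S)\cong S$ and, inductively, $D^n_S=\{\delta\in\mathrm{Hom}_{\mathbb Z}(S,S)\mid[\delta,s]\in D^{n-1}_S\text{ for all }s\in S\}$. Put $D^{(e)}_S=\mathrm{Hom}_{S^{p^e}}(S,S)$ and $D^{(n,p^e)}_S=D^n_S\cap D^{(e)}_S$. For an ideal $I\subseteq S$, the $n$-th differential power of level $e$ is $I^{\{n,p^e\}}=\{s\in S\mid\delta(s)\in I\text{ for all }\delta\in D^{(n-1,p^e)}_S\}$. *)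

theory Defs
  imports
    "HOL-Algebra.Ideal_Product"
    "HOL-Algebra.Ring_Divisibility"
    "HOL-Computational_Algebra.Primes"
    "HOL-Library.Extended_Nat"
begin

section \<open>Localization at a prime ideal\<close>

definition loc_rel :: "('a, 'b) ring_scheme \<Rightarrow> 'a set \<Rightarrow> (('a \<times> 'a) \<times> ('a \<times> 'a)) set" where
  "loc_rel R P = {((a, s), (b, t)) | a s b t.
     a \<in> carrier R \<and> s \<in> carrier R - P \<and> b \<in> carrier R \<and> t \<in> carrier R - P \<and>
     (\<exists>u \<in> carrier R - P. u \<otimes>\<^bsub>R\<^esub> (t \<otimes>\<^bsub>R\<^esub> a \<ominus>\<^bsub>R\<^esub> s \<otimes>\<^bsub>R\<^esub> b) = \<zero>\<^bsub>R\<^esub>)}"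

definition loc_frac :: "('a, 'b) ring_scheme \<Rightarrow> 'a set \<Rightarrow> 'a \<Rightarrow> 'a \<Rightarrow> ('a \<times> 'a) set" where
  "loc_frac R P a s = loc_rel R P `` {(a, s)}"

text \<open>In the operations each union is over all representatives; all of them yield the same class.\<close>

definition localization :: "('a, 'b) ring_scheme \<Rightarrow> 'a set \<Rightarrow> ('a \<times> 'a) set ring" where
  "localization R P =
    \<lparr> carrier = (carrier R \<times> (carrier R - P)) // loc_rel R P,
      monoid.mult = (\<lambda>X Y. \<Union>(a, s)\<in>X. \<Union>(b, t)\<in>Y. loc_frac R P (a \<otimes>\<^bsub>R\<^esub> b) (s \<otimes>\<^bsub>R\<^esub> t)),
      one = loc_frac R P \<one>\<^bsub>R\<^esub> \<one>\<^bsub>R\<^esub>,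
      zero = loc_frac R P \<zero>\<^bsub>R\<^esub> \<one>\<^bsub>R\<^esub>,
      add = (\<lambda>X Y. \<Union>(a, s)\<in>X. \<Union>(b, t)\<in>Y.
               loc_frac R P (t \<otimes>\<^bsub>R\<^esub> a \<oplus>\<^bsub>R\<^esub> s \<otimes>\<^bsub>R\<^esub> b) (s \<otimes>\<^bsub>R\<^esub> t)) \<rparr>"

definition loc_map :: "('a, 'b) ring_scheme \<Rightarrow> 'a set \<Rightarrow> 'a \<Rightarrow> ('a \<times> 'a) set" where
  "loc_map R P a = loc_frac R P a \<one>\<^bsub>R\<^esub>"

text \<open>The ideal \<open>I R\<^sub>P \<inter> R\<close>: the contraction to \<open>R\<close> of the extension of \<open>I\<close> to \<open>R\<^sub>P\<close>.\<close>

definition loc_contraction :: "('a, 'b) ring_scheme \<Rightarrow> 'a set \<Rightarrow> 'a set \<Rightarrow> 'a set" where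
  "loc_contraction R P I =
    {x \<in> carrier R. loc_map R P x \<in> Idl\<^bsub>localization R P\<^esub> (loc_map R P ` I)}"


section \<open>Regular rings\<close>

definition krull_dim :: "('a, 'b) ring_scheme \<Rightarrow> enat" where
  "krull_dim R = Sup {enat n | n. \<exists>C :: nat \<Rightarrow> 'a set.
     (\<forall>i\<le>n. primeideal (C i) R) \<and> (\<forall>i<n. C i \<subset> C (Suc i))}"

definition min_num_gens :: "('a, 'b) ring_scheme \<Rightarrow> 'a set \<Rightarrow> nat" where
  "min_num_gens R I = (LEAST n. \<exists>A \<subseteq> carrier R. finite A \<and> card A = n \<and> I = Idl\<^bsub>R\<^esub> A)"

definition regular_local_ring :: "('a, 'b) ring_scheme \<Rightarrow> bool" where
  "regular_local_ring R \<longleftrightarrow> cring R \<and> noetherian_ring R \<and>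
     (\<exists>m. {M. maximalideal M R} = {m} \<and> enat (min_num_gens R m) = krull_dim R)"

definition regular_ring :: "('a, 'b) ring_scheme \<Rightarrow> bool" where
  "regular_ring R \<longleftrightarrow> cring R \<and> noetherian_ring R \<and>
     (\<forall>P. primeideal P R \<longrightarrow> regular_local_ring (localization R P))"


section \<open>Characteristic and F-finiteness\<close>

definition ring_char :: "('a, 'b) ring_scheme \<Rightarrow> nat" where
  "ring_char R = (if \<exists>k::nat. k > 0 \<and> add_pow R k \<one>\<^bsub>R\<^esub> = \<zero>\<^bsub>R\<^esub>
     then (LEAST k::nat. k > 0 \<and> add_pow R k \<one>\<^bsub>R\<^esub> = \<zero>\<^bsub>R\<^esub>) else 0)"

definition finite_ring_map ::
  "('a, 'b) ring_scheme \<Rightarrow> ('c, 'd) ring_scheme \<Rightarrow> ('a \<Rightarrow> 'c) \<Rightarrow> bool" where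
  "finite_ring_map R T h \<longleftrightarrow> h \<in> ring_hom R T \<and>
     (\<exists>A \<subseteq> carrier T. finite A \<and>
       (\<forall>x \<in> carrier T. \<exists>c \<in> A \<rightarrow> carrier R. x = (\<Oplus>\<^bsub>T\<^esub>a\<in>A. h (c a) \<otimes>\<^bsub>T\<^esub> a)))"

definition F_finite :: "nat \<Rightarrow> ('a, 'b) ring_scheme \<Rightarrow> bool" where
  "F_finite p R \<longleftrightarrow> finite_ring_map R R (\<lambda>x. x [^]\<^bsub>R\<^esub> p)"


section \<open>Differential operators and differential powers\<close>

definition hom_over :: "('a, 'b) ring_scheme \<Rightarrow> 'a set \<Rightarrow> ('a \<Rightarrow> 'a) set" where
  "hom_over R A = {\<delta> \<in> hom (add_monoid R) (add_monoid R).
     \<forall>a\<in>A. \<forall>x\<in>carrier R. \<delta> (a \<otimes>\<^bsub>R\<^esub> x) = a \<otimes>\<^bsub>R\<^esub> \<delta> x}"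

definition commutator :: "('a, 'b) ring_scheme \<Rightarrow> ('a \<Rightarrow> 'a) \<Rightarrow> 'a \<Rightarrow> 'a \<Rightarrow> 'a" where
  "commutator R \<delta> s = (\<lambda>x. \<delta> (s \<otimes>\<^bsub>R\<^esub> x) \<ominus>\<^bsub>R\<^esub> s \<otimes>\<^bsub>R\<^esub> \<delta> x)"

text \<open>The elements of \<open>hom\<close> are total functions, so an operator on \<open>R\<close> is represented by every
  function that agrees with it on the carrier; the values elsewhere play no role.\<close>

fun diff_ops :: "('a, 'b) ring_scheme \<Rightarrow> nat \<Rightarrow> ('a \<Rightarrow> 'a) set" where
  "diff_ops R 0 = hom_over R (carrier R)"
| "diff_ops R (Suc n) = {\<delta> \<in> hom (add_monoid R) (add_monoid R).
     \<forall>s\<in>carrier R. commutator R \<delta> s \<in> diff_ops R n}"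

definition diff_ops_level :: "('a, 'b) ring_scheme \<Rightarrow> nat \<Rightarrow> nat \<Rightarrow> ('a \<Rightarrow> 'a) set" where
  "diff_ops_level R p e = hom_over R ((\<lambda>x. x [^]\<^bsub>R\<^esub> (p ^ e)) ` carrier R)"

text \<open>Only meaningful for \<open>n \<ge> 1\<close>, because of the truncated subtraction.\<close>

definition diff_power ::
  "('a, 'b) ring_scheme \<Rightarrow> 'a set \<Rightarrow> nat \<Rightarrow> nat \<Rightarrow> nat \<Rightarrow> 'a set" where
  "diff_power R I n p e =
    {s \<in> carrier R. \<forall>\<delta> \<in> diff_ops R (n - 1) \<inter> diff_ops_level R p e. \<delta> s \<in> I}"

definition frobenius_power :: "('a, 'b) ring_scheme \<Rightarrow> 'a set \<Rightarrow> nat \<Rightarrow> nat \<Rightarrow> 'a set" where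
  "frobenius_power R I p e = Idl\<^bsub>R\<^esub> ((\<lambda>x. x [^]\<^bsub>R\<^esub> (p ^ e)) ` I)"


section \<open>Primary components\<close>

definition ideal_radical :: "('a, 'b) ring_scheme \<Rightarrow> 'a set \<Rightarrow> 'a set" where
  "ideal_radical R I = {x \<in> carrier R. \<exists>k::nat. x [^]\<^bsub>R\<^esub> k \<in> I}"

definition primary_ideal :: "('a, 'b) ring_scheme \<Rightarrow> 'a set \<Rightarrow> bool" where
  "primary_ideal R Q \<longleftrightarrow> ideal Q R \<and> Q \<noteq> carrier R \<and>
     (\<forall>a\<in>carrier R. \<forall>b\<in>carrier R. a \<otimes>\<^bsub>R\<^esub> b \<in> Q \<longrightarrow> a \<in> Q \<or> b \<in> ideal_radical R Q)"

text \<open>The intersection with the carrier only matters for the empty family.\<close>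

definition minimal_primary_decomposition ::
  "('a, 'b) ring_scheme \<Rightarrow> 'a set \<Rightarrow> 'a set set \<Rightarrow> bool" where
  "minimal_primary_decomposition R I D \<longleftrightarrow>
     finite D \<and> (\<forall>Q\<in>D. primary_ideal R Q) \<and> I = carrier R \<inter> \<Inter>D \<and>
     inj_on (ideal_radical R) D \<and> (\<forall>Q\<in>D. \<not> carrier R \<inter> \<Inter>(D - {Q}) \<subseteq> Q)"

text \<open>\<open>J\<close> is \<^emph>\<open>the\<close> \<open>P\<close>-primary component of \<open>I\<close>: a minimal primary decomposition of \<open>I\<close> exists,
  and in every one of them \<open>J\<close> is the unique member with radical \<open>P\<close>.\<close>

definition is_primary_component ::
  "('a, 'b) ring_scheme \<Rightarrow> 'a set \<Rightarrow> 'a set \<Rightarrow> 'a set \<Rightarrow> bool" where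
  "is_primary_component R P I J \<longleftrightarrow>
     (\<exists>D. minimal_primary_decomposition R I D) \<and>
     (\<forall>D. minimal_primary_decomposition R I D \<longrightarrow> {Q \<in> D. ideal_radical R Q = P} = {J})"

end

theory Submission
  imports Defs "HOL-Computational_Algebra.Polynomial"
begin

text \<open>
  Write \<open>q = p\<^sup>e\<close>. An operator of order below \<open>n\<close> lowers the exponent of \<open>P\<^sup>n\<close> by at most \<open>n - 1\<close>, and
  \<open>q\<close>-th powers commute with operators of level \<open>e\<close>; this gives one inclusion. For the other one let
  \<open>R = S\<^sub>P\<close> with maximal ideal \<open>\<mm> = (x\<^sub>1, \<dots>, x\<^sub>d)\<close> and residue field \<open>k\<close>, and let \<open>y\<close> be lifts of a
  \<open>p\<close>-basis of \<open>k\<close>. The monomials in \<open>x\<close> and \<open>y\<close> with exponents below \<open>q\<close> generate \<open>R\<close> over its \<open>q\<close>-th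
  powers by Nakayama, and they are independent since, by Krull's principal ideal theorem, a chain of
  primes of length \<open>d\<close> forces the ideals \<open>(x\<^sub>1, \<dots>, x\<^sub>j)\<close> to be prime. So the divided power operators in
  the \<open>x\<^sub>i\<close> exist on \<open>R\<close>, are linear over \<open>q\<close>-th powers, and the one belonging to an exponent vector \<open>a\<close>
  has order \<open>\<bar>a\<bar>\<close>. If \<open>s\<close> is not in \<open>\<mm>\<^sup>n + \<mm>\<^sup>[\<^sup>q\<^sup>]\<close>, some coefficient of \<open>s\<close> at \<open>x\<^sup>a y\<^sup>c\<close> with \<open>\<bar>a\<bar> < n\<close> is a
  unit, and the operator of \<open>a\<close> maps \<open>s\<close> to a unit. A multiple of that operator lifts to \<open>S\<close> because
  \<open>S\<close> is finite over its \<open>q\<close>-th powers.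
\<close>

section \<open>Ideals, saturation and Nakayama's lemma\<close>

text \<open>The given ring is a record, so the algebra is done in a type-class ring that maps onto
  it, modulo the kernel \<open>J\<close> of that map: ideals are taken above \<open>J\<close>, and
  identities hold up to \<open>J\<close>. \<open>R\<close> need not contain a copy of its residue
  field, and no completion is taken to obtain one. Lifts of a \<open>p\<close>-basis can replace it
  because the constants that the operators must respect are the \<open>q\<close>-th powers and not a
  field; the monomials in \<open>y\<close> merely carry coefficients and are never differentiated.
  The divided powers are defined through coordinates with respect to the monomial basis, because
  iterated derivatives cannot be divided by factorials in characteristic \<open>p\<close>.
  Independence of the basis makes these coordinates well defined, and this is where regularity
  enters.\<close>

definition is_ideal :: "'c::comm_ring_1 set \<Rightarrow> bool" where
  "is_ideal I \<longleftrightarrow> 0 \<in> I \<and> (\<forall>x\<in>I. \<forall>y\<in>I. x + y \<in> I) \<and> (\<forall>x\<in>I. \<forall>r. r * x \<in> I)"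

definition is_prime :: "'c::comm_ring_1 set \<Rightarrow> bool" where
  "is_prime P \<longleftrightarrow> is_ideal P \<and> 1 \<notin> P \<and> (\<forall>x y. x * y \<in> P \<longrightarrow> x \<in> P \<or> y \<in> P)"

definition adjoin :: "'c::comm_ring_1 set \<Rightarrow> 'c \<Rightarrow> 'c set" where
  "adjoin I a = {i + r * a | i r. i \<in> I}"

text \<open>For a prime \<open>P\<close> and an ideal \<open>I\<close> this is the contraction of
  the extension of \<open>I\<close> to the localization at \<open>P\<close>. It allows arguments at
  two different primes to take place in one and the same ring.\<close>

definition saturation :: "'c::comm_ring_1 set \<Rightarrow> 'c set \<Rightarrow> 'c set" where
  "saturation P I = {r. \<exists>u. u \<notin> P \<and> u * r \<in> I}"

lemma is_idealI:
  assumes "0 \<in> I" "\<And>x y. x \<in> I \<Longrightarrow> y \<in> I \<Longrightarrow> x + y \<in> I" "\<And>x r. x \<in> I \<Longrightarrow> r * x \<in> I"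
  shows "is_ideal I"
  using assms by (auto simp: is_ideal_def)

lemma is_ideal_zero: "is_ideal I \<Longrightarrow> 0 \<in> I"
  and is_ideal_add: "is_ideal I \<Longrightarrow> x \<in> I \<Longrightarrow> y \<in> I \<Longrightarrow> x + y \<in> I"
  and is_ideal_mult_left: "is_ideal I \<Longrightarrow> x \<in> I \<Longrightarrow> r * x \<in> I"
  by (auto simp: is_ideal_def)

lemma is_ideal_mult_right: "is_ideal I \<Longrightarrow> x \<in> I \<Longrightarrow> x * r \<in> I"
  using is_ideal_mult_left[of I x r] by (simp add: mult.commute)

lemma is_ideal_uminus: "is_ideal I \<Longrightarrow> x \<in> I \<Longrightarrow> - x \<in> I"
  using is_ideal_mult_left[of I x "-1"] by simp

lemma is_ideal_diff: "is_ideal I \<Longrightarrow> x \<in> I \<Longrightarrow> y \<in> I \<Longrightarrow> x - y \<in> I"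
  using is_ideal_add[of I x "- y"] is_ideal_uminus[of I y] by simp

lemma is_ideal_sum: "is_ideal I \<Longrightarrow> (\<And>j. j \<in> A \<Longrightarrow> f j \<in> I) \<Longrightarrow> sum f A \<in> I"
  by (induction A rule: infinite_finite_induct) (auto simp: is_ideal_zero is_ideal_add)

lemma is_ideal_one: "is_ideal I \<Longrightarrow> 1 \<in> I \<Longrightarrow> I = UNIV"
  using is_ideal_mult_left[of I 1] by auto

lemma is_prime_ideal: "is_prime P \<Longrightarrow> is_ideal P"
  by (simp add: is_prime_def)

lemma is_prime_mult: "is_prime P \<Longrightarrow> u \<notin> P \<Longrightarrow> v \<notin> P \<Longrightarrow> u * v \<notin> P"
  by (auto simp: is_prime_def)

lemma is_prime_power: "is_prime P \<Longrightarrow> x ^ n \<in> P \<Longrightarrow> x \<in> P"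
  by (induction n) (auto simp: is_prime_def)

lemma is_ideal_UNIV: "is_ideal UNIV"
  by (simp add: is_ideal_def)

lemma is_ideal_adjoin:
  assumes "is_ideal I"
  shows "is_ideal (adjoin I a)"
proof (rule is_idealI)
  show "0 \<in> adjoin I a"
    unfolding adjoin_def using is_ideal_zero[OF assms] by (auto intro!: exI[of _ 0])
next
  fix x y assume "x \<in> adjoin I a" "y \<in> adjoin I a"
  then obtain i r j s where "x = i + r * a" "y = j + s * a" "i \<in> I" "j \<in> I"
    by (auto simp: adjoin_def)
  then have "x + y = (i + j) + (r + s) * a" "i + j \<in> I"
    using is_ideal_add[OF assms] by (auto simp: algebra_simps)
  then show "x + y \<in> adjoin I a" unfolding adjoin_def by blast
next
  fix x t assume "x \<in> adjoin I a"
  then obtain i r where "x = i + r * a" "i \<in> I" by (auto simp: adjoin_def)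
  then have "t * x = t * i + (t * r) * a" "t * i \<in> I"
    using is_ideal_mult_left[OF assms] by (auto simp: algebra_simps)
  then show "t * x \<in> adjoin I a" unfolding adjoin_def by blast
qed

lemma subset_adjoin: "I \<subseteq> adjoin I a"
  unfolding adjoin_def by clarsimp (metis add.right_neutral mult_zero_left)

lemma mem_adjoin: "is_ideal I \<Longrightarrow> a \<in> adjoin I a"
  unfolding adjoin_def using is_ideal_zero[of I] by clarsimp (metis add_0 mult_1)

lemma adjoin_least: "is_ideal K \<Longrightarrow> I \<subseteq> K \<Longrightarrow> a \<in> K \<Longrightarrow> adjoin I a \<subseteq> K"
  unfolding adjoin_def by (auto intro!: is_ideal_add is_ideal_mult_left)

lemma is_ideal_saturation:
  assumes "is_prime P" "is_ideal I"
  shows "is_ideal (saturation P I)"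
proof (rule is_idealI)
  show "0 \<in> saturation P I"
    using assms is_ideal_zero by (auto simp: saturation_def is_prime_def)
next
  fix x y assume "x \<in> saturation P I" "y \<in> saturation P I"
  then obtain u v where uv: "u \<notin> P" "v \<notin> P" "u * x \<in> I" "v * y \<in> I"
    by (auto simp: saturation_def)
  have "(u * v) * (x + y) = v * (u * x) + u * (v * y)" by (simp add: algebra_simps)
  also have "\<dots> \<in> I" using uv assms by (auto intro!: is_ideal_add is_ideal_mult_left)
  finally show "x + y \<in> saturation P I"
    using is_prime_mult[OF assms(1) uv(1,2)] by (auto simp: saturation_def)
next
  fix x r assume "x \<in> saturation P I"
  then obtain u where u: "u \<notin> P" "u * x \<in> I" by (auto simp: saturation_def)
  have "u * (r * x) = r * (u * x)" by (simp add: algebra_simps)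
  also have "\<dots> \<in> I" using u is_ideal_mult_left[OF assms(2)] by blast
  finally show "r * x \<in> saturation P I" using u by (auto simp: saturation_def)
qed

lemma subset_saturation: "is_prime P \<Longrightarrow> I \<subseteq> saturation P I"
  by (auto simp: saturation_def is_prime_def intro!: exI[of _ 1])

lemma saturation_mono: "I \<subseteq> K \<Longrightarrow> saturation P I \<subseteq> saturation P K"
  by (auto simp: saturation_def)

lemma saturation_anti: "P \<subseteq> Q \<Longrightarrow> saturation Q I \<subseteq> saturation P I"
  by (auto simp: saturation_def)

lemma saturation_idem: "is_prime P \<Longrightarrow> saturation P (saturation P I) = saturation P I"
proof
  assume P: "is_prime P"
  show "saturation P (saturation P I) \<subseteq> saturation P I"
  proof
    fix x assume "x \<in> saturation P (saturation P I)"
    then obtain u v where "u \<notin> P" "v \<notin> P" "v * (u * x) \<in> I" by (auto simp: saturation_def)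
    with is_prime_mult[OF P, of v u] show "x \<in> saturation P I"
      by (auto simp: saturation_def mult.assoc intro!: exI[of _ "v * u"])
  qed
qed (rule subset_saturation)

lemma saturation_prime: "is_prime P \<Longrightarrow> is_prime Q \<Longrightarrow> P \<subseteq> Q \<Longrightarrow> saturation Q P = P"
  using subset_saturation[of Q P] by (auto simp: saturation_def is_prime_def)

lemma saturation_eqD: "saturation P W = W \<Longrightarrow> u \<notin> P \<Longrightarrow> u * x \<in> W \<Longrightarrow> x \<in> W"
  by (auto simp: saturation_def)

definition ideal_gen :: "'c::comm_ring_1 set \<Rightarrow> 'c set" where
  "ideal_gen X = \<Inter>{I. is_ideal I \<and> X \<subseteq> I}"

lemma is_ideal_gen: "is_ideal (ideal_gen X)"
  unfolding ideal_gen_def by (rule is_idealI) (auto simp: is_ideal_def)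

lemma subset_ideal_gen: "X \<subseteq> ideal_gen X"
  by (auto simp: ideal_gen_def)

lemma ideal_gen_least: "is_ideal I \<Longrightarrow> X \<subseteq> I \<Longrightarrow> ideal_gen X \<subseteq> I"
  by (auto simp: ideal_gen_def)

section \<open>Nakayama's lemma and descending chains in a Noetherian quotient\<close>

locale noetherian_above =
  fixes J :: "'c::comm_ring_1 set"
  assumes maximal_element: "\<lbrakk>F \<noteq> {}; \<And>I. I \<in> F \<Longrightarrow> is_ideal I \<and> J \<subseteq> I\<rbrakk>
    \<Longrightarrow> \<exists>M\<in>F. \<forall>I\<in>F. M \<subseteq> I \<longrightarrow> I = M"
begin

lemma obtain_maximal:
  assumes "A \<in> F" "\<And>I. I \<in> F \<Longrightarrow> is_ideal I \<and> J \<subseteq> I"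
  obtains M where "M \<in> F" "\<And>V. V \<in> F \<Longrightarrow> M \<subseteq> V \<Longrightarrow> V = M"
  using maximal_element[of F] assms by blast

text \<open>The hypothesis is \<open>I \<subseteq> Q + P I\<close> after localization at \<open>P\<close>, phrased without the product of ideals.\<close>

lemma nakayama:
  assumes P: "is_prime P" and Q: "is_ideal Q" "J \<subseteq> Q"
    and hyp: "\<And>W. \<lbrakk>is_ideal W; Q \<subseteq> W; \<And>x y. x \<in> P \<Longrightarrow> y \<in> I \<Longrightarrow> x * y \<in> W\<rbrakk> \<Longrightarrow> I \<subseteq> saturation P W"
  shows "I \<subseteq> saturation P Q"
proof (rule ccontr)
  assume neg: "\<not> I \<subseteq> saturation P Q"
  \<comment> \<open>A maximal \<open>W\<close> of this family takes the place of finite generation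
    of \<open>I\<close>: it turns out to contain all products of \<open>P\<close> and
    \<open>I\<close>, so that the hypothesis applies to \<open>W\<close> itself.\<close>
  define F where "F = {W. is_ideal W \<and> Q \<subseteq> W \<and> saturation P W = W \<and> \<not> I \<subseteq> W}"
  have "saturation P Q \<in> F"
    using neg is_ideal_saturation[OF P Q(1)] saturation_idem[OF P, of Q] subset_saturation[OF P, of Q]
    by (simp add: F_def)
  then obtain W where "W \<in> F" and max: "\<And>V. V \<in> F \<Longrightarrow> W \<subseteq> V \<Longrightarrow> V = W"
    by (rule obtain_maximal[of _ F]) (use Q(2) in \<open>auto simp: F_def\<close>)
  then have W: "is_ideal W" "Q \<subseteq> W" "saturation P W = W" "\<not> I \<subseteq> W" by (auto simp: F_def)
  have big: "I \<subseteq> saturation P (adjoin W g)" if "g \<notin> W" for g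
  proof (rule ccontr)
    assume "\<not> ?thesis"
    moreover have "W \<subseteq> saturation P (adjoin W g)"
      using subset_adjoin[of W g] subset_saturation[OF P, of "adjoin W g"] by blast
    moreover have "g \<in> saturation P (adjoin W g)"
      using mem_adjoin[OF W(1), of g] subset_saturation[OF P, of "adjoin W g"] by blast
    moreover from calculation have "saturation P (adjoin W g) \<in> F"
      using W P is_ideal_saturation[OF P is_ideal_adjoin[OF W(1)]] saturation_idem[OF P]
      by (auto simp: F_def)
    ultimately show False using max[of "saturation P (adjoin W g)"] that by blast
  qed
  have "x * y \<in> W" if "x \<in> P" "y \<in> I" for x y
  proof (rule ccontr)
    assume n: "x * y \<notin> W"
    from big[OF n] that obtain u where "u \<notin> P" "u * y \<in> adjoin W (x * y)"
      by (auto simp: saturation_def)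
    then obtain w r where w: "w \<in> W" "u * y = w + r * (x * y)" by (auto simp: adjoin_def)
    \<comment> \<open>Since \<open>u\<close> is outside \<open>P\<close> and \<open>x\<close> is in
      \<open>P\<close>, the factor \<open>u - r * x\<close> is outside \<open>P\<close> and can be
      cancelled modulo the saturated ideal \<open>W\<close>.\<close>
    then have "(u - r * x) * y \<in> W" by (simp add: algebra_simps)
    moreover have "u - r * x \<notin> P"
    proof
      assume "u - r * x \<in> P"
      then have "(u - r * x) + r * x \<in> P"
        using that is_ideal_add is_ideal_mult_left is_prime_ideal[OF P] by blast
      with \<open>u \<notin> P\<close> show False by simp
    qed
    ultimately have "y \<in> W" using saturation_eqD[OF W(3)] by blast
    with n show False using is_ideal_mult_left[OF W(1)] by blast
  qed
  with hyp[OF W(1,2)] W(3,4) show False by blast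
qed

text \<open>A Noetherian local ring of dimension zero is Artinian; the proof is a Noetherian
  induction. An ideal maximal among those that lie below a non-stationary chain is prime, because a
  chain is stationary as soon as its sums with \<open>a\<close> and its colon ideals by
  \<open>a\<close> are. Hence this ideal is \<open>P\<close>, and the only saturated ideals above
  \<open>P\<close> are \<open>P\<close> and the whole ring.\<close>

lemma saturated_dcc:
  assumes P: "is_prime P" and J0: "is_ideal J0" "J \<subseteq> J0"
    and only: "\<And>W. is_prime W \<Longrightarrow> J0 \<subseteq> W \<Longrightarrow> W \<subseteq> P \<Longrightarrow> W = P"
    and K: "\<And>n. is_ideal (K n)" "\<And>n. J0 \<subseteq> K n" "\<And>n. saturation P (K n) = K n"
      "\<And>n. K (Suc n) \<subseteq> K n"
  shows "\<exists>N. \<forall>n\<ge>N. K n = K N"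
proof (rule ccontr)
  define seq where "seq I K \<longleftrightarrow> (\<forall>n. is_ideal (K n) \<and> I \<subseteq> K n \<and> saturation P (K n) = K n
      \<and> K (Suc n) \<subseteq> K n)" for I and K :: "nat \<Rightarrow> 'c set"
  define stable where "stable K \<longleftrightarrow> (\<exists>N. \<forall>n\<ge>N. K n = K N)" for K :: "nat \<Rightarrow> 'c set"
  define F where "F = {I. is_ideal I \<and> J0 \<subseteq> I \<and> saturation P I = I \<and> (\<exists>K. seq I K \<and> \<not> stable K)}"
  assume "\<not> ?thesis"
  then have "\<not> stable K" by (simp add: stable_def)
  have anti: "K m \<subseteq> K n" if "seq I K" "n \<le> m" for I K m n
    using lift_Suc_antimono_le[of K n m] that by (simp add: seq_def)
  have PI: "is_ideal P" by (rule is_prime_ideal[OF P])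
  have "saturation P J0 \<subseteq> K n" for n
    using saturation_mono[OF K(2), of P n] K(3) by simp
  then have "saturation P J0 \<in> F"
    using \<open>\<not> stable K\<close> K is_ideal_saturation[OF P J0(1)] saturation_idem[OF P, of J0]
      subset_saturation[OF P, of J0]
    unfolding F_def seq_def by blast
  then obtain I where "I \<in> F" and max: "\<And>V. V \<in> F \<Longrightarrow> I \<subseteq> V \<Longrightarrow> V = I"
    by (rule obtain_maximal[of _ F]) (use J0(2) in \<open>auto simp: F_def\<close>)
  then obtain K where I: "is_ideal I" "J0 \<subseteq> I" "saturation P I = I" and K: "seq I K" "\<not> stable K"
    by (auto simp: F_def)
  have st: "stable L" if "seq V L" "is_ideal V" "I \<subseteq> V" "saturation P V = V" "V \<noteq> I" for V L
  proof (rule ccontr)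
    assume "\<not> stable L"
    with that I have "V \<in> F" by (auto simp: F_def)
    with max that show False by blast
  qed
  have Kid: "is_ideal (K n)" and KI: "I \<subseteq> K n" and Ksat: "saturation P (K n) = K n"
    and Kdec: "K (Suc n) \<subseteq> K n" for n
    using K(1) by (auto simp: seq_def)
  have "1 \<notin> I"
  proof
    assume "1 \<in> I"
    then have "K n = UNIV" for n using is_ideal_one[OF Kid] KI by blast
    with K(2) show False by (auto simp: stable_def)
  qed
  have "a \<in> I \<or> b \<in> I" if ab: "a * b \<in> I" for a b
  proof (rule ccontr)
    assume n: "\<not> ?thesis"
    define V1 where "V1 = saturation P (adjoin I a)"
    define L1 where "L1 = (\<lambda>n. saturation P (adjoin (K n) a))"
    define V2 where "V2 = {x. x * a \<in> I}"
    define L2 where "L2 = (\<lambda>n. {x. x * a \<in> K n})"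
    have mono: "adjoin A a \<subseteq> adjoin B a" if "A \<subseteq> B" for A B
      using that by (auto simp: adjoin_def)
    have "seq V1 L1"
      unfolding seq_def V1_def L1_def
      by (simp add: saturation_idem[OF P] is_ideal_saturation[OF P is_ideal_adjoin[OF Kid]]
          saturation_mono[OF mono] KI Kdec)
    moreover have "is_ideal V1" "saturation P V1 = V1"
      using I P by (auto simp: V1_def saturation_idem is_ideal_saturation is_ideal_adjoin)
    moreover have "I \<subseteq> V1" "a \<in> V1"
      using subset_adjoin[of I a] mem_adjoin[OF I(1), of a] subset_saturation[OF P, of "adjoin I a"]
      by (auto simp: V1_def)
    ultimately have "stable L1" using st[of V1 L1] n by blast
    have ideal_colon: "is_ideal {x. x * a \<in> A}" if "is_ideal A" for A
      using that by (auto simp: is_ideal_def distrib_right mult.assoc)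
    have sat_colon: "saturation P {x. x * a \<in> A} = {x. x * a \<in> A}" if "saturation P A = A" for A
      using saturation_eqD[OF that] subset_saturation[OF P, of "{x. x * a \<in> A}"]
      by (auto simp: saturation_def mult.assoc)
    have "seq V2 L2"
      unfolding seq_def V2_def L2_def using subsetD[OF Kdec] subsetD[OF KI]
      by (auto simp: ideal_colon[OF Kid] sat_colon[OF Ksat])
    moreover have "is_ideal V2" "saturation P V2 = V2" "I \<subseteq> V2" "b \<in> V2"
      using I ab is_ideal_mult_right[OF I(1)]
      by (auto simp: V2_def ideal_colon sat_colon mult.commute)
    ultimately have "stable L2" using st[of V2 L2] n by blast
    then obtain N1 N2 where N1: "\<And>n. n \<ge> N1 \<Longrightarrow> L1 n = L1 N1" and N2: "\<And>n. n \<ge> N2 \<Longrightarrow> L2 n = L2 N2"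
      using \<open>stable L1\<close> by (auto simp: stable_def)
    have "K n = K (max N1 N2)" if le: "n \<ge> max N1 N2" for n
    proof
      show "K n \<subseteq> K (max N1 N2)" by (rule anti[OF K(1) le])
      show "K (max N1 N2) \<subseteq> K n"
      proof
        fix f assume f: "f \<in> K (max N1 N2)"
        then have "f \<in> L1 (max N1 N2)"
          using subset_adjoin[of "K (max N1 N2)" a] subset_saturation[OF P, of "adjoin (K (max N1 N2)) a"]
          by (auto simp: L1_def)
        then have "f \<in> L1 n" using N1[of n] N1[of "max N1 N2"] le by auto
        then obtain u k r where u: "u \<notin> P" "k \<in> K n" "u * f = k + r * a"
          by (auto simp: L1_def saturation_def adjoin_def)
        have "r * a = u * f - k" using u by simp
        also have "\<dots> \<in> K (max N1 N2)"
          by (intro is_ideal_diff[OF Kid] is_ideal_mult_left[OF Kid] f subsetD[OF anti[OF K(1) le] u(2)])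
        finally have "r \<in> L2 (max N1 N2)" by (simp add: L2_def)
        then have "r \<in> L2 n" using N2[of n] N2[of "max N1 N2"] le by auto
        then have "u * f \<in> K n" using u by (auto simp: L2_def intro!: is_ideal_add[OF Kid])
        then show "f \<in> K n" using saturation_eqD[OF Ksat u(1)] by blast
      qed
    qed
    then have "stable K" unfolding stable_def by blast
    with K(2) show False by simp
  qed
  then have "is_prime I" using I \<open>1 \<notin> I\<close> by (auto simp: is_prime_def)
  moreover have outside: "A = UNIV" if "is_ideal A" "saturation P A = A" "u \<in> A" "u \<notin> P" for A u
    using that saturation_eqD[of P A u 1] is_ideal_one[of A] by simp
  moreover have "I \<subseteq> P" using outside[OF I(1,3)] \<open>1 \<notin> I\<close> by auto
  ultimately have "I = P" using only I(2) by blast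
  have "K n = P \<or> K n = UNIV" for n
    using outside[OF Kid Ksat, of _ n] KI[of n] \<open>I = P\<close> by blast
  then have "stable K"
    unfolding stable_def using anti[OF K(1)] by (metis top.extremum_uniqueI subset_antisym)
  with K(2) show False by simp
qed

end

section \<open>The principal ideal theorem and regular systems of parameters\<close>

context noetherian_above
begin

text \<open>Krull's theorem as an exchange: the middle prime can be traded for one that contains
  \<open>x\<close>. If no such \<open>W\<close> existed, \<open>P2\<close> would be minimal over
  \<open>P0\<close> and \<open>x\<close>, and Krull's argument with symbolic powers would push
  \<open>P1\<close> into \<open>P0\<close>.\<close>

lemma krull_principal_ideal:
  assumes P: "is_prime P0" "is_prime P1" "is_prime P2" and lt: "P0 \<subset> P1" "P1 \<subset> P2"
    and J: "J \<subseteq> P0" and x: "x \<in> P2" "x \<notin> P1"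
  shows "\<exists>W. is_prime W \<and> P0 \<subset> W \<and> W \<subset> P2 \<and> x \<in> W"
proof (rule ccontr)
  assume neg: "\<not> ?thesis"
  have idl: "is_ideal P0" "is_ideal P1" "is_ideal P2" using P is_prime_ideal by auto
  define J0 where "J0 = adjoin P0 x"
  define G where "G A = ideal_gen (P0 \<union> {y * z | y z. y \<in> P1 \<and> z \<in> A})" for A
  \<comment> \<open>\<open>N n\<close> is the \<open>n\<close>-th symbolic power of
    \<open>P1\<close> modulo \<open>P0\<close>. Saturation at \<open>P1\<close> makes
    \<open>x\<close>, which is outside \<open>P1\<close>, cancellable modulo every
    \<open>N n\<close>.\<close>
  define N where "N = rec_nat UNIV (\<lambda>_ A. saturation P1 (G A))"
  have N0: "N 0 = UNIV" and NS: "N (Suc n) = saturation P1 (G (N n))" for n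
    by (simp_all add: N_def)
  have GI: "is_ideal (G A)" for A by (simp add: G_def is_ideal_gen)
  have PG: "P0 \<subseteq> G A" and PGm: "y \<in> P1 \<Longrightarrow> z \<in> A \<Longrightarrow> y * z \<in> G A" for A y z
    using subset_ideal_gen[of "P0 \<union> {y * z | y z. y \<in> P1 \<and> z \<in> A}"] by (auto simp: G_def)
  have NI: "is_ideal (N n)" for n
    by (cases n) (simp_all add: N0 NS is_ideal_UNIV is_ideal_saturation P GI)
  have N1: "saturation P1 (N n) = N n" for n
    using subset_saturation[OF P(2), of UNIV] by (cases n) (auto simp: N0 NS saturation_idem P)
  have N2: "saturation P2 (N n) = N n" for n
    using N1[of n] saturation_anti[of P1 P2 "N n"] lt subset_saturation[OF P(3), of "N n"] by auto
  have PN: "P0 \<subseteq> N n" for n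
    using PG subset_saturation[OF P(2)] by (cases n) (auto simp: N0 NS)
  have ND: "N (Suc n) \<subseteq> N n" for n
  proof -
    have "P0 \<union> {y * z |y z. y \<in> P1 \<and> z \<in> N n} \<subseteq> N n"
      using PN is_ideal_mult_left[OF NI] by auto
    then have "G (N n) \<subseteq> N n" unfolding G_def by (rule ideal_gen_least[OF NI])
    from saturation_mono[OF this, of P1] show ?thesis by (simp add: NS N1)
  qed
  define K where "K n = saturation P2 (adjoin (N n) x)" for n
  have J0: "is_ideal J0" "J \<subseteq> J0"
    using J subset_adjoin[of P0 x] by (auto simp: J0_def is_ideal_adjoin idl)
  have J0K: "J0 \<subseteq> K n" for n
  proof -
    have "J0 \<subseteq> adjoin (N n) x"
      unfolding J0_def
      using subset_adjoin[of "N n" x] PN[of n] mem_adjoin[OF NI]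
      by (intro adjoin_least is_ideal_adjoin NI) auto
    then show ?thesis using subset_saturation[OF P(3)] unfolding K_def by blast
  qed
  have Kdec: "K (Suc n) \<subseteq> K n" for n
    unfolding K_def by (rule saturation_mono) (use ND in \<open>auto simp: adjoin_def\<close>)
  have only: "W = P2" if "is_prime W" "J0 \<subseteq> W" "W \<subseteq> P2" for W
  proof -
    have "x \<in> W" "P0 \<subset> W"
      using that(2) subset_adjoin[of P0 x] mem_adjoin[OF idl(1), of x] x(2) lt by (auto simp: J0_def)
    with neg that show ?thesis by blast
  qed
  have "\<exists>n. \<forall>k\<ge>n. K k = K n"
    by (rule saturated_dcc[OF P(3) J0 only])
      (use J0K Kdec in \<open>auto simp: K_def saturation_idem P is_ideal_saturation is_ideal_adjoin NI\<close>)
  then obtain n where n: "K (Suc n) = K n" by (metis le_Suc_eq order_refl)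
  \<comment> \<open>Stability of \<open>K\<close> gives \<open>N n = N (Suc n) + x N n\<close>
    locally at \<open>P2\<close>, and \<open>x\<close> lies in \<open>P2\<close>.\<close>
  have "N n \<subseteq> saturation P2 (N (Suc n))"
  proof (rule nakayama[OF P(3) NI])
    show "J \<subseteq> N (Suc n)" using J PN by blast
    fix W assume W: "is_ideal W" "N (Suc n) \<subseteq> W" "\<And>x y. x \<in> P2 \<Longrightarrow> y \<in> N n \<Longrightarrow> x * y \<in> W"
    show "N n \<subseteq> saturation P2 W"
    proof
      fix f assume f: "f \<in> N n"
      then have "f \<in> K n" 
        using subset_adjoin[of "N n" x] subset_saturation[OF P(3), of "adjoin (N n) x"]
        by (auto simp: K_def)
      then obtain u g h where u: "u \<notin> P2" "g \<in> N (Suc n)" "u * f = g + h * x"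
        unfolding n[symmetric] by (auto simp: K_def saturation_def adjoin_def)
      have "x * h = u * f - g" using u by (simp add: mult.commute)
      also have "\<dots> \<in> N n"
        by (intro is_ideal_diff[OF NI] is_ideal_mult_left[OF NI] f subsetD[OF ND u(2)])
      finally have "h \<in> N n" using saturation_eqD[OF N1 x(2)] by blast
      then have "u * f \<in> W"
        using u(2,3) W x by (auto simp: mult.commute[of h] intro!: is_ideal_add[OF W(1)])
      then show "f \<in> saturation P2 W" using u(1) by (auto simp: saturation_def)
    qed
  qed
  then have step: "N n \<subseteq> N (Suc n)" by (simp add: N2)
  \<comment> \<open>Locally at \<open>P1\<close> the ideal \<open>N n\<close> is now contained in
    \<open>P0 + P1 N n\<close>, so Nakayama at \<open>P1\<close> leaves only
    \<open>P0\<close>.\<close>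
  have "N n \<subseteq> saturation P1 P0"
  proof (rule nakayama[OF P(2) idl(1) J])
    fix W assume W: "is_ideal W" "P0 \<subseteq> W" "\<And>x y. x \<in> P1 \<Longrightarrow> y \<in> N n \<Longrightarrow> x * y \<in> W"
    have "G (N n) \<subseteq> W"
      unfolding G_def by (rule ideal_gen_least[OF W(1)]) (use W in auto)
    from saturation_mono[OF this, of P1] show "N n \<subseteq> saturation P1 W"
      using step by (simp add: NS)
  qed
  then have "N n \<subseteq> P0" using saturation_prime[OF P(1,2)] lt by auto
  moreover have "a ^ n \<in> N n" if "a \<in> P1" for a
    by (induction n) (auto simp: N0 NS intro!: subsetD[OF subset_saturation[OF P(2)]] PGm that)
  ultimately have "P1 \<subseteq> P0" using is_prime_power[OF P(1)] by blast
  with lt show False by blast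
qed

end

section \<open>Chains of primes and regular systems of parameters\<close>

inductive prime_chain :: "nat \<Rightarrow> 'c::comm_ring_1 set \<Rightarrow> 'c set \<Rightarrow> bool" where
  prime_chain_0: "is_prime A \<Longrightarrow> prime_chain 0 A A"
| prime_chain_Suc: "prime_chain n A B \<Longrightarrow> is_prime B' \<Longrightarrow> B \<subset> B' \<Longrightarrow> prime_chain (Suc n) A B'"

inductive_cases prime_chain_0E: "prime_chain 0 A B"
inductive_cases prime_chain_SucE: "prime_chain (Suc n) A B"

lemma prime_chain_primes: "prime_chain n A B \<Longrightarrow> is_prime A \<and> is_prime B \<and> A \<subseteq> B"
  by (induction rule: prime_chain.induct) auto

context noetherian_above
begin

text \<open>Exchanging primes from the top downwards pushes \<open>x\<close> into ever lower members
  of the chain. Once the member next to \<open>A\<close> contains \<open>x\<close>, the bottom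
  \<open>A\<close> is dropped at the cost of one step.\<close>

lemma prime_chain_refine:
  assumes "prime_chain (Suc n) A B" "J \<subseteq> A" "x \<in> B"
  shows "\<exists>A'. A \<subset> A' \<and> x \<in> A' \<and> prime_chain n A' B"
  using assms
proof (induction n arbitrary: B)
  case 0
  from 0(1) obtain B' where B': "prime_chain 0 A B'" "is_prime B" "B' \<subset> B"
    by (rule prime_chain_SucE)
  then have "B' = A" by (blast elim: prime_chain_0E)
  with B' 0 show ?case by (blast intro: prime_chain_0)
next
  case (Suc n)
  from Suc.prems(1) obtain B1 where B1: "prime_chain (Suc n) A B1" "is_prime B" "B1 \<subset> B"
    by (rule prime_chain_SucE)
  from B1(1) obtain B2 where B2: "prime_chain n A B2" "is_prime B1" "B2 \<subset> B1"
    by (rule prime_chain_SucE)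
  have "\<exists>B'. prime_chain (Suc n) A B' \<and> B' \<subset> B \<and> x \<in> B'"
  proof (cases "x \<in> B1")
    case True
    with B1 show ?thesis by blast
  next
    case False
    have "is_prime B2" "J \<subseteq> B2" using prime_chain_primes[OF B2(1)] Suc.prems(2) by auto
    from krull_principal_ideal[OF this(1) B2(2) B1(2) B2(3) B1(3) this(2) Suc.prems(3) False]
    show ?thesis using B2(1) prime_chain_Suc by blast
  qed
  then obtain B' where B': "prime_chain (Suc n) A B'" "B' \<subset> B" "x \<in> B'" by blast
  from Suc.IH[OF B'(1) Suc.prems(2) B'(3)] show ?case
    using B'(2) B1(2) prime_chain_Suc by blast
qed

end

locale local_above = noetherian_above J for J :: "'c::comm_ring_1 set" +
  fixes \<mm> :: "'c set"
  assumes ideal_J: "is_ideal J" and prime_m: "is_prime \<mm>" and J_le_m: "J \<subseteq> \<mm>"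
    and inverse_mod: "u \<notin> \<mm> \<Longrightarrow> \<exists>v. u * v - 1 \<in> J"
begin

lemma ideal_m: "is_ideal \<mm>"
  by (rule is_prime_ideal[OF prime_m])

lemma saturation_m:
  assumes "is_ideal I" "J \<subseteq> I"
  shows "saturation \<mm> I = I"
proof
  show "saturation \<mm> I \<subseteq> I"
  proof
    fix r assume "r \<in> saturation \<mm> I"
    then obtain u where u: "u \<notin> \<mm>" "u * r \<in> I" by (auto simp: saturation_def)
    then obtain v where v: "u * v - 1 \<in> I" using inverse_mod assms by blast
    have "v * (u * r) - r * (u * v - 1) \<in> I"
      by (rule is_ideal_diff[OF assms(1) is_ideal_mult_left[OF assms(1) u(2)]
            is_ideal_mult_left[OF assms(1) v]])
    then show "r \<in> I" by (simp add: algebra_simps)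
  qed
qed (rule subset_saturation[OF prime_m])

lemma local_nakayama:
  assumes "is_ideal Q" "J \<subseteq> Q" "is_ideal I" "x \<in> \<mm>"
    and "\<And>f. f \<in> I \<Longrightarrow> \<exists>q\<in>Q. \<exists>g\<in>I. f = q + x * g"
  shows "I \<subseteq> Q"
proof -
  have "I \<subseteq> saturation \<mm> Q"
  proof (rule nakayama[OF prime_m assms(1,2)])
    fix W assume W: "is_ideal W" "Q \<subseteq> W" "\<And>x y. x \<in> \<mm> \<Longrightarrow> y \<in> I \<Longrightarrow> x * y \<in> W"
    have "I \<subseteq> W"
    proof
      fix f assume "f \<in> I"
      with assms(5) obtain q g where "q \<in> Q" "g \<in> I" "f = q + x * g" by blast
      with W assms(4) show "f \<in> W" by (auto intro!: is_ideal_add[OF W(1)])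
    qed
    then show "I \<subseteq> saturation \<mm> W" using subset_saturation[OF prime_m] by blast
  qed
  then show ?thesis by (simp add: saturation_m assms)
qed

end

text \<open>A regular system of parameters \<open>x\<close>, read from the last one: \<open>I k\<close> is generated by \<open>J\<close>
  and the \<open>x i\<close> with \<open>k \<le> i < d\<close>.\<close>

locale regular_parameters = local_above J \<mm> for J \<mm> :: "'c::comm_ring_1 set" +
  fixes d :: nat and x :: "nat \<Rightarrow> 'c" and I :: "nat \<Rightarrow> 'c set" and A0 :: "'c set"
  assumes ideal_I: "k \<le> d \<Longrightarrow> is_ideal (I k)"
    and I_0: "I 0 = \<mm>" and I_d: "I d = J" and I_step: "k < d \<Longrightarrow> I k = adjoin (I (Suc k)) (x k)"
    and chain: "prime_chain d A0 \<mm>" and J_le_A0: "J \<subseteq> A0"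
begin

lemma J_le_I: "k \<le> d \<Longrightarrow> J \<subseteq> I k"
proof (induction k rule: inc_induct)
  case (step n)
  then show ?case using I_step subset_adjoin by blast
qed (simp add: I_d)

lemma I_le_m: "k \<le> d \<Longrightarrow> I k \<subseteq> \<mm>"
proof (induction k)
  case (Suc k)
  then show ?case using I_step[of k] subset_adjoin[of "I (Suc k)" "x k"] by auto
qed (simp add: I_0)

lemma x_in_m: "k < d \<Longrightarrow> x k \<in> \<mm>"
  using I_step[of k] mem_adjoin[OF ideal_I, of "Suc k" "x k"] I_le_m[of k] by auto

text \<open>Each parameter accounts for at most one step of a chain, which is the usual bound of the
  dimension by the number of generators. The equality case is the point: a chain of full length has
  no choice for its bottom prime, and this later makes the ideals \<open>I k\<close> prime.\<close>

lemma chain_length_le: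
  assumes "k \<le> d" "prime_chain n A \<mm>" "I k \<subseteq> A"
  shows "n \<le> k \<and> (n = k \<longrightarrow> A = I k)"
  using assms
proof (induction k arbitrary: n A)
  case 0
  have "A = \<mm>" using 0 prime_chain_primes[of n A \<mm>] by (auto simp: I_0)
  moreover have "n = 0"
  proof (cases n)
    case (Suc n')
    have "prime_chain (Suc n') \<mm> \<mm>" using 0(2) Suc \<open>A = \<mm>\<close> by simp
    then obtain B where "prime_chain n' \<mm> B" "B \<subset> \<mm>"
      by (rule prime_chain_SucE)
    then show ?thesis using prime_chain_primes[of n' \<mm> B] by blast
  qed
  ultimately show ?case by (simp add: I_0)
next
  case (Suc k)
  have A: "is_prime A" "A \<subseteq> \<mm>" using prime_chain_primes[OF Suc.prems(2)] by auto
  then have idA: "is_ideal A" by (simp add: is_prime_ideal)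
  have JA: "J \<subseteq> A" using J_le_I[of "Suc k"] Suc.prems by auto
  have Ik: "I k = adjoin (I (Suc k)) (x k)" using Suc.prems I_step by auto
  show ?case
  proof (cases n)
    case (Suc n')
    show ?thesis
    proof (cases "x k \<in> A")
      case True
      then have "I k \<subseteq> A" unfolding Ik by (intro adjoin_least idA Suc.prems)
      then show ?thesis using Suc.IH[of n A] Suc.prems by auto
    next
      case False
      have xm: "x k \<in> \<mm>" using x_in_m Suc.prems by auto
      obtain A' where A': "A \<subset> A'" "x k \<in> A'" "prime_chain n' A' \<mm>"
        using prime_chain_refine[of n' A \<mm> "x k"] Suc.prems(2) Suc JA xm by auto
      have "I k \<subseteq> A'"
        unfolding Ik using A' Suc.prems(3) prime_chain_primes[OF A'(3)]
        by (intro adjoin_least) (auto simp: is_prime_ideal)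
      then have le: "n' \<le> k" "n' = k \<Longrightarrow> A' = I k" using Suc.IH[of n' A'] A' Suc.prems by auto
      have "A = I (Suc k)" if "n' = k"
      proof
        \<comment> \<open>As \<open>x k\<close> is outside the prime \<open>A\<close>, the cofactor
          \<open>r\<close> lies in \<open>A\<close>. So \<open>A = I (Suc k) + x k A\<close>, and
          Nakayama removes the second summand.\<close>
        have "\<exists>q\<in>I (Suc k). \<exists>g\<in>A. f = q + x k * g" if f: "f \<in> A" for f
        proof -
          have "f \<in> I k" using f A' le(2) \<open>n' = k\<close> by auto
          then obtain i r where i: "i \<in> I (Suc k)" "f = i + r * x k"
            unfolding Ik by (auto simp: adjoin_def)
          then have "r * x k \<in> A" using is_ideal_diff[OF idA f, of i] Suc.prems(3) by auto
          then have "r \<in> A" using A(1) False by (auto simp: is_prime_def)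
          with i show ?thesis by (auto simp: mult.commute)
        qed
        then show "A \<subseteq> I (Suc k)"
          using local_nakayama[OF ideal_I J_le_I idA xm, of "Suc k"] Suc.prems(1) by auto
      qed (use Suc.prems in auto)
      with le Suc show ?thesis by auto
    qed
  qed simp
qed

text \<open>The equality case forces the given chain to start at \<open>J\<close>. Going down from
  \<open>d\<close>, every refinement by \<open>x k\<close> loses one step and is again of full
  length, so its new bottom must be \<open>I k\<close>.\<close>

lemma chain_from_I: "k \<le> d \<Longrightarrow> prime_chain k (I k) \<mm>"
proof (induction k rule: inc_induct)
  case base
  have "A0 = I d" using chain_length_le[OF le_refl chain] J_le_A0 by (auto simp: I_d)
  with chain show ?case by simp
next
  case (step k)
  have xm: "x k \<in> \<mm>" and JI: "J \<subseteq> I (Suc k)" and Ik: "I k = adjoin (I (Suc k)) (x k)"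
    using step.hyps x_in_m J_le_I I_step by auto
  obtain A' where A': "I (Suc k) \<subset> A'" "x k \<in> A'" "prime_chain k A' \<mm>"
    using prime_chain_refine[OF step.IH JI xm] by blast
  have "is_ideal A'" using prime_chain_primes[OF A'(3)] is_prime_ideal by blast
  then have "I k \<subseteq> A'" unfolding Ik using A' by (intro adjoin_least) auto
  with chain_length_le[of k k A'] A'(3) step.hyps have "A' = I k" by simp
  with A'(3) show ?case by simp
qed

lemma prime_I: "k \<le> d \<Longrightarrow> is_prime (I k)"
  using chain_from_I prime_chain_primes by blast

text \<open>Otherwise \<open>I k\<close> and \<open>I (Suc k)\<close> would coincide, and a chain of
  length \<open>k + 1\<close> would start at \<open>I k\<close>, one step more than
  \<open>chain_length_le\<close> permits.\<close>

lemma x_notin_I: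
  assumes "k < d"
  shows "x k \<notin> I (Suc k)"
proof
  assume "x k \<in> I (Suc k)"
  then have "I k = I (Suc k)"
    using assms subset_adjoin[of "I (Suc k)" "x k"] adjoin_least[OF ideal_I[of "Suc k"], of "I (Suc k)" "x k"]
    by (auto simp: I_step)
  moreover have "prime_chain (Suc k) (I (Suc k)) \<mm>" using assms by (intro chain_from_I) simp
  ultimately show False using chain_length_le[of k "Suc k" "I (Suc k)"] assms by auto
qed

end

section \<open>Linear combinations of monomials with \<open>q\<close>-th powers as coefficients\<close>

text \<open>The error is kept as a multiple of \<open>p\<close> because the ambient ring need not
  have characteristic \<open>p\<close>; it is only its quotient by \<open>J\<close> in which
  \<open>p\<close> vanishes.\<close>

lemma freshmans_dream_mod:
  fixes x y :: "'c::comm_ring_1"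
  assumes "Factorial_Ring.prime p"
  shows "\<exists>w. (x + y) ^ p = x ^ p + y ^ p + of_nat p * w"
proof -
  have p: "p > 0" using assms prime_gt_0_nat by blast
  have "\<exists>w. of_nat (p choose k) * x ^ k * y ^ (p - k) = of_nat p * w" if "k \<in> {1..<p}" for k
  proof -
    have "p dvd (p choose k)" using that assms by (intro dvd_choose_prime) auto
    then obtain t where "p choose k = p * t" by blast
    then show ?thesis by (auto intro!: exI[of _ "of_nat t * x ^ k * y ^ (p - k)"] simp: mult_ac)
  qed
  then obtain w where w: "\<And>k. k \<in> {1..<p} \<Longrightarrow> of_nat (p choose k) * x ^ k * y ^ (p - k) = of_nat p * w k"
    by metis
  have "(x + y) ^ p = (\<Sum>k\<le>p. of_nat (p choose k) * x ^ k * y ^ (p - k))" by (rule binomial_ring)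
  also have "{..p} = insert 0 (insert p {1..<p})" using p by auto
  also have "(\<Sum>k\<in>\<dots>. of_nat (p choose k) * x ^ k * y ^ (p - k))
      = y ^ p + (x ^ p + (\<Sum>k=1..<p. of_nat (p choose k) * x ^ k * y ^ (p - k)))"
    using p by simp
  also have "(\<Sum>k=1..<p. of_nat (p choose k) * x ^ k * y ^ (p - k)) = of_nat p * (\<Sum>k=1..<p. w k)"
    by (simp add: w sum_distrib_left)
  finally show ?thesis by (auto simp: add_ac)
qed

lemma is_ideal_power_diff:
  assumes "is_ideal K" "x - y \<in> K"
  shows "x ^ n - y ^ n \<in> K"
proof (induction n)
  case (Suc n)
  have "x ^ Suc n - y ^ Suc n = x * (x ^ n - y ^ n) + y ^ n * (x - y)" by (simp add: algebra_simps)
  also have "\<dots> \<in> K" by (intro is_ideal_add is_ideal_mult_left assms Suc)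
  finally show ?case .
qed (simp add: is_ideal_zero assms)

lemma is_ideal_diff_trans:
  assumes "is_ideal K" "x - y \<in> K" "y - z \<in> K"
  shows "x - z \<in> K"
  using is_ideal_add[OF assms] by simp

lemma is_ideal_diff_commute: "is_ideal K \<Longrightarrow> x - y \<in> K \<Longrightarrow> y - x \<in> K"
  using is_ideal_uminus[of K "x - y"] by simp

lemma is_ideal_diff_iff: "is_ideal K \<Longrightarrow> x - y \<in> K \<Longrightarrow> x \<in> K \<longleftrightarrow> y \<in> K"
  using is_ideal_add[of K "x - y" y] is_ideal_diff[of K x "x - y"] by auto

text \<open>The coefficients are indexed by exponent lists; the head of a list is the exponent of the last
  variable \<open>z (N - 1)\<close>.\<close>

primrec lin :: "(nat \<Rightarrow> 'c::comm_ring_1) \<Rightarrow> nat \<Rightarrow> nat \<Rightarrow> (nat list \<Rightarrow> 'c) \<Rightarrow> 'c" where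
  "lin z q 0 c = c [] ^ q"
| "lin z q (Suc N) c = (\<Sum>j<q. lin z q N (\<lambda>bs. c (j # bs)) * z N ^ j)"

definition idx :: "nat \<Rightarrow> nat \<Rightarrow> nat list set" where
  "idx q N = {b. length b = N \<and> set b \<subseteq> {..<q}}"

lemma idx_0 [simp]: "idx q 0 = {[]}"
  by (auto simp: idx_def)

lemma Cons_idx_Suc [simp]: "j # bs \<in> idx q (Suc N) \<longleftrightarrow> j < q \<and> bs \<in> idx q N"
  by (auto simp: idx_def)

lemma idx_SucE:
  assumes "b \<in> idx q (Suc N)"
  obtains j bs where "b = j # bs" "j < q" "bs \<in> idx q N"
  using assms by (cases b) (auto simp: idx_def)

text \<open>Linear independence of the monomials over the \<open>q\<close>-th powers modulo
  \<open>K\<close>. Asking for \<open>c b\<close> in \<open>K\<close>, and not merely for its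
  \<open>q\<close>-th power, is what will make the coefficients themselves unique.\<close>

definition indep :: "(nat \<Rightarrow> 'c::comm_ring_1) \<Rightarrow> nat \<Rightarrow> nat \<Rightarrow> 'c set \<Rightarrow> bool" where
  "indep z q N K \<longleftrightarrow> (\<forall>c. lin z q N c \<in> K \<longrightarrow> (\<forall>b\<in>idx q N. c b \<in> K))"

definition lin_span :: "(nat \<Rightarrow> 'c::comm_ring_1) \<Rightarrow> nat \<Rightarrow> nat \<Rightarrow> 'c set \<Rightarrow> 'c set" where
  "lin_span z q N K = {s. \<exists>c. s - lin z q N c \<in> K}"

lemma lin_cong_vars: "(\<And>i. i < N \<Longrightarrow> z i = z' i) \<Longrightarrow> lin z q N c = lin z' q N c"
  by (induction N arbitrary: c) auto

lemma lin_cong_mod: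
  assumes "is_ideal K" "\<And>b. b \<in> idx q N \<Longrightarrow> c b - d b \<in> K"
  shows "lin z q N c - lin z q N d \<in> K"
  using assms(2)
proof (induction N arbitrary: c d)
  case 0
  then show ?case using is_ideal_power_diff[OF assms(1)] by simp
next
  case (Suc N)
  have "lin z q (Suc N) c - lin z q (Suc N) d =
      (\<Sum>j<q. (lin z q N (\<lambda>bs. c (j # bs)) - lin z q N (\<lambda>bs. d (j # bs))) * z N ^ j)"
    by (simp add: sum_subtractf left_diff_distrib)
  also have "\<dots> \<in> K"
    by (intro is_ideal_sum is_ideal_mult_right assms(1) Suc.IH) (auto intro: Suc.prems)
  finally show ?case .
qed

lemma lin_scale: "lin z q N (\<lambda>b. r * c b) = r ^ q * lin z q N c"
  by (induction N arbitrary: c) (simp_all add: power_mult_distrib sum_distrib_left mult.assoc)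

lemma lin_zero: "q > 0 \<Longrightarrow> lin z q N (\<lambda>b. 0) = 0"
  by (induction N) (auto simp: zero_power)

text \<open>The coefficients after multiplication by \<open>z i\<close>. An exponent that reaches
  \<open>q\<close> returns to 0, and \<open>z N ^ q\<close> enters the coefficient as
  \<open>z N\<close>, because coefficients are raised to the power \<open>q\<close>.\<close>

fun shift :: "(nat \<Rightarrow> 'c::comm_ring_1) \<Rightarrow> nat \<Rightarrow> nat \<Rightarrow> nat \<Rightarrow> (nat list \<Rightarrow> 'c) \<Rightarrow> nat list \<Rightarrow> 'c" where
  "shift z q i (Suc N) c (j # bs) =
    (if i = N then (if j = 0 then z N * c ((q - 1) # bs) else c ((j - 1) # bs))
     else shift z q i N (\<lambda>bs. c (j # bs)) bs)"
| "shift z q i _ c _ = c []"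

lemma lin_shift:
  assumes "i < N" "q > 0"
  shows "lin z q N (shift z q i N c) = z i * lin z q N c"
  using assms(1)
proof (induction N arbitrary: c)
  case (Suc N)
  show ?case
  proof (cases "i = N")
    case True
    obtain q' where q': "q = Suc q'" using assms(2) by (cases q) auto
    have "lin z q (Suc N) (shift z q i (Suc N) c) =
        lin z q N (\<lambda>bs. z N * c (q' # bs)) + (\<Sum>j<q'. lin z q N (\<lambda>bs. c (j # bs)) * z N ^ Suc j)"
      unfolding lin.simps q' sum.lessThan_Suc_shift by (simp add: True q')
    also have "\<dots> = (\<Sum>j<Suc q'. lin z q N (\<lambda>bs. c (j # bs)) * z N ^ Suc j)"
      by (simp add: lin_scale q' mult_ac)
    also have "\<dots> = z i * lin z q (Suc N) c"
      unfolding lin.simps q' True sum_distrib_left by (intro sum.cong) (simp_all add: mult_ac)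
    finally show ?thesis .
  next
    case False
    then show ?thesis using Suc by (simp add: sum_distrib_left mult_ac)
  qed
qed simp

text \<open>An induction principle for what is generated by \<open>q\<close>-th powers and
  variables. It serves for the spans, and later for the set of elements whose commutator with an
  operator has small order.\<close>

lemma lin_mult_closed:
  assumes X: "0 \<in> X" "\<And>x y. x \<in> X \<Longrightarrow> y \<in> X \<Longrightarrow> x + y \<in> X" "\<And>r x. x \<in> X \<Longrightarrow> r ^ q * x \<in> X"
    "\<And>i x. i < N \<Longrightarrow> x \<in> X \<Longrightarrow> z i * x \<in> X"
  shows "x \<in> X \<Longrightarrow> lin z q N c * x \<in> X"
  using X(4)
proof (induction N arbitrary: c)
  case 0
  then show ?case using X(3) by simp
next
  case (Suc N)
  have pow: "z N ^ j * y \<in> X" if "y \<in> X" for j y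
    by (induction j) (auto simp: mult.assoc that intro: Suc.prems)
  have sum: "sum f A \<in> X" if "\<And>j. j \<in> A \<Longrightarrow> f j \<in> X" for f and A :: "nat set"
    using that by (induction A rule: infinite_finite_induct) (auto intro: X)
  have "lin z q (Suc N) c * x = (\<Sum>j<q. z N ^ j * (lin z q N (\<lambda>bs. c (j # bs)) * x))"
    unfolding lin.simps sum_distrib_right by (intro sum.cong) (simp_all add: mult_ac)
  also have "\<dots> \<in> X" by (intro sum pow Suc.IH) (auto intro: Suc.prems)
  finally show ?case .
qed

section \<open>Frobenius modulo an ideal that contains p\<close>

locale char_p_above = local_above J \<mm> for J \<mm> :: "'c::comm_ring_1 set" +
  fixes p :: nat
  assumes prime_p: "Factorial_Ring.prime p" and p_in_J: "of_nat p \<in> J"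
begin

lemma frob_add: "(x + y) ^ (p ^ e) - (x ^ (p ^ e) + y ^ (p ^ e)) \<in> J"
proof (induction e)
  case (Suc e)
  have *: "(a + b) ^ p - (a ^ p + b ^ p) \<in> J" for a b
  proof -
    obtain w where "(a + b) ^ p = a ^ p + b ^ p + of_nat p * w"
      using freshmans_dream_mod[OF prime_p] by blast
    then show ?thesis by (simp add: is_ideal_mult_right ideal_J p_in_J)
  qed
  have "((x + y) ^ (p ^ e)) ^ p - (x ^ (p ^ e) + y ^ (p ^ e)) ^ p \<in> J"
    by (rule is_ideal_power_diff[OF ideal_J Suc])
  from is_ideal_diff_trans[OF ideal_J this *] show ?case
    by (simp add: power_mult[symmetric] mult.commute)
qed (simp add: is_ideal_zero ideal_J)

lemma q_pos: "p ^ e > 0"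
  using prime_gt_0_nat[OF prime_p] by simp

lemma lin_add: "lin z (p ^ e) N (\<lambda>b. c b + d b) - (lin z (p ^ e) N c + lin z (p ^ e) N d) \<in> J"
proof (induction N arbitrary: c d)
  case 0
  then show ?case using frob_add by simp
next
  case (Suc N)
  have "lin z (p ^ e) (Suc N) (\<lambda>b. c b + d b) - (lin z (p ^ e) (Suc N) c + lin z (p ^ e) (Suc N) d) =
      (\<Sum>j<p ^ e. (lin z (p ^ e) N (\<lambda>bs. c (j # bs) + d (j # bs))
        - (lin z (p ^ e) N (\<lambda>bs. c (j # bs)) + lin z (p ^ e) N (\<lambda>bs. d (j # bs)))) * z N ^ j)"
    by (simp add: sum_subtractf sum.distrib left_diff_distrib distrib_right)
  also have "\<dots> \<in> J"
    by (intro is_ideal_sum is_ideal_mult_right ideal_J Suc.IH)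
  finally show ?case .
qed

lemma lin_sum:
  assumes "finite A"
  shows "lin z (p ^ e) N (\<lambda>b. \<Sum>a\<in>A. c a b) - (\<Sum>a\<in>A. lin z (p ^ e) N (c a)) \<in> J"
  using assms
proof (induction A)
  case empty
  then show ?case by (simp add: lin_zero[OF q_pos] is_ideal_zero ideal_J)
next
  case (insert a A)
  have "(lin z (p ^ e) N (\<lambda>b. c a b + (\<Sum>a\<in>A. c a b))
        - (lin z (p ^ e) N (c a) + lin z (p ^ e) N (\<lambda>b. \<Sum>a\<in>A. c a b)))
      + (lin z (p ^ e) N (\<lambda>b. \<Sum>a\<in>A. c a b) - (\<Sum>a\<in>A. lin z (p ^ e) N (c a))) \<in> J"
    by (rule is_ideal_add[OF ideal_J lin_add insert.IH])
  then show ?case using insert by (simp add: algebra_simps)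
qed

lemma frob_diff: "(x - y) ^ (p ^ e) - (x ^ (p ^ e) - y ^ (p ^ e)) \<in> J"
  using is_ideal_uminus[OF ideal_J frob_add[of "x - y" y e]] by (simp add: algebra_simps)

lemma lin_diff: "lin z (p ^ e) N (\<lambda>b. c b - d b) - (lin z (p ^ e) N c - lin z (p ^ e) N d) \<in> J"
  using is_ideal_uminus[OF ideal_J lin_add[of z e N "\<lambda>b. c b - d b" d]] by (simp add: algebra_simps)

context
  fixes K assumes K: "is_ideal K" "J \<subseteq> K"
begin

lemma lin_span_add:
  assumes "s \<in> lin_span z (p ^ e) N K" "t \<in> lin_span z (p ^ e) N K"
  shows "s + t \<in> lin_span z (p ^ e) N K"
proof -
  obtain c d where cd: "s - lin z (p ^ e) N c \<in> K" "t - lin z (p ^ e) N d \<in> K"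
    using assms by (auto simp: lin_span_def)
  have "((s - lin z (p ^ e) N c) + (t - lin z (p ^ e) N d))
      - (lin z (p ^ e) N (\<lambda>b. c b + d b) - (lin z (p ^ e) N c + lin z (p ^ e) N d)) \<in> K"
    by (rule is_ideal_diff[OF K(1) is_ideal_add[OF K(1) cd] subsetD[OF K(2) lin_add]])
  then have "(s + t) - lin z (p ^ e) N (\<lambda>b. c b + d b) \<in> K" by (simp add: algebra_simps)
  then show ?thesis by (auto simp: lin_span_def)
qed

lemma lin_span_scale:
  assumes "s \<in> lin_span z q N K"
  shows "r ^ q * s \<in> lin_span z q N K"
proof -
  obtain c where "s - lin z q N c \<in> K" using assms by (auto simp: lin_span_def)
  then have "r ^ q * (s - lin z q N c) \<in> K" by (rule is_ideal_mult_left[OF K(1)])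
  then have "r ^ q * s - lin z q N (\<lambda>b. r * c b) \<in> K" by (simp add: lin_scale algebra_simps)
  then show ?thesis by (auto simp: lin_span_def)
qed

lemma lin_span_var:
  assumes "s \<in> lin_span z q N K" "i < N" "q > 0"
  shows "z i * s \<in> lin_span z q N K"
proof -
  obtain c where "s - lin z q N c \<in> K" using assms by (auto simp: lin_span_def)
  then have "z i * (s - lin z q N c) \<in> K" by (rule is_ideal_mult_left[OF K(1)])
  then have "z i * s - lin z q N (shift z q i N c) \<in> K" by (simp add: lin_shift assms algebra_simps)
  then show ?thesis by (auto simp: lin_span_def)
qed

lemma lin_span_ideal: "q > 0 \<Longrightarrow> k \<in> K \<Longrightarrow> k \<in> lin_span z q N K"
  by (auto simp: lin_span_def lin_zero intro!: exI[of _ "\<lambda>_. 0"])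

lemma lin_span_power: "q > 0 \<Longrightarrow> r ^ q \<in> lin_span z q N K"
proof -
  assume q: "q > 0"
  have "lin z q N (\<lambda>b. if b = replicate N 0 then r else 0) = r ^ q" 
  proof (induction N)
    case (Suc N)
    have "lin z q (Suc N) (\<lambda>b. if b = replicate (Suc N) 0 then r else 0) =
        (\<Sum>j<q. if j = 0 then r ^ q else 0)"
      unfolding lin.simps
    proof (rule sum.cong)
      fix j
      show "lin z q N (\<lambda>bs. if j # bs = replicate (Suc N) 0 then r else 0) * z N ^ j
          = (if j = 0 then r ^ q else 0)"
        using Suc by (cases "j = 0") (auto simp: lin_zero q)
    qed simp
    also have "\<dots> = r ^ q" using q by (simp add: sum.delta)
    finally show ?case .
  qed simp
  then have "r ^ q - lin z q N (\<lambda>b. if b = replicate N 0 then r else 0) \<in> K"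
    using K by (simp add: is_ideal_zero)
  then show ?thesis unfolding lin_span_def by blast
qed

text \<open>The span has to be a ring: modulo \<open>\<mm>\<close> it plays the intermediate field
  \<open>L\<close> of \<open>purely_inseparable_independent\<close>.\<close>

lemma lin_span_mult:
  assumes "s \<in> lin_span z (p ^ e) N K" "t \<in> lin_span z (p ^ e) N K"
  shows "s * t \<in> lin_span z (p ^ e) N K"
proof -
  obtain c where c: "s - lin z (p ^ e) N c \<in> K" using assms by (auto simp: lin_span_def)
  have "lin z (p ^ e) N c * t \<in> lin_span z (p ^ e) N K"
    by (rule lin_mult_closed[of _ "p ^ e" N z, OF _ _ _ _ assms(2)])
      (use q_pos K in \<open>auto intro: lin_span_add lin_span_scale lin_span_var lin_span_ideal is_ideal_zero\<close>)
  moreover have "(s - lin z (p ^ e) N c) * t \<in> lin_span z (p ^ e) N K"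
    by (intro lin_span_ideal q_pos is_ideal_mult_right K c)
  ultimately have "lin z (p ^ e) N c * t + (s - lin z (p ^ e) N c) * t \<in> lin_span z (p ^ e) N K"
    by (rule lin_span_add)
  then show ?thesis by (simp add: algebra_simps)
qed

end

end

section \<open>Purely inseparable elements of degree \<open>p\<close>\<close>

definition coeffs_in :: "'c::comm_ring_1 set \<Rightarrow> 'c poly \<Rightarrow> bool" where
  "coeffs_in L a \<longleftrightarrow> (\<forall>i. coeff a i \<in> L)"

context
  fixes K :: "'c::comm_ring_1 set"
  assumes K: "is_ideal K"
begin

lemma coeffs_in_add: "coeffs_in K a \<Longrightarrow> coeffs_in K b \<Longrightarrow> coeffs_in K (a + b)"
  and coeffs_in_mult: "coeffs_in K a \<Longrightarrow> coeffs_in K (b * a)"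
  and coeffs_in_const: "k \<in> K \<Longrightarrow> coeffs_in K [:k:]"
  by (auto simp: coeffs_in_def coeff_mult coeff_pCons is_ideal_add[OF K] is_ideal_zero[OF K]
      intro!: is_ideal_sum[OF K] is_ideal_mult_left[OF K] split: nat.split)

lemma poly_in_ideal: "coeffs_in K a \<Longrightarrow> poly a x \<in> K"
  by (auto simp: poly_altdef coeffs_in_def intro!: is_ideal_sum[OF K] is_ideal_mult_right[OF K])

text \<open>A monic linear polynomial is not a zero divisor modulo any ideal; the coefficients of
  \<open>a\<close> are obtained from the top down.\<close>

lemma linear_factor_cancel:
  assumes "coeffs_in K ([:- g, 1:] * a)"
  shows "coeffs_in K a"
proof -
  have "coeff a i \<in> K" if "i \<le> Suc (degree a)" for i
    using that
  proof (induction i rule: inc_induct)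
    case base
    then show ?case by (simp add: coeff_eq_0 is_ideal_zero[OF K])
  next
    case (step i)
    have "coeff ([:- g, 1:] * a) (Suc i) \<in> K" using assms unfolding coeffs_in_def by blast
    then have "coeff ([:- g, 1:] * a) (Suc i) + g * coeff a (Suc i) \<in> K"
      using step by (intro is_ideal_add[OF K] is_ideal_mult_left[OF K])
    then show ?case by simp
  qed
  moreover have "coeff a i \<in> K" if "i > degree a" for i
    using that by (simp add: coeff_eq_0 is_ideal_zero[OF K])
  ultimately show ?thesis unfolding coeffs_in_def by (metis leI le_SucI)
qed

end

text \<open>Evaluation at \<open>g\<close> replaces unique factorization over a fraction field.
  Since \<open>K\<close> is prime, \<open>f\<close> or \<open>h\<close> vanishes at \<open>g\<close>
  modulo \<open>K\<close>; synthetic division takes the linear factor out of it, and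
  \<open>s\<close> drops by one.\<close>

lemma monic_factor_of_linear_power:
  assumes K: "is_prime K" and "lead_coeff f = 1" "coeffs_in K ([:- g, 1:] ^ s - f * h)"
  shows "coeffs_in K (f - [:- g, 1:] ^ degree f)"
  using assms(2,3)
proof (induction s arbitrary: f h)
  case 0
  have I: "is_ideal K" and one: "1 \<notin> K" using K by (auto simp: is_prime_def)
  have "degree f = 0"
  proof (rule ccontr)
    assume t: "degree f \<noteq> 0"
    \<comment> \<open>If the monic \<open>f\<close> had positive degree, comparing
      \<open>f * h\<close> with 1 from the top coefficient down would put all of \<open>h\<close>
      into \<open>K\<close>, and the constant term would put 1 there.\<close>
    have "coeff h i \<in> K" if "i \<le> Suc (degree h)" for i
      using that
    proof (induction i rule: measure_induct_rule[of "\<lambda>i. Suc (degree h) - i"])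
      case (less i)
      have hi: "coeff h j \<in> K" if "j > i" for j
      proof (cases "j \<le> Suc (degree h)")
        case True
        then show ?thesis using less that by auto
      next
        case False
        then show ?thesis by (simp add: coeff_eq_0 is_ideal_zero[OF I])
      qed
      have "coeff (1 - f * h) (degree f + i) \<in> K"
        using 0(2) unfolding coeffs_in_def power_0 by blast
      then have "coeff (f * h) (degree f + i) \<in> K"
        using t is_ideal_uminus[OF I, of "- coeff (f * h) (degree f + i)"] by (simp add: coeff_1)
      moreover have "coeff (f * h) (degree f + i) =
          coeff h i + (\<Sum>k\<in>{..degree f + i} - {degree f}. coeff f k * coeff h (degree f + i - k))"
        unfolding coeff_mult using 0(1) by (subst sum.remove[of _ "degree f"]) auto
      moreover have "(\<Sum>k\<in>{..degree f + i} - {degree f}. coeff f k * coeff h (degree f + i - k)) \<in> K"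
      proof (intro is_ideal_sum[OF I])
        fix k assume k: "k \<in> {..degree f + i} - {degree f}"
        show "coeff f k * coeff h (degree f + i - k) \<in> K"
        proof (cases "k < degree f")
          case True
          then show ?thesis by (intro is_ideal_mult_left[OF I] hi) auto
        next
          case False
          then show ?thesis using k by (simp add: coeff_eq_0 is_ideal_zero[OF I])
        qed
      qed
      ultimately show ?case
        using is_ideal_diff[OF I, of "coeff (f * h) (degree f + i)"] by fastforce
    qed
    then have "coeff h 0 \<in> K" by simp
    moreover have "coeff (1 - f * h) 0 \<in> K" using 0(2) unfolding coeffs_in_def power_0 by blast
    ultimately have "coeff (1 - f * h) 0 + coeff f 0 * coeff h 0 \<in> K"
      by (intro is_ideal_add[OF I] is_ideal_mult_left[OF I])
    then show False using one by (simp add: coeff_mult)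
  qed
  then obtain a where "f = [:a:]" by (rule degree_eq_zeroE)
  then have "f = 1" using 0 by (simp add: one_pCons)
  then show ?case by (simp add: coeffs_in_def is_ideal_zero[OF I])
next
  case (Suc s)
  have I: "is_ideal K" and one: "1 \<notin> K" using K by (auto simp: is_prime_def)
  have "poly ([:- g, 1:] ^ Suc s - f * h) g \<in> K" by (rule poly_in_ideal[OF I Suc.prems(2)])
  then have "poly f g * poly h g \<in> K" using is_ideal_uminus[OF I] by fastforce
  then consider "poly f g \<in> K" | "poly h g \<in> K" using K by (auto simp: is_prime_def)
  then show ?case
  proof cases
    case 1
    define f1 where "f1 = synthetic_div f g"
    have f: "f = [:- g, 1:] * f1 + [:poly f g:]" unfolding f1_def by (rule synthetic_div_correct'[symmetric])
    have "degree f \<noteq> 0"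
    proof
      assume "degree f = 0"
      then obtain a where "f = [:a:]" by (rule degree_eq_zeroE)
      with Suc.prems(1) 1 one show False by simp
    qed
    then obtain t where t: "degree f = Suc t" by (cases "degree f") auto
    then have deg: "degree f1 = t" by (simp add: f1_def degree_synthetic_div)
    have "coeff f (Suc t) = coeff f1 t"
    proof -
      have "coeff f1 (Suc t) = 0" using deg by (simp add: coeff_eq_0)
      then show ?thesis by (subst f) simp
    qed
    then have lead: "lead_coeff f1 = 1" using Suc.prems(1) t deg by simp
    have "[:- g, 1:] * ([:- g, 1:] ^ s - f1 * h)
        = ([:- g, 1:] ^ Suc s - ([:- g, 1:] * f1 + [:poly f g:]) * h) + h * [:poly f g:]"
      by (simp only: algebra_simps power_Suc)
    then have "[:- g, 1:] * ([:- g, 1:] ^ s - f1 * h) = ([:- g, 1:] ^ Suc s - f * h) + h * [:poly f g:]"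
      by (simp only: f[symmetric])
    then have "coeffs_in K ([:- g, 1:] * ([:- g, 1:] ^ s - f1 * h))"
      using Suc.prems(2) 1 coeffs_in_add[OF I] coeffs_in_mult[OF I] coeffs_in_const[OF I] by metis
    from Suc.IH[OF lead linear_factor_cancel[OF I this]]
    have "coeffs_in K (f1 - [:- g, 1:] ^ t)" by (simp add: deg)
    moreover have "([:- g, 1:] * f1 + [:poly f g:]) - [:- g, 1:] ^ degree f
        = [:- g, 1:] * (f1 - [:- g, 1:] ^ t) + [:poly f g:]"
      unfolding t by (simp only: algebra_simps power_Suc)
    then have "f - [:- g, 1:] ^ degree f = [:- g, 1:] * (f1 - [:- g, 1:] ^ t) + [:poly f g:]"
      by (simp only: f[symmetric])
    ultimately show ?thesis
      using 1 coeffs_in_add[OF I] coeffs_in_mult[OF I] coeffs_in_const[OF I] by metis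
  next
    case 2
    define h1 where "h1 = synthetic_div h g"
    have h: "h = [:- g, 1:] * h1 + [:poly h g:]" unfolding h1_def by (rule synthetic_div_correct'[symmetric])
    have "[:- g, 1:] * ([:- g, 1:] ^ s - f * h1)
        = ([:- g, 1:] ^ Suc s - f * ([:- g, 1:] * h1 + [:poly h g:])) + f * [:poly h g:]"
      by (simp only: algebra_simps power_Suc)
    then have "[:- g, 1:] * ([:- g, 1:] ^ s - f * h1) = ([:- g, 1:] ^ Suc s - f * h) + f * [:poly h g:]"
      by (simp only: h[symmetric])
    then have "coeffs_in K ([:- g, 1:] * ([:- g, 1:] ^ s - f * h1))"
      using Suc.prems(2) 2 coeffs_in_add[OF I] coeffs_in_mult[OF I] coeffs_in_const[OF I] by metis
    from Suc.IH[OF Suc.prems(1) linear_factor_cancel[OF I this]] show ?thesis .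
  qed
qed

context char_p_above
begin

text \<open>\<open>L\<close> stands for a field of residues between \<open>k\<^sup>p\<close> and \<open>k\<close>. A monic relation for \<open>g\<close> of minimal
  degree \<open>n < p\<close> divides \<open>X\<^sup>p - g\<^sup>p = (X - g)\<^sup>p\<close>, hence is \<open>(X - g)\<^sup>n\<close>, whose second coefficient
  puts \<open>n g\<close>, and so \<open>g\<close>, in \<open>L\<close>.\<close>

lemma purely_inseparable_independent:
  assumes L: "\<And>x y. x \<in> L \<Longrightarrow> y \<in> L \<Longrightarrow> x + y \<in> L" "\<And>x y. x \<in> L \<Longrightarrow> y \<in> L \<Longrightarrow> x * y \<in> L"
      "\<And>r. r ^ p \<in> L" "\<mm> \<subseteq> L"
    and g: "g \<notin> L" and l: "\<And>j. l j \<in> L" "(\<Sum>j<p. l j * g ^ j) \<in> \<mm>" and j: "j < p"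
  shows "l j \<in> \<mm>"
proof (rule ccontr)
  assume "l j \<notin> \<mm>"
  have p: "p > 0" using prime_gt_0_nat[OF prime_p] .
  have I: "is_ideal \<mm>" and one: "1 \<notin> \<mm>" using prime_m by (auto simp: is_prime_def)
  have zL: "0 \<in> L" using L(4) is_ideal_zero[OF I] by auto
  have oL: "1 \<in> L" using L(3)[of 1] by simp
  have nL: "of_nat n \<in> L" for n by (induction n) (auto simp: zL oL L)
  have pm: "of_nat p \<in> \<mm>" using p_in_J J_le_m by auto
  have uL: "- x \<in> L" if "x \<in> L" for x
  proof -
    \<comment> \<open>Negation is obtained from addition: \<open>- x\<close> is
      \<open>(p - 1) x\<close> up to a multiple of \<open>p\<close>, and such a multiple lies in
      \<open>\<mm>\<close>.\<close>
    have "of_nat (p - 1) * x + - (of_nat p * x) \<in> L"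
      by (rule L(1)[OF L(2)[OF nL that] subsetD[OF L(4) is_ideal_uminus[OF I is_ideal_mult_right[OF I pm]]]])
    moreover have "of_nat (p - 1) * x + - (of_nat p * x) = - x"
      using p by (simp add: of_nat_diff algebra_simps)
    ultimately show ?thesis by simp
  qed
  have dL: "x - y \<in> L" if "x \<in> L" "y \<in> L" for x y using L(1)[OF that(1) uL[OF that(2)]] by simp
  have pL: "x ^ n \<in> L" if "x \<in> L" for x n by (induction n) (auto simp: oL that L)
  have sL: "sum f A \<in> L" if "\<And>a. a \<in> A \<Longrightarrow> f a \<in> L" for f and A :: "nat set"
    using that by (induction A rule: infinite_finite_induct) (auto simp: zL L)
  define rel where "rel n \<longleftrightarrow> (\<exists>l. (\<forall>j. l j \<in> L) \<and> (\<Sum>j\<le>n. l j * g ^ j) \<in> \<mm> \<and> l n \<notin> \<mm>)" for n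
  have ex: "\<exists>n<p. rel n"
  proof -
    define n where "n = (GREATEST j. j < p \<and> l j \<notin> \<mm>)"
    have n: "n < p \<and> l n \<notin> \<mm>"
      unfolding n_def by (rule GreatestI_nat[of _ j p]) (use \<open>l j \<notin> \<mm>\<close> j in auto)
    have gt: "l i \<in> \<mm>" if "n < i" "i < p" for i
      using Greatest_le_nat[of "\<lambda>j. j < p \<and> l j \<notin> \<mm>" i p] that by (fastforce simp: n_def)
    have "{..<p} = {..n} \<union> {n<..<p}" using n by auto
    then have "(\<Sum>j<p. l j * g ^ j) = (\<Sum>j\<le>n. l j * g ^ j) + (\<Sum>j\<in>{n<..<p}. l j * g ^ j)"
      by (simp add: sum.union_disjoint ivl_disj_int)
    moreover have "(\<Sum>j\<in>{n<..<p}. l j * g ^ j) \<in> \<mm>"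
      using gt by (intro is_ideal_sum[OF I] is_ideal_mult_right[OF I]) auto
    ultimately have "(\<Sum>j\<le>n. l j * g ^ j) \<in> \<mm>" using l(2) is_ideal_diff[OF I] by fastforce
    with n l(1) show ?thesis unfolding rel_def by blast
  qed
  define n where "n = (LEAST n. rel n)"
  have "rel n" and n_min: "\<And>k. rel k \<Longrightarrow> n \<le> k"
    using ex LeastI[of rel] Least_le[of rel] by (auto simp: n_def)
  have "n < p" using ex n_min by fastforce
  obtain l where l: "\<And>j. l j \<in> L" "(\<Sum>j\<le>n. l j * g ^ j) \<in> \<mm>" "l n \<notin> \<mm>"
    using \<open>rel n\<close> by (auto simp: rel_def)
  obtain v where v: "l n * v - 1 \<in> J" using inverse_mod[OF l(3)] by blast
  \<comment> \<open>An inverse of \<open>l n\<close> modulo \<open>\<mm>\<close> that belongs to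
    \<open>L\<close>: the inverse \<open>v\<close> may lie outside \<open>L\<close>, but its
    \<open>p\<close>-th power cannot.\<close>
  define w where "w = l n ^ (p - 1) * v ^ p"
  have wL: "w \<in> L" unfolding w_def by (rule L(2)[OF pL[OF l(1)] L(3)])
  have "l n * w = (l n * v) ^ p"
    using p by (cases p) (simp_all add: w_def power_mult_distrib mult_ac)
  then have w: "l n * w - 1 \<in> \<mm>"
    using is_ideal_power_diff[OF ideal_J v, of p] J_le_m by auto
  define f where "f = monom 1 n + (\<Sum>j<n. monom (w * l j) j)"
  have cf: "coeff f i = (if i = n then 1 else if i < n then w * l i else 0)" for i
    unfolding f_def by (auto simp: coeff_sum sum.delta)
  have deg_f: "degree f = n"
    by (rule antisym) (auto intro!: degree_le le_degree simp: cf)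
  have lead_f: "lead_coeff f = 1" by (simp add: deg_f cf)
  have f_L: "coeffs_in L f" by (auto simp: coeffs_in_def cf oL zL intro!: L(2) wL l(1))
  have "poly f g \<in> \<mm>"
  proof -
    have "poly f g = g ^ n + (\<Sum>j<n. w * l j * g ^ j)"
      by (simp add: f_def poly_monom poly_sum)
    also have "\<dots> = w * (\<Sum>j\<le>n. l j * g ^ j) - (l n * w - 1) * g ^ n"
      by (simp add: lessThan_Suc_atMost[symmetric] sum_distrib_left algebra_simps)
    also have "\<dots> \<in> \<mm>"
      by (intro is_ideal_diff[OF I] is_ideal_mult_left[OF I] is_ideal_mult_right[OF I] l w)
    finally show ?thesis .
  qed
  \<comment> \<open>Minimality of \<open>n\<close> in terms of polynomials. It will be applied to
    the remainder of \<open>X^p - g^p\<close> after division by \<open>f\<close>.\<close>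
  have small: "coeffs_in \<mm> r" if r: "coeffs_in L r" "\<And>i. i \<ge> n \<Longrightarrow> coeff r i = 0" "poly r g \<in> \<mm>" for r
  proof (rule ccontr)
    assume "\<not> ?thesis"
    then obtain i where i: "coeff r i \<notin> \<mm>" by (auto simp: coeffs_in_def)
    define k where "k = (GREATEST j. coeff r j \<notin> \<mm>)"
    have bound: "\<And>y. coeff r y \<notin> \<mm> \<Longrightarrow> y \<le> n" using r(2) is_ideal_zero[OF I] by (metis nat_le_linear)
    have k: "coeff r k \<notin> \<mm>" unfolding k_def by (rule GreatestI_nat[where P = "\<lambda>j. coeff r j \<notin> \<mm>", OF i bound])
    have gt: "coeff r i \<in> \<mm>" if "k < i" for i
      using Greatest_le_nat[of "\<lambda>j. coeff r j \<notin> \<mm>" i n] bound that by (fastforce simp: k_def)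
    have "k < n" using k r(2) is_ideal_zero[OF I] by (metis not_le)
    have "poly r g = (\<Sum>i\<le>max k (degree r). coeff r i * g ^ i)"
      unfolding poly_altdef by (intro sum.mono_neutral_left) (auto simp: coeff_eq_0)
    also have "{..max k (degree r)} = {..k} \<union> {k<..max k (degree r)}" by auto
    also have "(\<Sum>i\<in>\<dots>. coeff r i * g ^ i)
        = (\<Sum>i\<le>k. coeff r i * g ^ i) + (\<Sum>i\<in>{k<..max k (degree r)}. coeff r i * g ^ i)"
      by (intro sum.union_disjoint) auto
    finally have "(\<Sum>i\<le>k. coeff r i * g ^ i) = poly r g - (\<Sum>i\<in>{k<..max k (degree r)}. coeff r i * g ^ i)"
      by simp
    also have "\<dots> \<in> \<mm>"
      using gt r(3) by (intro is_ideal_diff[OF I] is_ideal_sum[OF I] is_ideal_mult_right[OF I]) auto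
    finally have "rel k" using k r(1) unfolding rel_def coeffs_in_def by blast
    with n_min \<open>k < n\<close> show False by fastforce
  qed
  have division: "\<exists>h r. a = f * h + r \<and> coeffs_in L h \<and> coeffs_in L r \<and> (\<forall>i\<ge>n. coeff r i = 0)"
    if "coeffs_in L a" "\<And>i. i \<ge> k \<Longrightarrow> coeff a i = 0" for a k
    using that
  proof (induction k arbitrary: a)
    case 0
    then have "a = 0" by (intro poly_eqI) simp
    then show ?case by (auto intro!: exI[of _ 0] simp: coeffs_in_def zL)
  next
    case (Suc k)
    show ?case
    proof (cases "Suc k \<le> n")
      case True
      then show ?thesis using Suc.prems by (intro exI[of _ 0] exI[of _ a]) (auto simp: coeffs_in_def zL)
    next
      case False
      define t where "t = monom (coeff a k) (k - n)"
      have ct: "coeff (f * t) i = (if i < k - n then 0 else coeff a k * coeff f (i - (k - n)))" for i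
        by (simp add: t_def mult.commute[of f] coeff_monom_mult)
      have "coeff (a - f * t) i = 0" if "i \<ge> k" for i
        using that Suc.prems(2)[of i] False by (cases "i = k") (auto simp: ct cf)
      moreover have "coeffs_in L (a - f * t)"
        using Suc.prems(1) f_L by (auto simp: coeffs_in_def ct intro!: dL L(2) zL)
      ultimately obtain h r where "a - f * t = f * h + r" "coeffs_in L h" "coeffs_in L r"
        "\<forall>i\<ge>n. coeff r i = 0" using Suc.IH by blast
      moreover from this have "a = f * (h + t) + r" by (simp add: algebra_simps)
      moreover have "coeffs_in L (h + t)"
        using calculation(2) Suc.prems(1) by (auto simp: coeffs_in_def t_def intro!: L(1) zL)
      ultimately show ?thesis by blast
    qed
  qed
  define a where "a = monom 1 p - [:g ^ p:]"
  have "coeffs_in L a"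
    by (auto simp: a_def coeffs_in_def coeff_pCons intro!: dL uL L(3) oL zL split: nat.split)
  moreover have "coeff a i = 0" if "i \<ge> Suc p" for i
    using that p by (auto simp: a_def coeff_pCons split: nat.split)
  ultimately obtain h r where hr: "a = f * h + r" "coeffs_in L h" "coeffs_in L r" "\<forall>i\<ge>n. coeff r i = 0"
    using division by blast
  have "poly r g = poly a g - poly f g * poly h g" by (simp add: hr(1))
  also have "poly a g = 0" by (simp add: a_def poly_monom)
  also have "0 - poly f g * poly h g \<in> \<mm>"
    by (intro is_ideal_diff[OF I] is_ideal_mult_right[OF I] is_ideal_zero[OF I] \<open>poly f g \<in> \<mm>\<close>)
  finally have r_m: "coeffs_in \<mm> r" using small hr(3,4) by blast
  have pK: "coeffs_in \<mm> (of_nat p * w)" for w :: "'c poly"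
    using pm by (auto simp: of_nat_poly coeffs_in_def intro!: is_ideal_mult_right[OF I])
  have "coeffs_in \<mm> ([:- g, 1:] ^ p - a)"
  proof -
    obtain w where w: "([:- g:] + monom 1 1) ^ p = [:- g:] ^ p + monom 1 1 ^ p + of_nat p * w"
      using freshmans_dream_mod[OF prime_p] by blast
    obtain w' where w': "(g + - g) ^ p = g ^ p + (- g) ^ p + of_nat p * w'"
      using freshmans_dream_mod[OF prime_p] by blast
    have "[:- g, 1:] ^ p - a = of_nat p * w + [:(- g) ^ p + g ^ p:]"
    proof -
      have e1: "[:- g, 1:] = [:- g:] + monom 1 1" by (simp add: monom_altdef)
      have e2: "[:(- g) ^ p + g ^ p:] = [:- g:] ^ p + [:g ^ p:]" by (simp add: poly_const_pow)
      show ?thesis unfolding e1 w e2 a_def by (simp add: monom_power)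
    qed
    also have "(- g) ^ p + g ^ p = of_nat p * (- w')"
    proof -
      have "g ^ p + (- g) ^ p + of_nat p * w' = 0" using w' p by (simp add: zero_power)
      then show ?thesis
        unfolding mult_minus_right eq_neg_iff_add_eq_0 by (simp only: add.commute[of "(- g) ^ p"])
    qed
    finally show ?thesis
      using pm by (auto intro!: coeffs_in_add[OF I] pK coeffs_in_const[OF I]
          is_ideal_uminus[OF I] is_ideal_mult_right[OF I])
  qed
  then have "coeffs_in \<mm> ([:- g, 1:] ^ p - f * h)"
    using coeffs_in_add[OF I _ r_m] by (fastforce simp: hr(1))
  from monic_factor_of_linear_power[OF prime_m lead_f this]
  have fin: "coeffs_in \<mm> (f - [:- g, 1:] ^ n)" by (simp add: deg_f)
  have "n \<noteq> 0"
  proof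
    assume "n = 0"
    with l(2,3) show False by simp
  qed
  then obtain t where t: "n = Suc t" by (cases n) auto
  have "coeff (f - [:- g, 1:] ^ n) t \<in> \<mm>" using fin by (simp add: coeffs_in_def)
  moreover have "coeff ([:- g, 1:] ^ n) t = - (of_nat n * g)"
    by (subst coeff_linear_poly_power) (simp_all add: t)
  ultimately have "coeff f t - - (of_nat n * g) \<in> L" using L(4) by auto
  then have ng: "of_nat n * g \<in> L"
    using dL[of "coeff f t - - (of_nat n * g)" "coeff f t"] f_L by (simp add: coeffs_in_def)
  have "coprime n p"
  proof -
    have "\<not> p dvd n" using \<open>n < p\<close> \<open>n \<noteq> 0\<close> by (auto dest: dvd_imp_le)
    then show ?thesis using prime_imp_coprime[OF prime_p] coprime_commute by blast
  qed
  \<comment> \<open>Here \<open>a\<close> inverts \<open>n\<close> modulo \<open>p\<close>, and the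
    surplus \<open>p b g\<close> lies in \<open>\<mm>\<close>.\<close>
  then obtain a b where ab: "n * a = Suc (p * b)"
    using coprime_bezout_strong[of n p] prime_p by (metis Suc_eq_plus1 not_prime_1)
  have "of_nat a * (of_nat n * g) - of_nat p * (of_nat b * g) \<in> L"
    using pm by (intro dL L(2) nL ng subsetD[OF L(4)] is_ideal_mult_right[OF I])
  also have "of_nat a * (of_nat n * g) = of_nat (n * a) * g" by (simp add: mult_ac)
  also have "\<dots> - of_nat p * (of_nat b * g) = g" unfolding ab by (simp add: algebra_simps)
  finally show False using g by simp
qed

end

section \<open>A basis over the subring of \<open>q\<close>-th powers\<close>

text \<open>The assumption \<open>generation\<close> says that \<open>G\<close> generates the residue ring modulo \<open>J\<close> as a module
  over its \<open>p\<close>-th powers.\<close>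

locale f_finite_above = char_p_above J \<mm> p for J \<mm> :: "'c::comm_ring_1 set" and p +
  fixes G :: "'c set"
  assumes finite_G: "finite G"
    and generation: "\<lbrakk>J \<subseteq> X; \<And>x y. x \<in> X \<Longrightarrow> y \<in> X \<Longrightarrow> x + y \<in> X; \<And>r g. g \<in> G \<Longrightarrow> r ^ p * g \<in> X\<rbrakk>
      \<Longrightarrow> X = UNIV"
begin

lemmas lin_span_closed = lin_span_add[where e = 1, unfolded power_one_right]
  lin_span_mult[where e = 1, unfolded power_one_right]

lemma p_pos: "p > 0"
  using prime_gt_0_nat[OF prime_p] .

lemma lin_span_extend:
  assumes K: "is_ideal K" "J \<subseteq> K" "K \<subseteq> K'" "is_ideal K'"
    and "N \<le> N'" "\<And>i. i < N \<Longrightarrow> z i = z' i"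
  shows "lin_span z p N K \<subseteq> lin_span z' p N' K'"
proof
  fix s assume "s \<in> lin_span z p N K"
  then obtain c where c: "s - lin z p N c \<in> K" by (auto simp: lin_span_def)
  have JK: "J \<subseteq> K'" using K by blast
  have one: "1 \<in> lin_span z' p N' K'" using lin_span_power[OF K(4) JK p_pos, of 1] by simp
  have "lin z p N c * 1 \<in> lin_span z' p N' K'"
  proof (rule lin_mult_closed[of _ p N z, OF _ _ _ _ one])
    show "0 \<in> lin_span z' p N' K'"
      using lin_span_ideal[OF K(4) JK p_pos is_ideal_zero[OF K(4)]] .
    show "z i * x \<in> lin_span z' p N' K'" if "i < N" "x \<in> lin_span z' p N' K'" for i x
      using lin_span_var[OF K(4) JK that(2), of i] that assms(5,6) p_pos by auto
  qed (use lin_span_closed(1)[OF K(4) JK] lin_span_scale[OF K(4) JK] in auto)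
  moreover have "s - lin z p N c \<in> lin_span z' p N' K'"
    using lin_span_ideal[OF K(4) JK p_pos] c K(3) by blast
  ultimately have "lin z p N c * 1 + (s - lin z p N c) \<in> lin_span z' p N' K'"
    by (rule lin_span_closed(1)[OF K(4) JK])
  then show "s \<in> lin_span z' p N' K'" by simp
qed

text \<open>A greedy choice: among the independent families, take one whose span meets
  \<open>G\<close> in the largest number of elements, which is bounded by \<open>card G\<close>. An
  element of \<open>G\<close> outside the span could be adjoined by
  \<open>purely_inseparable_independent\<close> and would increase this number.\<close>

lemma exists_p_basis: "\<exists>y M. indep y p M \<mm> \<and> lin_span y p M \<mm> = UNIV"
proof -
  note m = ideal_m J_le_m
  define f where "f = (\<lambda>(y, M). card (G \<inter> lin_span y p M \<mm>))"
  have "indep (\<lambda>_. 0) p 0 \<mm>"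
    using is_prime_power[OF prime_m] by (auto simp: indep_def)
  moreover have "\<forall>a. f a < Suc (card G)" by (auto simp: f_def finite_G less_Suc_eq_le intro: card_mono)
  ultimately obtain a where a: "(\<lambda>(y, M). indep y p M \<mm>) a"
    "\<And>b. (\<lambda>(y, M). indep y p M \<mm>) b \<Longrightarrow> f b \<le> f a"
    using ex_has_greatest_nat[of "\<lambda>(y, M). indep y p M \<mm>" "(\<lambda>_. 0, 0)" f "Suc (card G)"] by auto
  obtain y M where yM: "a = (y, M)" by (cases a)
  have ind: "indep y p M \<mm>" using a(1) by (simp add: yM)
  have "G \<subseteq> lin_span y p M \<mm>"
  proof (rule ccontr)
    assume "\<not> ?thesis"
    then obtain g where g: "g \<in> G" "g \<notin> lin_span y p M \<mm>" by blast
    define y' where "y' = y(M := g)"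
    have lin_eq: "lin y' p M c = lin y p M c" for c
      by (rule lin_cong_vars) (simp add: y'_def)
    have "indep y' p (Suc M) \<mm>"
      unfolding indep_def
    proof (intro allI impI ballI)
      fix c b assume c: "lin y' p (Suc M) c \<in> \<mm>" and b: "b \<in> idx p (Suc M)"
      obtain j bs where j: "b = j # bs" "j < p" "bs \<in> idx p M" using b by (rule idx_SucE)
      have "lin y p M (\<lambda>bs. c (j # bs)) \<in> \<mm>"
      proof (rule purely_inseparable_independent[where L = "lin_span y p M \<mm>" and g = g
            and l = "\<lambda>j. lin y p M (\<lambda>bs. c (j # bs))"])
        show "lin y p M (\<lambda>bs. c (j # bs)) \<in> lin_span y p M \<mm>" for j
          using is_ideal_zero[OF ideal_m] by (auto simp: lin_span_def intro!: exI[of _ "\<lambda>bs. c (j # bs)"])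
        show "(\<Sum>j<p. lin y p M (\<lambda>bs. c (j # bs)) * g ^ j) \<in> \<mm>"
          using c by (simp add: lin_eq) (simp add: y'_def)
      qed (use lin_span_closed[OF m] lin_span_power[OF m p_pos] lin_span_ideal[OF m p_pos] g j in auto)
      with ind j show "c b \<in> \<mm>" by (auto simp: indep_def)
    qed
    then have "f (y', Suc M) \<le> f (y, M)" using a(2)[of "(y', Suc M)"] by (simp add: yM)
    moreover have "G \<inter> lin_span y p M \<mm> \<subset> G \<inter> lin_span y' p (Suc M) \<mm>"
    proof -
      have "1 \<in> lin_span y' p (Suc M) \<mm>" using lin_span_power[OF m p_pos, of 1] by simp
      then have "y' M * 1 \<in> lin_span y' p (Suc M) \<mm>" by (intro lin_span_var m p_pos) auto
      then have "g \<in> lin_span y' p (Suc M) \<mm>" by (simp add: y'_def)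
      moreover have "lin_span y p M \<mm> \<subseteq> lin_span y' p (Suc M) \<mm>"
        by (rule lin_span_extend) (use m in \<open>auto simp: y'_def\<close>)
      ultimately show ?thesis using g by blast
    qed
    then have "f (y, M) < f (y', Suc M)" unfolding f_def by (simp add: psubset_card_mono finite_G)
    ultimately show False by simp
  qed
  then have "lin_span y p M \<mm> = UNIV"
    using lin_span_closed(1)[OF m] lin_span_ideal[OF m p_pos] m lin_span_scale[OF m]
    by (intro generation) blast+
  with ind show ?thesis by blast
qed

lemma module_nakayama:
  assumes X: "J \<subseteq> X" "\<And>x y. x \<in> X \<Longrightarrow> y \<in> X \<Longrightarrow> x + y \<in> X" "\<And>r x. x \<in> X \<Longrightarrow> r ^ p * x \<in> X"
    and H: "\<And>s. \<exists>x\<in>X. s - x \<in> ideal_gen (J \<union> {\<mu> ^ p | \<mu>. \<mu> \<in> \<mm>})"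
  shows "X = UNIV"
proof -
  define closed where "closed Y \<longleftrightarrow> X \<subseteq> Y \<and> (\<forall>x\<in>Y. \<forall>y\<in>Y. x + y \<in> Y) \<and> (\<forall>r. \<forall>x\<in>Y. r ^ p * x \<in> Y)" for Y
  define V where "V W = \<Inter>{Y. closed Y \<and> W \<subseteq> Y}" for W
  have V: "X \<subseteq> V W" "W \<subseteq> V W" "\<And>x y. x \<in> V W \<Longrightarrow> y \<in> V W \<Longrightarrow> x + y \<in> V W"
    "\<And>r x. x \<in> V W \<Longrightarrow> r ^ p * x \<in> V W" for W
    by (auto simp: V_def closed_def)
  have V_least: "V W \<subseteq> Y" if "closed Y" "W \<subseteq> Y" for W Y
    using that by (auto simp: V_def)
  have VJ: "J \<subseteq> V W" for W using V(1) X(1) by blast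
  have frob: "(a + b) ^ p - (a ^ p + b ^ p) \<in> J" for a b using frob_add[of a b 1] by simp
  have neg: "- j \<in> V W" if "j \<in> J" for j W using that VJ is_ideal_uminus[OF ideal_J] by blast
  have combine: "\<exists>v''\<in>V W. (v + c ^ p * g) + (v' + c' ^ p * g) = v'' + (c + c') ^ p * g"
    if "v \<in> V W" "v' \<in> V W" for v c v' c' g W
  proof
    have "((c + c') ^ p - (c ^ p + c' ^ p)) * g \<in> J" by (intro is_ideal_mult_right ideal_J frob)
    then show "(v + v') + - (((c + c') ^ p - (c ^ p + c' ^ p)) * g) \<in> V W" by (intro V(3) that neg)
  qed (simp add: algebra_simps)
  have step: "V W = UNIV" if full: "V (insert g W) = UNIV" for g W
  proof -
    define Y where "Y = {v + c ^ p * g | v c. v \<in> V W}"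
    have zero: "v = v + 0 ^ p * g" for v using p_pos by (simp add: zero_power)
    have VY: "V W \<subseteq> Y" unfolding Y_def using zero by blast
    have "closed Y"
      unfolding closed_def
    proof (intro conjI ballI allI)
      show "X \<subseteq> Y" using VY V(1) by blast
    next
      fix x y assume "x \<in> Y" "y \<in> Y"
      then obtain v c v' c' where vc: "x = v + c ^ p * g" "v \<in> V W" "y = v' + c' ^ p * g" "v' \<in> V W"
        by (auto simp: Y_def)
      with combine[OF vc(2,4), of c g c'] show "x + y \<in> Y" unfolding Y_def by blast
    next
      fix r x assume "x \<in> Y"
      then obtain v c where "x = v + c ^ p * g" "v \<in> V W" by (auto simp: Y_def)
      then have "r ^ p * x = r ^ p * v + (r * c) ^ p * g" "r ^ p * v \<in> V W"
        using V(4) by (auto simp: algebra_simps power_mult_distrib)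
      then show "r ^ p * x \<in> Y" unfolding Y_def by blast
    qed
    moreover have "g \<in> Y"
    proof -
      have "g = 0 + 1 ^ p * g" "0 \<in> V W" using is_ideal_zero[OF ideal_J] VJ by auto
      then show ?thesis unfolding Y_def by blast
    qed
    ultimately have "V (insert g W) \<subseteq> Y" using VY V(2) by (intro V_least) blast+
    then have all: "\<exists>v c. t = v + c ^ p * g \<and> v \<in> V W" for t
      using full unfolding Y_def by blast
    \<comment> \<open>Multiplication by the \<open>p\<close>-th power of an element of
      \<open>\<mm>\<close> sends everything into \<open>Y2\<close>. Hence the largest ideal
      \<open>Z\<close> inside \<open>Y2\<close> contains the ideal in \<open>H\<close>, which puts
      \<open>g\<close> itself into \<open>Y2\<close>.\<close>
    define Y2 where "Y2 = {v + \<mu> ^ p * g | v \<mu>. v \<in> V W \<and> \<mu> \<in> \<mm>}"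
    have VY2: "V W \<subseteq> Y2"
      unfolding Y2_def using zero is_ideal_zero[OF ideal_m] by blast
    have Y2_add: "x + y \<in> Y2" if xy: "x \<in> Y2" "y \<in> Y2" for x y
    proof -
      obtain v c where vc: "x = v + c ^ p * g" "v \<in> V W" "c \<in> \<mm>"
        using xy(1) unfolding Y2_def by blast
      obtain v' c' where vc': "y = v' + c' ^ p * g" "v' \<in> V W" "c' \<in> \<mm>"
        using xy(2) unfolding Y2_def by blast
      show "x + y \<in> Y2"
        using combine[OF vc(2) vc'(2), of c g c'] is_ideal_add[OF ideal_m vc(3) vc'(3)]
        unfolding Y2_def vc(1) vc'(1) by blast
    qed
    define Z where "Z = {h. \<forall>t. h * t \<in> Y2}"
    have "is_ideal Z"
    proof (rule is_idealI)
      show "0 \<in> Z" using VY2 VJ is_ideal_zero[OF ideal_J] by (auto simp: Z_def)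
      show "x + y \<in> Z" if "x \<in> Z" "y \<in> Z" for x y
        using that Y2_add by (auto simp: Z_def distrib_right)
      show "r * x \<in> Z" if "x \<in> Z" for r x
        using that by (auto simp: Z_def mult.assoc mult.left_commute[of r])
    qed
    moreover have "J \<subseteq> Z" using VY2 VJ is_ideal_mult_right[OF ideal_J] by (fastforce simp: Z_def)
    moreover have "\<mu> ^ p \<in> Z" if "\<mu> \<in> \<mm>" for \<mu>
      unfolding Z_def
    proof (intro CollectI allI)
      fix t
      obtain v c where "t = v + c ^ p * g" "v \<in> V W" using all by blast
      then have "\<mu> ^ p * t = \<mu> ^ p * v + (\<mu> * c) ^ p * g" "\<mu> ^ p * v \<in> V W" "\<mu> * c \<in> \<mm>"
        using V(4) that is_ideal_mult_right[OF ideal_m] by (auto simp: algebra_simps power_mult_distrib)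
      then show "\<mu> ^ p * t \<in> Y2" unfolding Y2_def by blast
    qed
    ultimately have HZ: "ideal_gen (J \<union> {\<mu> ^ p | \<mu>. \<mu> \<in> \<mm>}) \<subseteq> Z" by (intro ideal_gen_least) auto
    obtain x where x: "x \<in> X" "g - x \<in> ideal_gen (J \<union> {\<mu> ^ p | \<mu>. \<mu> \<in> \<mm>})" using H by blast
    then have "(g - x) * 1 \<in> Y2" using HZ unfolding Z_def by blast
    then have "x + (g - x) \<in> Y2" using x(1) V(1) VY2 by (intro Y2_add) auto
    then obtain v \<nu> where \<nu>: "g = v + \<nu> ^ p * g" "v \<in> V W" "\<nu> \<in> \<mm>" by (auto simp: Y2_def)
    have "1 - \<nu> \<notin> \<mm>"
      using is_ideal_add[OF ideal_m _ \<nu>(3), of "1 - \<nu>"] prime_m by (auto simp: is_prime_def)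
    \<comment> \<open>From \<open>g = v + \<nu> ^ p * g\<close> one gets
      \<open>(1 - \<nu>) ^ p * g = v\<close> modulo \<open>J\<close>, and multiplication by
      \<open>u ^ p\<close> isolates \<open>g\<close>.\<close>
    then obtain u where u: "(1 - \<nu>) * u - 1 \<in> J" using inverse_mod by blast
    have "(1 - \<nu>) ^ p - (1 - \<nu> ^ p) \<in> J" using frob_diff[of 1 \<nu> 1] by simp
    then have "((1 - \<nu>) ^ p - (1 - \<nu> ^ p)) * (u ^ p * g) \<in> J" by (rule is_ideal_mult_right[OF ideal_J])
    moreover have "(((1 - \<nu>) * u) ^ p - 1) * g \<in> J"
      using is_ideal_power_diff[OF ideal_J u, of p] by (intro is_ideal_mult_right ideal_J) simp
    ultimately have "((1 - \<nu>) ^ p - (1 - \<nu> ^ p)) * (u ^ p * g) - (((1 - \<nu>) * u) ^ p - 1) * g \<in> J"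
      by (rule is_ideal_diff[OF ideal_J])
    then have "(((1 - \<nu>) ^ p - (1 - \<nu> ^ p)) * (u ^ p * g) - (((1 - \<nu>) * u) ^ p - 1) * g) + u ^ p * v \<in> V W"
      using VJ V(4)[OF \<nu>(2)] by (intro V(3)) auto
    moreover have "v = g - \<nu> ^ p * g" by (subst (1) \<nu>(1)) simp
    moreover have "(a - (1 - n)) * (U * g) - (a * U - 1) * g + U * (g - n * g) = g" for a n U
      by (simp add: algebra_simps)
    ultimately have "g \<in> V W" by (simp only: power_mult_distrib)
    moreover have "closed (V W)" using V by (auto simp: closed_def)
    ultimately have "V (insert g W) \<subseteq> V W" using V(2) by (intro V_least) auto
    with full show ?thesis by blast
  qed
  have "finite A \<Longrightarrow> V A = UNIV \<Longrightarrow> V {} = UNIV" for A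
    by (induction A rule: finite_induct) (use step in auto)
  moreover have "V G = UNIV"
    by (rule generation) (use VJ V(2-4) in \<open>auto dest: subsetD[OF V(2)]\<close>)
  ultimately have "V {} = UNIV" using finite_G by blast
  moreover have "V {} \<subseteq> X" by (rule V_least) (use X in \<open>auto simp: closed_def\<close>)
  ultimately show ?thesis by blast
qed

end

section \<open>From exponents below p to exponents below powers of p\<close>

context char_p_above
begin

lemma lin_one_exponent: "lin z (Suc 0) N c = c (replicate N 0)"
  by (induction N arbitrary: c) auto

text \<open>Digit by digit, an exponent below \<open>p q\<close> is \<open>p a + b\<close> with \<open>b < p\<close> and \<open>a < q\<close>.\<close>

lemma lin_mult_exponent:
  "lin z (p * q) N c - lin z p N (\<lambda>bs. lin z q N (\<lambda>as. c (map2 (\<lambda>b a. p * a + b) bs as))) \<in> J"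
proof (induction N arbitrary: c)
  case 0
  then show ?case by (simp add: power_mult[symmetric] mult.commute is_ideal_zero ideal_J)
next
  case (Suc N)
  define D where "D = (\<lambda>c. lin z p N (\<lambda>bs. lin z q N (\<lambda>as. c (map2 (\<lambda>b a. p * a + b) bs as))))"
  define cc where "cc j = (\<lambda>l. c (j # l))" for j
  have shift: "(\<Sum>j=a*p..<a*p+p. F j) = (\<Sum>b<p. F (p * a + b))" for F :: "nat \<Rightarrow> 'c" and a
    using sum.shift_bounds_nat_ivl[of F 0 "a * p" p]
    by (simp add: lessThan_atLeast0 mult.commute[of p] add.commute)
  have "lin z (p * q) (Suc N) c = (\<Sum>a<q. \<Sum>j=a*p..<a*p+p. lin z (p * q) N (cc j) * z N ^ j)"
    by (simp add: sum.nat_group mult.commute[of p] cc_def)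
  also have "\<dots> = (\<Sum>a<q. \<Sum>b<p. lin z (p * q) N (cc (p * a + b)) * z N ^ (p * a + b))"
    by (simp only: shift)
  also have "\<dots> = (\<Sum>b<p. \<Sum>a<q. lin z (p * q) N (cc (p * a + b)) * z N ^ (p * a + b))"
    by (rule sum.swap)
  finally have lhs: "lin z (p * q) (Suc N) c =
    (\<Sum>b<p. \<Sum>a<q. lin z (p * q) N (cc (p * a + b)) * z N ^ (p * a + b))" .
  have "lin z p N (\<lambda>bs. \<Sum>a<q. lin z q N (\<lambda>as. cc (p * a + b) (map2 (\<lambda>b a. p * a + b) bs as)) * z N ^ a)
      - (\<Sum>a<q. z N ^ (p * a) * D (cc (p * a + b))) \<in> J" for b
  proof -
    have "(\<Sum>a<q. z N ^ (p * a) * D (cc (p * a + b))) =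
        (\<Sum>a<q. lin z p N (\<lambda>bs. z N ^ a * lin z q N (\<lambda>as. cc (p * a + b) (map2 (\<lambda>b a. p * a + b) bs as))))"
      unfolding D_def lin_scale by (simp add: power_mult[symmetric] mult.commute[of p])
    then show ?thesis
      using lin_sum[of "{..<q}" z 1 N
          "\<lambda>a bs. z N ^ a * lin z q N (\<lambda>as. cc (p * a + b) (map2 (\<lambda>b a. p * a + b) bs as))"]
      by (simp add: mult.commute)
  qed
  then have "(\<Sum>b<p. (lin z p N (\<lambda>bs. \<Sum>a<q. lin z q N (\<lambda>as. cc (p * a + b) (map2 (\<lambda>b a. p * a + b) bs as)) * z N ^ a)
      - (\<Sum>a<q. z N ^ (p * a) * D (cc (p * a + b)))) * z N ^ b) \<in> J" (is "?A \<in> J")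
    by (intro is_ideal_sum is_ideal_mult_right ideal_J)
  moreover have "(\<Sum>b<p. \<Sum>a<q. (lin z (p * q) N (cc (p * a + b)) - D (cc (p * a + b))) * z N ^ (p * a + b)) \<in> J"
    (is "?B \<in> J")
    unfolding D_def by (intro is_ideal_sum is_ideal_mult_right ideal_J Suc)
  ultimately have "?B - ?A \<in> J" by (intro is_ideal_diff[OF ideal_J])
  also have "?B - ?A = lin z (p * q) (Suc N) c
      - lin z p (Suc N) (\<lambda>bs. lin z q (Suc N) (\<lambda>as. c (map2 (\<lambda>b a. p * a + b) bs as)))"
  proof -
    have "(\<Sum>b<p. \<Sum>a<q. (F a b - U a b) * Z ^ (p * a + b))
        - (\<Sum>b<p. (E b - (\<Sum>a<q. Z ^ (p * a) * U a b)) * Z ^ b)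
        = (\<Sum>b<p. \<Sum>a<q. F a b * Z ^ (p * a + b)) - (\<Sum>b<p. E b * Z ^ b)"
      for F U :: "nat \<Rightarrow> nat \<Rightarrow> 'c" and E Z
    proof -
      have "(\<Sum>a<q. Z ^ (p * a) * U a b) * Z ^ b = (\<Sum>a<q. U a b * Z ^ (p * a + b))" for b
        unfolding sum_distrib_right by (intro sum.cong) (simp_all add: power_add mult_ac)
      then show ?thesis by (simp add: left_diff_distrib sum_subtractf)
    qed
    then show ?thesis unfolding lhs by (simp add: cc_def)
  qed
  finally show ?case .
qed

text \<open>Splitting off the lowest digit of every exponent turns a relation of level
  \<open>p ^ Suc e\<close> into one of level \<open>p\<close>, whose coefficients are combinations
  of level \<open>p ^ e\<close>. Independence is then used once at each of the two levels.\<close>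

lemma indelin_span_closed:
  assumes K: "is_ideal K" "J \<subseteq> K" and ind: "indep z p N K"
  shows "indep z (p ^ e) N K"
proof (induction e)
  case 0
  have "b = replicate N 0" if "b \<in> idx (Suc 0) N" for b
    using that by (intro replicate_eqI) (auto simp: idx_def)
  then show ?case by (auto simp: indep_def lin_one_exponent)
next
  case (Suc e)
  show ?case
    unfolding indep_def
  proof (intro allI impI ballI)
    fix c b assume c: "lin z (p ^ Suc e) N c \<in> K" and b: "b \<in> idx (p ^ Suc e) N"
    have p: "p > 0" using prime_gt_0_nat[OF prime_p] .
    define bs as where "bs = map (\<lambda>i. i mod p) b" and "as = map (\<lambda>i. i div p) b"
    have idx: "bs \<in> idx p N" "as \<in> idx (p ^ e) N"
      using b p by (auto simp: idx_def bs_def as_def less_mult_imp_div_less mult.commute)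
    have "map2 (\<lambda>b a. p * a + b) bs as = b"
      unfolding bs_def as_def by (rule nth_equalityI) auto
    moreover have "lin z p N (\<lambda>bs. lin z (p ^ e) N (\<lambda>as. c (map2 (\<lambda>b a. p * a + b) bs as))) \<in> K"
      using is_ideal_diff_iff[OF K(1) subsetD[OF K(2) lin_mult_exponent]] c by simp
    then have "lin z (p ^ e) N (\<lambda>as. c (map2 (\<lambda>b a. p * a + b) bs as)) \<in> K"
      using ind idx(1) by (auto simp: indep_def)
    then have "c (map2 (\<lambda>b a. p * a + b) bs as) \<in> K"
      using Suc idx(2) by (auto simp: indep_def)
    ultimately show "c b \<in> K" by simp
  qed
qed

lemma lin_span_power_UNIV:
  assumes "lin_span z p N J = UNIV"
  shows "lin_span z (p ^ e) N J = UNIV"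
proof (induction e)
  case 0
  have "s - lin z (p ^ 0) N (\<lambda>_. s) \<in> J" for s
    by (simp add: lin_one_exponent is_ideal_zero ideal_J)
  then show ?case unfolding lin_span_def by blast
next
  case (Suc e)
  have "s \<in> lin_span z (p ^ Suc e) N J" for s
  proof -
    obtain c where c: "s - lin z p N c \<in> J" using assms unfolding lin_span_def by blast
    have "\<exists>d. c b - lin z (p ^ e) N d \<in> J" for b using Suc unfolding lin_span_def by blast
    then obtain d where d: "\<And>b. c b - lin z (p ^ e) N (d b) \<in> J" by metis
    \<comment> \<open>The two nested expansions are merged: the remainders of the exponents by
      \<open>p\<close> select the outer monomial and the quotients the inner one.\<close>
    define g where "g b = d (map (\<lambda>i. i mod p) b) (map (\<lambda>i. i div p) b)" for b
    have g: "lin z (p ^ e) N (\<lambda>as. g (map2 (\<lambda>b a. p * a + b) bs as)) - lin z (p ^ e) N (d bs) \<in> J"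
      if bs: "bs \<in> idx p N" for bs
    proof (rule lin_cong_mod[OF ideal_J])
      fix as assume as: "as \<in> idx (p ^ e) N"
      have "map (\<lambda>i. i mod p) (map2 (\<lambda>b a. p * a + b) bs as) = bs"
        "map (\<lambda>i. i div p) (map2 (\<lambda>b a. p * a + b) bs as) = as"
        using bs as prime_gt_0_nat[OF prime_p] by (auto simp: idx_def subset_iff intro!: nth_equalityI)
      then show "g (map2 (\<lambda>b a. p * a + b) bs as) - d bs as \<in> J"
        by (simp add: g_def is_ideal_zero ideal_J)
    qed
    have "lin z p N (\<lambda>bs. lin z (p ^ e) N (\<lambda>as. g (map2 (\<lambda>b a. p * a + b) bs as))) - lin z p N c \<in> J"
    proof (rule lin_cong_mod[OF ideal_J])
      fix bs assume "bs \<in> idx p N"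
      from is_ideal_diff_trans[OF ideal_J g[OF this] is_ideal_diff_commute[OF ideal_J d]]
      show "lin z (p ^ e) N (\<lambda>as. g (map2 (\<lambda>b a. p * a + b) bs as)) - c bs \<in> J" .
    qed
    from is_ideal_diff_trans[OF ideal_J lin_mult_exponent this]
    have "lin z (p ^ Suc e) N g - lin z p N c \<in> J" by simp
    from is_ideal_diff_trans[OF ideal_J c is_ideal_diff_commute[OF ideal_J this]]
    show ?thesis by (auto simp: lin_span_def)
  qed
  then show ?case by blast
qed

end

section \<open>Extending the residue field basis one parameter at a time\<close>

locale regular_f_finite =
  regular_parameters J \<mm> d x I A0 + f_finite_above J \<mm> p G
  for J \<mm> :: "'c::comm_ring_1 set" and d x I A0 p G
begin

text \<open>Modulo the ideal for \<open>I (Suc k)\<close>, an element minus its expansion is a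
  multiple of \<open>x k\<close>, and the cofactor can be expanded in turn. After \<open>p\<close>
  rounds the remainder carries \<open>x k ^ p\<close>, which is among the \<open>p\<close>-th powers
  of \<open>\<mm>\<close>.\<close>

lemma span_step:
  assumes k: "k < d" and x: "z N = x k"
    and span: "lin_span z p N (ideal_gen (I k \<union> {\<mu> ^ p | \<mu>. \<mu> \<in> \<mm>})) = UNIV"
  shows "lin_span z p (Suc N) (ideal_gen (I (Suc k) \<union> {\<mu> ^ p | \<mu>. \<mu> \<in> \<mm>})) = UNIV"
proof -
  define H where "H k = ideal_gen (I k \<union> {\<mu> ^ p | \<mu>. \<mu> \<in> \<mm>})" for k
  define X where "X = lin_span z p (Suc N) (H (Suc k))"
  have H: "is_ideal (H k)" for k by (simp add: H_def is_ideal_gen)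
  have sub: "I k \<subseteq> H k" "\<mu> \<in> \<mm> \<Longrightarrow> \<mu> ^ p \<in> H k" for k \<mu>
    using subset_ideal_gen[of "I k \<union> {\<mu> ^ p | \<mu>. \<mu> \<in> \<mm>}"] by (auto simp: H_def)
  have JH: "J \<subseteq> H (Suc k)" using J_le_I[of "Suc k"] sub(1) k by fastforce
  note HJ = H[of "Suc k"] JH
  have X_add: "a + b \<in> X" if "a \<in> X" "b \<in> X" for a b
    using that lin_span_closed(1)[OF HJ] by (simp add: X_def)
  have HX: "H (Suc k) \<subseteq> X" using lin_span_ideal[OF HJ p_pos] by (auto simp: X_def)
  have X_var: "x k ^ i * a \<in> X" if "a \<in> X" for a i
  proof (induction i)
    case (Suc i)
    have "z N * (x k ^ i * a) \<in> X" unfolding X_def by (rule lin_span_var[OF HJ]) (use Suc p_pos X_def in auto)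
    then show ?case by (simp add: x mult.assoc)
  qed (simp add: that)
  have lin_X: "lin z p N c \<in> X" for c
  proof -
    have "lin z p N c * 1 \<in> X"
    proof (rule lin_mult_closed)
      show "0 \<in> X" using HX is_ideal_zero[OF H] by blast
      show "r ^ p * a \<in> X" if "a \<in> X" for r a
        using that lin_span_scale[OF HJ] by (simp add: X_def)
      show "z i * a \<in> X" if "i < N" "a \<in> X" for i a
        unfolding X_def by (rule lin_span_var[OF HJ]) (use that p_pos X_def in auto)
      show "1 \<in> X" unfolding X_def using lin_span_power[OF HJ p_pos, of 1] by simp
    qed (rule X_add)
    then show ?thesis by simp
  qed
  have HkA: "H k \<subseteq> adjoin (H (Suc k)) (x k)"
    unfolding H_def[of k]
  proof (rule ideal_gen_least[OF is_ideal_adjoin[OF H]])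
    have "I k \<subseteq> adjoin (H (Suc k)) (x k)"
      using sub(1)[of "Suc k"] k by (auto simp: I_step adjoin_def)
    then show "I k \<union> {\<mu> ^ p |\<mu>. \<mu> \<in> \<mm>} \<subseteq> adjoin (H (Suc k)) (x k)"
      using sub(2)[of _ "Suc k"] subset_adjoin[of "H (Suc k)" "x k"] by blast
  qed
  have "\<exists>t. \<exists>v\<in>X. s = v + x k ^ i * t" for s i
  proof (induction i)
    case 0
    then show ?case using HX is_ideal_zero[OF H] by (intro exI[of _ s] bexI[of _ 0]) auto
  next
    case (Suc i)
    then obtain t v where tv: "v \<in> X" "s = v + x k ^ i * t" by blast
    obtain c where c: "t - lin z p N c \<in> H k"
      using span unfolding H_def[symmetric] by (auto simp: lin_span_def)
    then obtain h r where hr: "h \<in> H (Suc k)" "t - lin z p N c = h + r * x k"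
      using HkA by (auto simp: adjoin_def)
    have "t = lin z p N c + (t - lin z p N c)" by simp
    then have t: "t = lin z p N c + (h + r * x k)" unfolding hr(2) .
    have "s = (v + x k ^ i * (lin z p N c + h)) + x k ^ Suc i * r"
      unfolding tv(2) t by (simp add: algebra_simps)
    moreover have "v + x k ^ i * (lin z p N c + h) \<in> X"
      by (intro X_add tv X_var lin_X subsetD[OF HX hr(1)])
    ultimately show ?case by blast
  qed
  then have "s \<in> X" for s
  proof -
    assume "\<And>s i. \<exists>t. \<exists>v\<in>X. s = v + x k ^ i * t"
    then obtain t v where tv: "v \<in> X" "s = v + x k ^ p * t" by blast
    have "x k ^ p * t \<in> H (Suc k)" by (intro is_ideal_mult_right H sub x_in_m k)
    with tv HX X_add show ?thesis by blast
  qed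
  then show ?thesis unfolding X_def H_def by blast
qed

text \<open>A relation modulo \<open>I (Suc k)\<close> forces the coefficients of \<open>x\<^sup>0\<close> into \<open>I k\<close>, so that \<open>x\<^sup>p\<close> can be
  split off from them; dividing by \<open>x\<close> gives a relation whose coefficients are rotated by one place.
  Hence every coefficient is divisible by \<open>x\<close> up to other coefficients, and Nakayama applies.\<close>

lemma indep_step:
  assumes k: "k < d" and x: "z N = x k" and ind: "indep z p N (I k)"
  shows "indep z p (Suc N) (I (Suc k))"
proof -
  define Q where "Q = I (Suc k)"
  have Q: "is_prime Q" "is_ideal Q" "J \<subseteq> Q" "x k \<notin> Q"
    using k prime_I[of "Suc k"] J_le_I[of "Suc k"] x_notin_I[OF k] by (auto simp: Q_def is_prime_ideal)
  have Ik: "I k = adjoin Q (x k)" "is_ideal (I k)" using k I_step ideal_I[of k] by (auto simp: Q_def)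
  have xI: "x k \<in> I k" "Q \<subseteq> I k" unfolding Ik by (auto simp: mem_adjoin Q subset_adjoin[THEN subsetD])
  define rel where "rel c \<longleftrightarrow> lin z p (Suc N) c \<in> Q" for c
  define C where "C = ideal_gen (Q \<union> {c b | c b. rel c \<and> b \<in> idx p (Suc N)})"
  have C: "is_ideal C" "Q \<subseteq> C" "\<And>c b. rel c \<Longrightarrow> b \<in> idx p (Suc N) \<Longrightarrow> c b \<in> C"
    using subset_ideal_gen[of "Q \<union> {c b | c b. rel c \<and> b \<in> idx p (Suc N)}"]
    by (auto simp: C_def is_ideal_gen)
  define A where "A = {q + x k * g | q g. q \<in> Q \<and> g \<in> C}"
  obtain p' where p': "p = Suc p'" using p_pos by (cases p) auto
  have rotate: "(\<forall>bs\<in>idx p N. c (0 # bs) \<in> A) \<and>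
      (\<exists>c'. rel c' \<and> (\<forall>j<p'. \<forall>bs. c' (j # bs) = c (Suc j # bs)))" if c: "rel c" for c
  proof -
    define l where "l j = lin z p N (\<lambda>bs. c (j # bs))" for j
    define S where "S = (\<Sum>j<p'. l (Suc j) * x k ^ j)"
    have split: "lin z p (Suc N) c = l 0 + x k * S"
      unfolding lin.simps p' sum.lessThan_Suc_shift S_def sum_distrib_left
      by (simp add: x l_def p' mult_ac)
    have "l 0 + x k * S \<in> I k" using c split xI by (auto simp: rel_def)
    then have "(l 0 + x k * S) - x k * S \<in> I k"
      by (intro is_ideal_diff[OF Ik(2)] is_ideal_mult_right[OF Ik(2) xI(1)])
    then have "l 0 \<in> I k" by simp
    have "\<exists>r. c (0 # bs) - x k * r \<in> Q" if "bs \<in> idx p N" for bs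
    proof -
      have "c (0 # bs) \<in> adjoin Q (x k)"
        using ind \<open>l 0 \<in> I k\<close> that unfolding indep_def l_def Ik(1)[symmetric] by blast
      then obtain i r where "i \<in> Q" "c (0 # bs) = i + r * x k" by (auto simp: adjoin_def)
      then show ?thesis by (intro exI[of _ r]) (simp add: mult.commute)
    qed
    then obtain r where r: "\<And>bs. bs \<in> idx p N \<Longrightarrow> c (0 # bs) - x k * r bs \<in> Q" by metis
    have "l 0 - lin z p N (\<lambda>bs. x k * r bs) \<in> Q"
      unfolding l_def by (rule lin_cong_mod[OF Q(2)]) (rule r)
    moreover have "l 0 + x k * S \<in> Q" using c unfolding rel_def split .
    ultimately have "(l 0 + x k * S) - (l 0 - x k ^ p * lin z p N r) \<in> Q"
      unfolding lin_scale by (intro is_ideal_diff[OF Q(2), of "l 0 + x k * S"])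
    then have "x k * (S + x k ^ p' * lin z p N r) \<in> Q" by (simp add: algebra_simps p')
    then have "S + x k ^ p' * lin z p N r \<in> Q" using Q by (auto simp: is_prime_def)
    define c' where "c' b = (if hd b = p' then r (tl b) else c (Suc (hd b) # tl b))" for b
    have "lin z p (Suc N) c' = S + x k ^ p' * lin z p N r"
      by (simp add: p' c'_def S_def x l_def mult.commute)
    then have rel': "rel c'" using \<open>S + x k ^ p' * lin z p N r \<in> Q\<close> by (simp add: rel_def)
    have "c (0 # bs) \<in> A" if bs: "bs \<in> idx p N" for bs
    proof -
      have "c' (p' # bs) \<in> C" using bs p' by (intro C(3) rel') simp
      then have "r bs \<in> C" by (simp add: c'_def)
      moreover have "c (0 # bs) = (c (0 # bs) - x k * r bs) + x k * r bs" by simp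
      ultimately show ?thesis unfolding A_def using r[OF bs] by blast
    qed
    with rel' show ?thesis by (auto simp: c'_def intro!: exI[of _ c'])
  qed
  \<comment> \<open>Repeated rotation brings the coefficients at exponent \<open>j\<close> to
    exponent 0, where \<open>rotate\<close> applies.\<close>
  have coeffs: "c (j # bs) \<in> A" if "rel c" "j < p" "bs \<in> idx p N" for c j bs
    using that
  proof (induction j arbitrary: c)
    case 0
    then show ?case using rotate by blast
  next
    case (Suc j)
    from rotate[OF Suc.prems(1)] obtain c' where "rel c'" "\<forall>j<p'. \<forall>bs. c' (j # bs) = c (Suc j # bs)" by blast
    with Suc show ?case using p' by (metis Suc_less_eq less_SucI)
  qed
  have "C \<subseteq> A"
    unfolding C_def
  proof (rule ideal_gen_least)
    show "is_ideal A"
    proof (rule is_idealI)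
      have "0 = 0 + x k * 0" by simp
      then show "0 \<in> A" unfolding A_def using is_ideal_zero[OF Q(2)] is_ideal_zero[OF C(1)] by blast
    next
      fix a b assume "a \<in> A" "b \<in> A"
      then obtain q g q' g' where qg: "a = q + x k * g" "q \<in> Q" "g \<in> C" "b = q' + x k * g'" "q' \<in> Q" "g' \<in> C"
        unfolding A_def by blast
      then have "a + b = (q + q') + x k * (g + g')" by (simp add: algebra_simps)
      with is_ideal_add[OF Q(2) qg(2,5)] is_ideal_add[OF C(1) qg(3,6)] show "a + b \<in> A"
        unfolding A_def by blast
    next
      fix a t assume "a \<in> A"
      then obtain q g where qg: "a = q + x k * g" "q \<in> Q" "g \<in> C" unfolding A_def by blast
      then have "t * a = t * q + x k * (t * g)" by (simp add: algebra_simps)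
      with is_ideal_mult_left[OF Q(2) qg(2)] is_ideal_mult_left[OF C(1) qg(3)] show "t * a \<in> A"
        unfolding A_def by blast
    qed
    have "q \<in> A" if "q \<in> Q" for q
    proof -
      have "q = q + x k * 0" by simp
      with that is_ideal_zero[OF C(1)] show ?thesis unfolding A_def by blast
    qed
    then show "Q \<union> {c b |c b. rel c \<and> b \<in> idx p (Suc N)} \<subseteq> A"
      using coeffs by (auto elim!: idx_SucE)
  qed
  then have "C \<subseteq> Q"
    unfolding A_def by (intro local_nakayama[OF Q(2,3) C(1) x_in_m[OF k]]) blast
  with C(3) show ?thesis unfolding indep_def rel_def Q_def by blast
qed

text \<open>The parameters are appended while the ideal shrinks from \<open>\<mm>\<close> to
  \<open>J\<close>. Independence passes directly from \<open>I k\<close> to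
  \<open>I (Suc k)\<close>, but spanning is first known only modulo the \<open>p\<close>-th powers
  of \<open>\<mm>\<close>; \<open>module_nakayama\<close> removes these at the end.\<close>

theorem exists_frobenius_basis:
  "\<exists>z M. (\<forall>i<d. z (M + i) \<in> \<mm>) \<and> indep z (p ^ e) M \<mm> \<and> indep z (p ^ e) (M + d) J
     \<and> lin_span z (p ^ e) (M + d) J = UNIV"
proof -
  obtain y M where y: "indep y p M \<mm>" "lin_span y p M \<mm> = UNIV" using exists_p_basis by blast
  define z where "z i = (if i < M then y i else x (i - M))" for i
  have yz: "lin y q M c = lin z q M c" for q c by (rule lin_cong_vars) (simp add: z_def)
  have zx: "z (M + k) = x k" for k by (simp add: z_def)
  define H where "H k = ideal_gen (I k \<union> {\<mu> ^ p | \<mu>. \<mu> \<in> \<mm>})" for k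
  have ind0: "indep z p M \<mm>" and span0: "lin_span z p M \<mm> = UNIV"
    using y by (simp_all add: indep_def lin_span_def yz)
  have ind: "k \<le> d \<Longrightarrow> indep z p (M + k) (I k)" for k
  proof (induction k)
    case (Suc k)
    then show ?case using indep_step[of k z "M + k"] zx by simp
  qed (use ind0 I_0 in simp)
  have span: "k \<le> d \<Longrightarrow> lin_span z p (M + k) (H k) = UNIV" for k
  proof (induction k)
    case 0
    have "\<mm> \<subseteq> H 0" using subset_ideal_gen I_0 unfolding H_def by blast
    then have "lin_span z p M \<mm> \<subseteq> lin_span z p M (H 0)" by (auto simp: lin_span_def)
    then show ?case unfolding span0 by (simp add: top.extremum_unique)
  next
    case (Suc k)
    then show ?case using span_step[of k z "M + k"] zx by (simp add: H_def)
  qed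
  have "lin_span z p (M + d) J = UNIV"
  proof (rule module_nakayama)
    note JJ = ideal_J order_refl[of J]
    show "J \<subseteq> lin_span z p (M + d) J" using lin_span_ideal[OF JJ p_pos] by blast
    show "\<exists>x\<in>lin_span z p (M + d) J. s - x \<in> ideal_gen (J \<union> {\<mu> ^ p | \<mu>. \<mu> \<in> \<mm>})" for s
    proof -
      have "s \<in> lin_span z p (M + d) (H d)" using span[of d] by simp
      then obtain c where "s - lin z p (M + d) c \<in> ideal_gen (J \<union> {\<mu> ^ p | \<mu>. \<mu> \<in> \<mm>})"
        by (auto simp: lin_span_def H_def I_d)
      moreover have "lin z p (M + d) c \<in> lin_span z p (M + d) J"
        using is_ideal_zero[OF ideal_J] unfolding lin_span_def by (auto intro!: exI[of _ c])
      ultimately show ?thesis by blast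
    qed
  qed (use lin_span_closed(1)[OF ideal_J order_refl] lin_span_scale[OF ideal_J order_refl] in auto)
  then have "lin_span z (p ^ e) (M + d) J = UNIV" by (rule lin_span_power_UNIV)
  moreover have "indep z (p ^ e) (M + d) J"
    using indelin_span_closed[OF ideal_J order_refl] ind[of d] I_d by simp
  moreover have "indep z (p ^ e) M \<mm>" by (rule indelin_span_closed[OF ideal_m J_le_m ind0])
  ultimately show ?thesis using x_in_m zx by (intro exI[of _ z] exI[of _ M]) simp
qed

end

section \<open>Divided power operators\<close>

text \<open>Divided powers of the partial derivatives applied to \<open>lin z q N c\<close>; a list of orders that is shorter
  than \<open>N\<close> leaves the first variables alone.\<close>

fun dlin :: "(nat \<Rightarrow> 'c::comm_ring_1) \<Rightarrow> nat \<Rightarrow> nat list \<Rightarrow> nat \<Rightarrow> (nat list \<Rightarrow> 'c) \<Rightarrow> 'c" where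
  "dlin z q [] N c = lin z q N c"
| "dlin z q (k # ks) (Suc N) c =
    (\<Sum>j<q. of_nat (j choose k) * dlin z q ks N (\<lambda>bs. c (j # bs)) * z N ^ (j - k))"
| "dlin z q (k # ks) 0 c = 0"

section \<open>Differential operators of bounded order on a type-class ring\<close>

definition additive_map :: "('c::comm_ring_1 \<Rightarrow> 'c) \<Rightarrow> bool" where
  "additive_map D \<longleftrightarrow> (\<forall>x y. D (x + y) = D x + D y)"

fun diff_op :: "nat \<Rightarrow> ('c::comm_ring_1 \<Rightarrow> 'c) \<Rightarrow> bool" where
  "diff_op 0 D \<longleftrightarrow> additive_map D \<and> (\<forall>s x. D (s * x) = s * D x)"
| "diff_op (Suc n) D \<longleftrightarrow> additive_map D \<and> (\<forall>s. diff_op n (\<lambda>x. D (s * x) - s * D x))"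

lemma diff_op_additive: "diff_op n D \<Longrightarrow> additive_map D"
  by (cases n) auto

lemma diff_op_zero: "diff_op n (\<lambda>x. 0)"
  by (induction n) (auto simp: additive_map_def)

lemma diff_op_add: "diff_op n D \<Longrightarrow> diff_op n D' \<Longrightarrow> diff_op n (\<lambda>x. D x + D' x)"
proof (induction n arbitrary: D D')
  case (Suc n)
  have "diff_op n (\<lambda>x. (D (s * x) - s * D x) + (D' (s * x) - s * D' x))" for s
    using Suc.prems by (intro Suc.IH) auto
  moreover have "(\<lambda>x. (D (s * x) - s * D x) + (D' (s * x) - s * D' x))
      = (\<lambda>x. (D (s * x) + D' (s * x)) - s * (D x + D' x))" for s
    by (simp add: algebra_simps)
  ultimately show ?case using Suc.prems by (simp add: additive_map_def algebra_simps)
qed (auto simp: additive_map_def algebra_simps)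

lemma diff_op_mult_left: "diff_op n D \<Longrightarrow> diff_op n (\<lambda>x. t * D x)"
proof (induction n arbitrary: D)
  case (Suc n)
  have "diff_op n (\<lambda>x. t * (D (s * x) - s * D x))" for s
    using Suc.prems by (intro Suc.IH) auto
  moreover have "(\<lambda>x. t * (D (s * x) - s * D x)) = (\<lambda>x. t * D (s * x) - s * (t * D x))" for s
    by (simp add: algebra_simps)
  ultimately show ?case using Suc.prems by (simp add: additive_map_def algebra_simps)
qed (auto simp: additive_map_def algebra_simps)

lemma diff_op_mult_arg: "diff_op n D \<Longrightarrow> diff_op n (\<lambda>x. D (t * x))"
proof (induction n arbitrary: D)
  case (Suc n)
  have "diff_op n (\<lambda>x. D (s * (t * x)) - s * D (t * x))" for s
    using Suc.IH[of "\<lambda>x. D (s * x) - s * D x"] Suc.prems by simp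
  then show ?case using Suc.prems by (simp add: additive_map_def algebra_simps)
qed (auto simp: additive_map_def algebra_simps)

lemma diff_op_mono:
  assumes "diff_op m D" "m \<le> n"
  shows "diff_op n D"
proof -
  have Suc: "diff_op m D \<Longrightarrow> diff_op (Suc m) D" for m D
  proof (induction m arbitrary: D)
    case 0
    then show ?case by (simp add: diff_op_zero additive_map_def)
  next
    case (Suc m)
    have "diff_op (Suc m) (\<lambda>x. D (s * x) - s * D x)" for s
      using Suc.prems by (intro Suc.IH) simp
    then show ?case using diff_op_additive[OF Suc.prems] by (subst diff_op.simps(2)) blast
  qed
  show ?thesis using assms(2,1) by (induction rule: dec_induct) (blast intro: Suc)+
qed

text \<open>The quotient by \<open>J\<close> is the direct factor cut out by the idempotent
  \<open>\<epsilon>\<close>. Multiplication by \<open>\<epsilon>\<close> turns congruences modulo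
  \<open>J\<close> into equalities, so the operators become genuine functions on the ambient ring
  with exact identities.\<close>

locale factor_basis = char_p_above J \<mm> p for J \<mm> :: "'c::comm_ring_1 set" and p +
  fixes \<epsilon> :: 'c and z :: "nat \<Rightarrow> 'c" and M d e q :: nat
  defines "q \<equiv> p ^ e"
  assumes idem: "\<epsilon> * \<epsilon> = \<epsilon>" and J_ann: "J = {x. \<epsilon> * x = 0}"
    and z_m: "i < d \<Longrightarrow> z (M + i) \<in> \<mm>"
    and indep_m: "indep z q M \<mm>" and indep_J: "indep z q (M + d) J"
    and span_J: "lin_span z q (M + d) J = UNIV"
begin

lemma q_pos': "q > 0"
  using q_pos by (simp add: q_def)

lemma mod_iff: "x - y \<in> J \<longleftrightarrow> \<epsilon> * x = \<epsilon> * y"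
  by (simp add: J_ann algebra_simps)

lemma idem_left: "\<epsilon> * (\<epsilon> * x) = \<epsilon> * x"
  by (simp add: mult.assoc[symmetric] idem)

lemma idem_power: "n > 0 \<Longrightarrow> \<epsilon> ^ n = \<epsilon>"
proof (induction n)
  case (Suc n)
  then show ?case by (cases n) (auto simp: idem)
qed simp

definition supported :: "(nat list \<Rightarrow> 'c) \<Rightarrow> bool" where
  "supported c \<longleftrightarrow> (\<forall>b. \<epsilon> * c b = c b)"

lemma supported_Cons: "supported c \<Longrightarrow> supported (\<lambda>bs. c (j # bs))"
  by (simp add: supported_def)

lemma supported_eta: "supported c \<Longrightarrow> (\<lambda>b. \<epsilon> * c b) = c"
  by (simp add: supported_def)

lemma lin_supported: "supported c \<Longrightarrow> \<epsilon> * lin z q N c = lin z q N c"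
  using lin_scale[of z q N \<epsilon> c] by (metis supported_eta idem_power q_pos')

lemma dlin_scale: "dlin z q as N (\<lambda>b. r * c b) = r ^ q * dlin z q as N c"
proof (induction z q as N c rule: dlin.induct)
  case (2 z q k ks N c)
  then show ?case by (simp add: sum_distrib_left mult_ac)
qed (auto simp: lin_scale)

lemma dlin_supported: "supported c \<Longrightarrow> \<epsilon> * dlin z q as N c = dlin z q as N c"
  using dlin_scale[of as N \<epsilon> c] by (metis supported_eta idem_power q_pos')

lemma lin_add_supported:
  assumes "supported c" "supported c'"
  shows "lin z q N (\<lambda>b. c b + c' b) = lin z q N c + lin z q N c'"
proof -
  have "supported (\<lambda>b. c b + c' b)" using assms by (simp add: supported_def distrib_left)
  moreover have "\<epsilon> * lin z q N (\<lambda>b. c b + c' b) = \<epsilon> * (lin z q N c + lin z q N c')"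
    using lin_add[of z e N c c'] by (simp add: q_def mod_iff)
  ultimately show ?thesis using assms by (simp add: lin_supported distrib_left)
qed

lemma dlin_add_supported:
  assumes "supported c" "supported c'"
  shows "dlin z q as N (\<lambda>b. c b + c' b) = dlin z q as N c + dlin z q as N c'"
  using assms
proof (induction as arbitrary: N c c')
  case Nil
  then show ?case by (simp add: lin_add_supported)
next
  case (Cons k ks)
  show ?case
  proof (cases N)
    case (Suc N')
    then show ?thesis
      using Cons.IH[OF supported_Cons[OF Cons.prems(1)] supported_Cons[OF Cons.prems(2)]]
      by (simp add: algebra_simps sum.distrib)
  qed simp
qed

lemma lin_cong_idx: "(\<And>b. b \<in> idx q N \<Longrightarrow> c b = c' b) \<Longrightarrow> lin z q N c = lin z q N c'"
proof (induction N arbitrary: c c')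
  case (Suc N)
  have "lin z q N (\<lambda>bs. c (j # bs)) = lin z q N (\<lambda>bs. c' (j # bs))" if "j < q" for j
    using that by (intro Suc.IH Suc.prems) simp
  then show ?case by simp
qed simp

lemma dlin_cong_idx: "(\<And>b. b \<in> idx q N \<Longrightarrow> c b = c' b) \<Longrightarrow> dlin z q as N c = dlin z q as N c'"
proof (induction as arbitrary: N c c')
  case Nil
  show ?case unfolding dlin.simps by (rule lin_cong_idx) (rule Nil)
next
  case (Cons k ks)
  show ?case
  proof (cases N)
    case (Suc N')
    have "dlin z q ks N' (\<lambda>bs. c (j # bs)) = dlin z q ks N' (\<lambda>bs. c' (j # bs))" if "j < q" for j
      using that by (intro Cons.IH Cons.prems) (simp add: Suc)
    then show ?thesis by (simp add: Suc)
  qed simp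
qed

text \<open>Independence determines the coefficients on \<open>idx\<close> modulo \<open>J\<close>,
  and the factor \<open>\<epsilon>\<close> turns this into uniqueness there. Outside
  \<open>idx\<close> the chosen values never enter \<open>lin\<close> or
  \<open>dlin\<close>.\<close>

definition coef :: "'c \<Rightarrow> nat list \<Rightarrow> 'c" where
  "coef s = (\<lambda>b. \<epsilon> * (SOME c. s - lin z q (M + d) c \<in> J) b)"

definition D :: "nat list \<Rightarrow> 'c \<Rightarrow> 'c" where
  "D as s = dlin z q as (M + d) (coef s)"

lemma supported_coef: "supported (coef s)"
  by (simp add: supported_def coef_def idem_left)

lemma lin_coef: "lin z q (M + d) (coef s) = \<epsilon> * s"
proof -
  have "\<exists>c. s - lin z q (M + d) c \<in> J" using span_J by (auto simp: lin_span_def)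
  then have "s - lin z q (M + d) (SOME c. s - lin z q (M + d) c \<in> J) \<in> J" by (rule someI_ex)
  then show ?thesis by (simp add: coef_def lin_scale idem_power q_pos' mod_iff)
qed

text \<open>Two supported expansions of the same element differ by a relation modulo
  \<open>J\<close>, whose coefficients vanish by independence. The algebraic properties of
  \<open>D\<close> below follow by exhibiting a convenient expansion.\<close>

lemma D_eqI:
  assumes "supported c" "\<epsilon> * s = lin z q (M + d) c"
  shows "D as s = dlin z q as (M + d) c"
  unfolding D_def
proof (rule dlin_cong_idx)
  fix b assume b: "b \<in> idx q (M + d)"
  have "lin z q (M + d) (\<lambda>b. coef s b - c b) - (lin z q (M + d) (coef s) - lin z q (M + d) c) \<in> J"
    unfolding q_def by (rule lin_diff)
  then have "lin z q (M + d) (\<lambda>b. coef s b - c b) \<in> J"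
    by (simp add: lin_coef assms(2))
  then have "coef s b - c b \<in> J" using indep_J b by (auto simp: indep_def)
  then show "coef s b = c b"
    using assms(1) supported_coef[of s] by (simp add: mod_iff supported_def)
qed

lemma D_supported: "\<epsilon> * D as s = D as s"
  by (simp add: D_def dlin_supported supported_coef)

lemma D_cong: "\<epsilon> * s = \<epsilon> * t \<Longrightarrow> D as s = D as t"
  using D_eqI[OF supported_coef[of t], of s as] by (simp add: lin_coef D_def)

lemma D_add: "D as (s + t) = D as s + D as t"
proof -
  have "D as (s + t) = dlin z q as (M + d) (\<lambda>b. coef s b + coef t b)"
  proof (rule D_eqI)
    show "supported (\<lambda>b. coef s b + coef t b)"
      using supported_coef by (simp add: supported_def distrib_left)
    show "\<epsilon> * (s + t) = lin z q (M + d) (\<lambda>b. coef s b + coef t b)"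
      by (simp add: lin_add_supported supported_coef lin_coef distrib_left)
  qed
  then show ?thesis by (simp add: D_def dlin_add_supported supported_coef)
qed

lemma D_power: "D as (r ^ q * s) = r ^ q * D as s"
proof -
  have "D as (r ^ q * s) = dlin z q as (M + d) (\<lambda>b. r * coef s b)"
  proof (rule D_eqI)
    show "supported (\<lambda>b. r * coef s b)"
      using supported_coef[of s] unfolding supported_def by (metis mult.left_commute)
    show "\<epsilon> * (r ^ q * s) = lin z q (M + d) (\<lambda>b. r * coef s b)"
      by (simp add: lin_scale lin_coef mult_ac)
  qed
  then show ?thesis by (simp add: D_def dlin_scale)
qed

lemma supported_shift: "supported c \<Longrightarrow> supported (shift z q i N c)"
proof -
  have "\<epsilon> * shift z q i N c b = shift z q i N c b" if "supported c" for b
    using that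
    by (induction z q i N c b rule: shift.induct) (auto simp: supported_def mult.left_commute[of \<epsilon>])
  then show "supported c \<Longrightarrow> supported (shift z q i N c)" by (simp add: supported_def)
qed

text \<open>If \<open>p\<close> did not divide \<open>q choose k\<close>, the identity between
  \<open>k * (q choose k)\<close> and \<open>q\<close> times a binomial coefficient would make
  \<open>q\<close> divide \<open>k\<close>. The integer \<open>p\<close> acts as zero only on the
  factor of \<open>\<epsilon>\<close>, hence the condition on \<open>x\<close>.\<close>

lemma choose_q_zero:
  assumes "\<epsilon> * x = x" "0 < k" "k < q"
  shows "of_nat (q choose k) * x = 0"
proof -
  have "p dvd (q choose k)"
  proof (rule ccontr)
    assume n: "\<not> p dvd (q choose k)"
    obtain k' q' where kq: "k = Suc k'" "q = Suc q'" using assms q_pos' by (cases k; cases q) auto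
    have "k * (q choose k) = q * (q' choose k')" unfolding kq by (rule Suc_times_binomial)
    then have "p ^ e dvd k * (q choose k)" by (metis dvd_triv_left q_def)
    moreover have "coprime (p ^ e) (q choose k)" using n prime_p by (simp add: prime_imp_coprime)
    ultimately have "q dvd k" by (simp add: coprime_dvd_mult_left_iff q_def)
    with assms show False by (auto dest: dvd_imp_le)
  qed
  then obtain t where t: "q choose k = p * t" by blast
  have "\<epsilon> * of_nat p = 0" using p_in_J by (simp add: J_ann)
  then have "of_nat p * (\<epsilon> * x) = 0" by (metis mult.assoc mult.commute mult_zero_left)
  then have "of_nat p * x = 0" using assms(1) by simp
  then show ?thesis unfolding t by (metis of_nat_mult mult.assoc mult.commute mult_zero_right)
qed

text \<open>The commutator of the divided power operator \<open>\<partial>\<^sup>[\<^sup>k\<^sup>]\<close> with its variable is \<open>\<partial>\<^sup>[\<^sup>k\<^sup>-\<^sup>1\<^sup>]\<close>, by Pascal's rule;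
  the wrap-around at exponent \<open>q\<close> is harmless because \<open>p\<close> divides the inner binomial coefficients of \<open>q\<close>.\<close>

lemma dlin_shift_head:
  assumes "supported c" "k < q"
  shows "dlin z q (k # ks) (Suc N) (shift z q N (Suc N) c) = z N * dlin z q (k # ks) (Suc N) c
    + (if k > 0 then dlin z q ((k - 1) # ks) (Suc N) c else 0)"
proof -
  define F where "F j = dlin z q ks N (\<lambda>bs. c (j # bs))" for j
  obtain q' where q': "q = Suc q'" using q_pos' by (cases q) auto
  have F: "\<epsilon> * F j = F j" for j unfolding F_def by (rule dlin_supported[OF supported_Cons[OF assms(1)]])
  have left: "dlin z q (k # ks) (Suc N) (shift z q N (Suc N) c) =
      of_nat (0 choose k) * (z N ^ q * F q') * z N ^ (0 - k)
      + (\<Sum>j<q'. of_nat (Suc j choose k) * F j * z N ^ (Suc j - k))"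
    unfolding dlin.simps q' sum.lessThan_Suc_shift
    by (simp add: F_def q' dlin_scale[unfolded q'])
  have expand: "dlin z q (k # ks) (Suc N) c = (\<Sum>j<q. of_nat (j choose k) * F j * z N ^ (j - k))" for k
    by (simp add: F_def)
  show ?thesis
  proof (cases k)
    case 0
    show ?thesis
      unfolding left expand unfolding 0 by (simp add: sum_distrib_left distrib_left mult_ac q')
  next
    case (Suc k')
    have pascal: "of_nat (Suc j choose k) * F j * z N ^ (Suc j - k)
        = z N * (of_nat (j choose k) * F j * z N ^ (j - k)) + of_nat (j choose k') * F j * z N ^ (j - k')" for j
    proof (cases "k \<le> j")
      case True
      then have "j - k' = Suc (j - k)" using Suc by simp
      then show ?thesis by (simp add: Suc algebra_simps)
    next
      case False
      then show ?thesis by (cases "j = k'") (auto simp: Suc binomial_eq_0)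
    qed
    have "0 = of_nat (Suc q' choose k) * F q' * z N ^ (Suc q' - k)"
      using choose_q_zero[OF F, of k q'] assms(2) Suc by (simp add: q')
    then have wrap: "z N * (of_nat (q' choose k) * F q' * z N ^ (q' - k))
        + of_nat (q' choose k') * F q' * z N ^ (q' - k') = 0"
      unfolding pascal by simp
    have "dlin z q (k # ks) (Suc N) (shift z q N (Suc N) c)
        = (\<Sum>j<q'. z N * (of_nat (j choose k) * F j * z N ^ (j - k)) + of_nat (j choose k') * F j * z N ^ (j - k'))"
      unfolding left pascal by (simp add: Suc)
    also have "\<dots> = (\<Sum>j<q. z N * (of_nat (j choose k) * F j * z N ^ (j - k)) + of_nat (j choose k') * F j * z N ^ (j - k'))"
      unfolding q' sum.lessThan_Suc wrap by simp
    also have "\<dots> = z N * dlin z q (k # ks) (Suc N) c + dlin z q (k' # ks) (Suc N) c"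
      unfolding expand sum.distrib sum_distrib_left ..
    finally show ?thesis by (simp add: Suc)
  qed
qed

definition lower :: "nat list \<Rightarrow> nat \<Rightarrow> nat list" where
  "lower as k = as[k := as ! k - 1]"

text \<open>Pascal's rule at an arbitrary variable. Orders are listed from the last variable, so
  variable \<open>i\<close> stands at position \<open>N - 1 - i\<close>; there is no extra term if
  it is not differentiated.\<close>

lemma dlin_shift:
  assumes "supported c" "set as \<subseteq> {..<q}" "length as \<le> N" "i < N"
  shows "dlin z q as N (shift z q i N c) = z i * dlin z q as N c
    + (if N - 1 - i < length as \<and> as ! (N - 1 - i) > 0 then dlin z q (lower as (N - 1 - i)) N c else 0)"
  using assms
proof (induction as arbitrary: N c)
  case Nil
  then show ?case by (simp add: lin_shift q_pos')
next
  case (Cons k ks)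
  obtain N' where N: "N = Suc N'" using Cons.prems by (cases N) auto
  show ?case
  proof (cases "i = N'")
    case True
    then show ?thesis using Cons.prems dlin_shift_head[of c k ks N'] by (simp add: N lower_def)
  next
    case False
    define pos where "pos = N' - 1 - i"
    have pos: "N - 1 - i = Suc pos" using False Cons.prems by (simp add: N pos_def)
    define B where "B \<longleftrightarrow> pos < length ks \<and> ks ! pos > 0"
    have IH: "dlin z q ks N' (shift z q i N' (\<lambda>bs. c (j # bs))) = z i * dlin z q ks N' (\<lambda>bs. c (j # bs))
      + (if B then dlin z q (lower ks pos) N' (\<lambda>bs. c (j # bs)) else 0)" for j
      unfolding B_def pos_def
      using False Cons.prems by (intro Cons.IH supported_Cons) (auto simp: N)
    have "dlin z q (k # ks) N (shift z q i N c) =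
      (\<Sum>j<q. of_nat (j choose k) * (z i * dlin z q ks N' (\<lambda>bs. c (j # bs))
        + (if B then dlin z q (lower ks pos) N' (\<lambda>bs. c (j # bs)) else 0)) * z N' ^ (j - k))"
      using False by (simp add: N IH)
    also have "\<dots> = z i * dlin z q (k # ks) N c + (if B then dlin z q (k # lower ks pos) N c else 0)"
      by (simp add: N sum_distrib_left sum.distrib algebra_simps)
    finally show ?thesis unfolding pos by (simp add: B_def lower_def)
  qed
qed

lemma D_var:
  assumes "set as \<subseteq> {..<q}" "length as = d" "i < M + d"
  shows "D as (z i * s) = z i * D as s
    + (if M + d - 1 - i < d \<and> as ! (M + d - 1 - i) > 0 then D (lower as (M + d - 1 - i)) s else 0)"
proof -
  have "D as (z i * s) = dlin z q as (M + d) (shift z q i (M + d) (coef s))"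
    using assms q_pos'
    by (intro D_eqI supported_shift supported_coef) (simp add: lin_shift lin_coef mult.left_commute)
  then show ?thesis
    using dlin_shift[OF supported_coef assms(1), of "M + d" i s] assms by (simp add: D_def)
qed

lemma dlin_zero_orders: "set as \<subseteq> {0} \<Longrightarrow> length as \<le> N \<Longrightarrow> dlin z q as N c = lin z q N c"
proof (induction as arbitrary: N c)
  case (Cons k ks)
  then show ?case by (cases N) auto
qed simp

text \<open>By \<open>D_var\<close>, the elements whose commutator with \<open>D as\<close> has
  order at most \<open>n\<close> are closed under multiplication by variables; they also contain 1
  and are closed under addition and \<open>q\<close>-th power multiples. So they contain every
  \<open>lin\<close>, and an element enters its commutator only through its product with
  \<open>\<epsilon>\<close>, which is such a \<open>lin\<close>.\<close>

lemma diff_op_D: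
  assumes "set as \<subseteq> {..<q}" "length as = d"
  shows "diff_op (sum_list as) (D as)"
  using assms
proof (induction "sum_list as" arbitrary: as)
  case 0
  then have "D as s = \<epsilon> * s" for s
    using dlin_zero_orders[of as "M + d" "coef s"] by (auto simp: D_def lin_coef)
  then have D: "D as = (\<lambda>s. \<epsilon> * s)" by blast
  have "diff_op 0 (D as)" unfolding D by (simp add: additive_map_def algebra_simps)
  then show ?case unfolding 0(1)[symmetric] .
next
  case (Suc n)
  define K where "K s = (\<lambda>x. D as (s * x) - s * D as x)" for s
  define X where "X = {s. diff_op n (K s)}"
  have lin_in_X: "lin z q (M + d) c * 1 \<in> X" for c
  proof (rule lin_mult_closed)
    show "0 \<in> X" using D_add[of as 0 0] diff_op_zero by (simp add: X_def K_def)
    show "s + t \<in> X" if "s \<in> X" "t \<in> X" for s t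
    proof -
      have "K (s + t) = (\<lambda>x. K s x + K t x)" by (simp add: K_def D_add algebra_simps)
      then show ?thesis using that diff_op_add by (simp add: X_def)
    qed
    show "r ^ q * s \<in> X" if "s \<in> X" for r s
    proof -
      have "K (r ^ q * s) = (\<lambda>x. r ^ q * K s x)" by (simp add: K_def D_power mult.assoc right_diff_distrib)
      then show ?thesis using that diff_op_mult_left by (simp add: X_def)
    qed
    show "z i * s \<in> X" if i: "i < M + d" and s: "s \<in> X" for i s
    proof -
      define k where "k = M + d - 1 - i"
      define B where "B \<longleftrightarrow> k < d \<and> as ! k > 0"
      have "diff_op n (\<lambda>x. if B then D (lower as k) x else 0)"
      proof (cases B)
        case True
        then have "k < length as" "as ! k > 0" using Suc.prems by (auto simp: B_def)
        then have "sum_list (lower as k) = n"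
          using Suc.hyps(2) by (simp add: lower_def sum_list_update)
        moreover have "set (lower as k) \<subseteq> {..<q}"
        proof -
          have "as ! k < q" using Suc.prems(1) \<open>k < length as\<close> nth_mem by auto
          then show ?thesis unfolding lower_def
            using Suc.prems(1) set_update_subset_insert[of as k "as ! k - 1"] by auto
        qed
        ultimately show ?thesis using Suc.hyps(1)[of "lower as k"] Suc.prems True by (simp add: lower_def)
      qed (simp add: diff_op_zero)
      then have "diff_op n (\<lambda>x. if B then D (lower as k) (s * x) else 0)"
        using diff_op_mult_arg[of n "\<lambda>x. if B then D (lower as k) x else 0" s] by simp
      moreover have "K (z i * s) = (\<lambda>x. z i * K s x + (if B then D (lower as k) (s * x) else 0))"
        by (simp add: K_def mult.assoc D_var[OF Suc.prems i, folded k_def, folded B_def] right_diff_distrib diff_add_eq)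
      ultimately show ?thesis
        using diff_op_add[OF diff_op_mult_left] s by (simp add: X_def)
    qed
    have "K 1 = (\<lambda>x. 0)" by (simp add: K_def)
    then show "1 \<in> X" by (simp add: X_def diff_op_zero)
  qed
  have "diff_op n (K s)" for s
  proof -
    have "K s = K (\<epsilon> * s)"
    proof
      fix x
      have "D as (s * x) = D as (\<epsilon> * s * x)" by (rule D_cong) (simp add: mult.assoc idem_left)
      moreover have "s * D as x = \<epsilon> * s * D as x"
        using D_supported[of as x] by (metis mult.assoc mult.commute)
      ultimately show "K s x = K (\<epsilon> * s) x" by (simp add: K_def)
    qed
    then show ?thesis using lin_in_X[of "coef s"] by (simp add: X_def lin_coef)
  qed
  then show ?case unfolding Suc.hyps(2)[symmetric] by (simp add: additive_map_def D_add K_def)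
qed

text \<open>Below the exponent \<open>a\<close> the binomial coefficient vanishes, and above it a
  positive power of a parameter is left over. Modulo \<open>\<mm>\<close> only the part of exponent
  exactly \<open>as\<close> survives.\<close>

lemma D_leading:
  assumes "length as = k" "k \<le> d" "set as \<subseteq> {..<q}"
  shows "dlin z q as (M + k) c - lin z q M (\<lambda>b. c (as @ b)) \<in> \<mm>"
  using assms
proof (induction as arbitrary: k c)
  case Nil
  then show ?case using is_ideal_zero[OF ideal_m] by simp
next
  case (Cons a as)
  obtain k' where k': "k = Suc k'" using Cons.prems by (cases k) auto
  define F where "F j = dlin z q as (M + k') (\<lambda>bs. c (j # bs))" for j
  have "(\<Sum>j\<in>{..<q} - {a}. of_nat (j choose a) * F j * z (M + k') ^ (j - a)) \<in> \<mm>"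
  proof (intro is_ideal_sum[OF ideal_m])
    fix j assume j: "j \<in> {..<q} - {a}"
    show "of_nat (j choose a) * F j * z (M + k') ^ (j - a) \<in> \<mm>"
    proof (cases "j < a")
      case True
      then show ?thesis by (simp add: binomial_eq_0 is_ideal_zero[OF ideal_m])
    next
      case False
      then have "j - a = Suc (j - Suc a)" using j by auto
      then have "z (M + k') ^ (j - a) = z (M + k') ^ (j - Suc a) * z (M + k')"
        by (simp add: mult.commute)
      also have "\<dots> \<in> \<mm>" using Cons.prems k' by (intro is_ideal_mult_left[OF ideal_m] z_m) simp
      finally show ?thesis by (rule is_ideal_mult_left[OF ideal_m])
    qed
  qed
  moreover have "F a - lin z q M (\<lambda>b. c ((a # as) @ b)) \<in> \<mm>"
    using Cons.IH[of k' "\<lambda>bs. c (a # bs)"] Cons.prems by (simp add: F_def k')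
  ultimately have "(F a - lin z q M (\<lambda>b. c ((a # as) @ b)))
      + (\<Sum>j\<in>{..<q} - {a}. of_nat (j choose a) * F j * z (M + k') ^ (j - a)) \<in> \<mm>"
    by (intro is_ideal_add[OF ideal_m])
  moreover have "dlin z q (a # as) (M + k) c
      = F a + (\<Sum>j\<in>{..<q} - {a}. of_nat (j choose a) * F j * z (M + k') ^ (j - a))"
    using Cons.prems by (simp add: k' F_def sum.remove[of "{..<q}" a])
  ultimately show ?case by (simp only: add_diff_eq diff_add_eq)
qed

text \<open>\<open>F n\<close> stands for \<open>\<mm>\<^sup>n + \<mm>\<^sup>[\<^sup>q\<^sup>]\<close>.\<close>

lemma lin_in_filtration:
  assumes F: "\<And>n. is_ideal (F n)" "F 0 = UNIV" "\<And>n x s. x \<in> \<mm> \<Longrightarrow> s \<in> F n \<Longrightarrow> x * s \<in> F (Suc n)"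
      "\<And>n x. x \<in> \<mm> \<Longrightarrow> x ^ q \<in> F n"
    and "k \<le> d"
    and "\<And>as b. as \<in> idx q k \<Longrightarrow> sum_list as < n \<Longrightarrow> b \<in> idx q M \<Longrightarrow> c (as @ b) \<in> \<mm>"
  shows "lin z q (M + k) c \<in> F n"
  using assms(5,6)
proof (induction k arbitrary: n c)
  case 0
  show ?case
  proof (cases "n = 0")
    case False
    have c: "c b \<in> \<mm>" if "b \<in> idx q M" for b using 0(2)[of "[]" b] that False by simp
    have "(\<forall>b\<in>idx q N. c b \<in> \<mm>) \<Longrightarrow> lin z q N c \<in> F n" for N c
    proof (induction N arbitrary: c)
      case (Suc N)
      have "lin z q N (\<lambda>bs. c (j # bs)) \<in> F n" if "j < q" for j
        using that Suc.prems by (intro Suc.IH) auto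
      then show ?case by (auto intro!: is_ideal_sum[OF F(1)] is_ideal_mult_right[OF F(1)])
    qed (use F(4) in simp)
    then show ?thesis using c by simp
  qed (simp add: F)
next
  case (Suc k)
  \<comment> \<open>The subtraction \<open>n - j\<close> is truncated; for \<open>j\<close> at least
    \<open>n\<close> the premise is vacuous because \<open>F 0\<close> is everything.\<close>
  have power: "z (M + k) ^ j * t \<in> F n" if "t \<in> F (n - j)" for j t n
    using that
  proof (induction j arbitrary: n)
    case (Suc j)
    show ?case
    proof (cases n)
      case (Suc n')
      then have "z (M + k) * (z (M + k) ^ j * t) \<in> F (Suc n')"
        using Suc.prems \<open>Suc k \<le> d\<close> by (intro F(3) z_m Suc.IH) auto
      then show ?thesis by (simp add: Suc mult.assoc)
    qed (simp add: F)
  qed simp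
  have "lin z q (M + k) (\<lambda>bs. c (j # bs)) \<in> F (n - j)" if "j < q" for j
    using Suc.prems that by (intro Suc.IH) (auto simp: less_diff_conv add.commute simp flip: append_Cons)
  then have "lin z q (M + k) (\<lambda>bs. c (j # bs)) * z (M + k) ^ j \<in> F n" if "j < q" for j
    using that power by (metis mult.commute)
  then show ?case by (auto intro!: is_ideal_sum[OF F(1)])
qed

text \<open>If \<open>s\<close> is outside the filtration step, some coefficient of small total
  order is outside \<open>\<mm>\<close>. The operator of that order sees it together with other
  coefficients, multiplied by monomials in \<open>y\<close>; independence of these modulo
  \<open>\<mm>\<close> prevents a cancellation.\<close>

theorem exists_diff_op:
  assumes F: "\<And>n. is_ideal (F n)" "\<And>n. J \<subseteq> F n" "F 0 = UNIV"
      "\<And>n x s. x \<in> \<mm> \<Longrightarrow> s \<in> F n \<Longrightarrow> x * s \<in> F (Suc n)" "\<And>n x. x \<in> \<mm> \<Longrightarrow> x ^ q \<in> F n"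
    and s: "s \<notin> F (Suc n)"
  shows "\<exists>\<delta>. diff_op n \<delta> \<and> (\<forall>r x. \<delta> (r ^ q * x) = r ^ q * \<delta> x) \<and>
    (\<forall>x y. x - y \<in> J \<longrightarrow> \<delta> x = \<delta> y) \<and> \<delta> s \<notin> \<mm>"
proof -
  have "s - \<epsilon> * s \<in> J" by (simp add: mod_iff idem_left)
  then have "s - \<epsilon> * s \<in> F (Suc n)" using F(2) by blast
  then have "lin z q (M + d) (coef s) \<notin> F (Suc n)"
    using s is_ideal_diff_iff[OF F(1)] by (simp add: lin_coef)
  then obtain as b where ab: "as \<in> idx q d" "sum_list as < Suc n" "b \<in> idx q M" "coef s (as @ b) \<notin> \<mm>"
    using lin_in_filtration[of F d "Suc n" "coef s"] F by blast
  then have as: "length as = d" "set as \<subseteq> {..<q}" by (auto simp: idx_def)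
  have "lin z q M (\<lambda>b. coef s (as @ b)) \<notin> \<mm>" using indep_m ab by (auto simp: indep_def)
  then have "D as s \<notin> \<mm>"
    using is_ideal_diff_iff[OF ideal_m D_leading[OF as(1) order_refl as(2), of "coef s"]]
    by (simp add: D_def)
  moreover have "diff_op n (D as)"
    using diff_op_mono[OF diff_op_D[OF as(2,1)]] ab(2) by simp
  ultimately show ?thesis unfolding mod_iff using D_power D_cong by blast
qed

end

section \<open>Rings given as records\<close>

text \<open>Type classes are not available for a ring given as a record. Every commutative ring on a carrier
  in \<open>'t\<close> is however a direct factor of the following type, which is a commutative ring; the additional
  factor \<^typ>\<open>int\<close> makes it nontrivial.\<close>

typedef 't ring_product =
  "{(k :: int, f :: 't ring \<Rightarrow> 't). \<forall>R. if cring R then f R \<in> carrier R else f R = undefined}"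
  by (rule exI[of _ "(0, \<lambda>R. if cring R then \<zero>\<^bsub>R\<^esub> else undefined)"])
    (auto intro: ring.ring_simprules(2) cring.axioms)

definition int_part :: "'t ring_product \<Rightarrow> int" where
  "int_part x = fst (Rep_ring_product x)"

definition proj :: "'t ring \<Rightarrow> 't ring_product \<Rightarrow> 't" where
  "proj R x = snd (Rep_ring_product x) R"

definition tuple :: "int \<Rightarrow> ('t ring \<Rightarrow> 't) \<Rightarrow> 't ring_product" where
  "tuple k f = Abs_ring_product (k, \<lambda>R. if cring R then f R else undefined)"

lemma proj_closed: "cring R \<Longrightarrow> proj R x \<in> carrier R"
  using Rep_ring_product[of x] by (auto simp: proj_def split: if_splits prod.splits)

lemma ring_product_eqI:
  assumes "int_part x = int_part y" "\<And>R. cring R \<Longrightarrow> proj R x = proj R y"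
  shows "x = y"
proof -
  have "snd (Rep_ring_product x) R = snd (Rep_ring_product y) R" for R
    using Rep_ring_product[of x] Rep_ring_product[of y] assms(2)[of R]
    by (cases "cring R") (auto simp: proj_def split: prod.splits)
  then have "Rep_ring_product x = Rep_ring_product y"
    using assms(1) by (auto simp: int_part_def prod_eq_iff)
  then show ?thesis by (simp add: Rep_ring_product_inject)
qed

lemma tuple_parts:
  assumes "\<And>R. cring R \<Longrightarrow> f R \<in> carrier R"
  shows "int_part (tuple k f) = k" "cring R \<Longrightarrow> proj R (tuple k f) = f R"
  using assms by (auto simp: int_part_def proj_def tuple_def Abs_ring_product_inverse)

instantiation ring_product :: (type) comm_ring_1
begin

definition "0 = tuple 0 (\<lambda>R. \<zero>\<^bsub>R\<^esub>)"
definition "1 = tuple 1 (\<lambda>R. \<one>\<^bsub>R\<^esub>)"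
definition "x + y = tuple (int_part x + int_part y) (\<lambda>R. proj R x \<oplus>\<^bsub>R\<^esub> proj R y)"
definition "x * y = tuple (int_part x * int_part y) (\<lambda>R. proj R x \<otimes>\<^bsub>R\<^esub> proj R y)"
definition "- x = tuple (- int_part x) (\<lambda>R. \<ominus>\<^bsub>R\<^esub> proj R x)"
definition "x - y = tuple (int_part x - int_part y) (\<lambda>R. proj R x \<ominus>\<^bsub>R\<^esub> proj R y)"

lemma cring_closed:
  assumes "cring R"
  shows "\<zero>\<^bsub>R\<^esub> \<in> carrier R" "\<one>\<^bsub>R\<^esub> \<in> carrier R"
    "proj R x \<oplus>\<^bsub>R\<^esub> proj R y \<in> carrier R" "proj R x \<otimes>\<^bsub>R\<^esub> proj R y \<in> carrier R"
    "\<ominus>\<^bsub>R\<^esub> proj R x \<in> carrier R" "proj R x \<ominus>\<^bsub>R\<^esub> proj R y \<in> carrier R"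
proof -
  interpret cring R by fact
  note proj_closed[OF assms, simp]
  show "\<zero>\<^bsub>R\<^esub> \<in> carrier R" "\<one>\<^bsub>R\<^esub> \<in> carrier R"
    "proj R x \<oplus>\<^bsub>R\<^esub> proj R y \<in> carrier R" "proj R x \<otimes>\<^bsub>R\<^esub> proj R y \<in> carrier R"
    "\<ominus>\<^bsub>R\<^esub> proj R x \<in> carrier R" "proj R x \<ominus>\<^bsub>R\<^esub> proj R y \<in> carrier R" by simp_all
qed

lemma int_part_simps:
  "int_part 0 = 0" "int_part 1 = 1" "int_part (x + y) = int_part x + int_part y"
  "int_part (x * y) = int_part x * int_part y" "int_part (- x) = - int_part x"
  "int_part (x - y) = int_part x - int_part y"
  by (simp_all add: zero_ring_product_def one_ring_product_def plus_ring_product_def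
      times_ring_product_def uminus_ring_product_def minus_ring_product_def tuple_parts cring_closed)

lemma proj_simps:
  assumes "cring R"
  shows "proj R 0 = \<zero>\<^bsub>R\<^esub>" "proj R 1 = \<one>\<^bsub>R\<^esub>" "proj R (x + y) = proj R x \<oplus>\<^bsub>R\<^esub> proj R y"
    "proj R (x * y) = proj R x \<otimes>\<^bsub>R\<^esub> proj R y" "proj R (- x) = \<ominus>\<^bsub>R\<^esub> proj R x"
    "proj R (x - y) = proj R x \<ominus>\<^bsub>R\<^esub> proj R y"
  using assms
  by (simp_all add: zero_ring_product_def one_ring_product_def plus_ring_product_def
      times_ring_product_def uminus_ring_product_def minus_ring_product_def tuple_parts cring_closed)

instance
proof
  fix a b c :: "'a ring_product"
  have *: "proj R (a * b * c) = proj R (a * (b * c)) \<and> proj R (a * b) = proj R (b * a) \<and>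
    proj R (1 * a) = proj R a \<and> proj R (a + b + c) = proj R (a + (b + c)) \<and> proj R (a + b) = proj R (b + a)
    \<and> proj R (0 + a) = proj R a \<and> proj R (- a + a) = proj R 0 \<and> proj R (a - b) = proj R (a + - b)
    \<and> proj R ((a + b) * c) = proj R (a * c + b * c)" if R: "cring R" for R
  proof -
    interpret cring R by fact
    note proj_closed[OF R, simp]
    show ?thesis by (simp add: proj_simps R m_assoc a_assoc l_distr l_neg minus_eq) (simp add: m_comm a_comm)
  qed
  note parts = int_part_simps algebra_simps
  show "a * b * c = a * (b * c)" by (rule ring_product_eqI, simp add: parts, use * in blast)
  show "a * b = b * a" by (rule ring_product_eqI, simp add: parts, use * in blast)
  show "1 * a = a" by (rule ring_product_eqI, simp add: parts, use * in blast)
  show "a + b + c = a + (b + c)" by (rule ring_product_eqI, simp add: parts, use * in blast)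
  show "a + b = b + a" by (rule ring_product_eqI, simp add: parts, use * in blast)
  show "0 + a = a" by (rule ring_product_eqI, simp add: parts, use * in blast)
  show "- a + a = 0" by (rule ring_product_eqI, simp add: parts, use * in blast)
  show "a - b = a + - b" by (rule ring_product_eqI, simp add: parts, use * in blast)
  show "(a + b) * c = a * c + b * c" by (rule ring_product_eqI, simp add: parts, use * in blast)
  have "int_part (0 :: 'a ring_product) \<noteq> int_part 1" by (simp add: int_part_simps)
  then show "(0 :: 'a ring_product) \<noteq> 1" by metis
qed

end

section \<open>Passing between a ring record and its factor of the product\<close>

definition embed_ring :: "'t ring \<Rightarrow> 't \<Rightarrow> 't ring_product" where
  "embed_ring R r = tuple 0 (\<lambda>R'. if R' = R then r else \<zero>\<^bsub>R'\<^esub>)"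

lemma proj_embed_if:
  assumes "cring R'" "r \<in> carrier R"
  shows "proj R' (embed_ring R r) = (if R' = R then r else \<zero>\<^bsub>R'\<^esub>)"
proof -
  have "\<zero>\<^bsub>Q\<^esub> \<in> carrier Q" if "cring Q" for Q :: "'a ring"
    using cring.axioms(1)[OF that] by (rule ring.ring_simprules(2))
  then show ?thesis using assms unfolding embed_ring_def by (subst tuple_parts(2)) auto
qed

lemma int_part_embed:
  assumes "r \<in> carrier R"
  shows "int_part (embed_ring R r) = 0"
proof -
  have "\<zero>\<^bsub>Q\<^esub> \<in> carrier Q" if "cring Q" for Q :: "'a ring"
    using cring.axioms(1)[OF that] by (rule ring.ring_simprules(2))
  then show ?thesis using assms unfolding embed_ring_def by (subst tuple_parts(1)) auto
qed

context
  fixes R :: "'t ring"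
  assumes R: "cring R"
begin

interpretation cring R by (rule R)

lemma proj_in_carrier [simp]: "proj R x \<in> carrier R"
  by (rule proj_closed[OF R])

lemma proj_embed [simp]: "r \<in> carrier R \<Longrightarrow> proj R (embed_ring R r) = r"
  by (simp add: proj_embed_if R)

lemma proj_power: "proj R (x ^ n) = proj R x [^]\<^bsub>R\<^esub> n"
  by (induction n) (simp_all add: proj_simps R m_comm)

lemma proj_of_nat: "proj R (of_nat n) = add_pow R n \<one>\<^bsub>R\<^esub>"
  by (induction n) (simp_all add: proj_simps R a_comm)

lemma embed_one_mult: "embed_ring R \<one>\<^bsub>R\<^esub> * x = embed_ring R (proj R x)"
proof (rule ring_product_eqI)
  fix Q :: "'t ring" assume Q: "cring Q"
  interpret Q: cring Q by fact
  show "proj Q (embed_ring R \<one>\<^bsub>R\<^esub> * x) = proj Q (embed_ring R (proj R x))"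
    using proj_closed[OF Q] by (simp add: proj_simps Q proj_embed_if)
qed (simp add: int_part_simps int_part_embed)

lemma embed_zero_iff: "embed_ring R (proj R x) = 0 \<longleftrightarrow> proj R x = \<zero>\<^bsub>R\<^esub>"
proof
  assume "embed_ring R (proj R x) = 0"
  then have "proj R (embed_ring R (proj R x)) = proj R 0" by simp
  then show "proj R x = \<zero>\<^bsub>R\<^esub>" by (simp add: proj_simps R)
next
  assume "proj R x = \<zero>\<^bsub>R\<^esub>"
  then show "embed_ring R (proj R x) = 0"
    by (intro ring_product_eqI) (auto simp: int_part_embed int_part_simps proj_embed_if proj_simps R)
qed

definition kern :: "'t ring_product set" where
  "kern = {x. proj R x = \<zero>\<^bsub>R\<^esub>}"

text \<open>The embedded one is the idempotent of the factor \<open>R\<close>, and the kernel of the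
  projection is its annihilator. This is the shape of \<open>J\<close> that
  \<open>factor_basis\<close> expects.\<close>

lemma kern_ann: "kern = {x. embed_ring R \<one>\<^bsub>R\<^esub> * x = 0}"
  by (simp add: kern_def embed_one_mult embed_zero_iff)

lemma embed_idem: "embed_ring R \<one>\<^bsub>R\<^esub> * embed_ring R \<one>\<^bsub>R\<^esub> = embed_ring R \<one>\<^bsub>R\<^esub>"
  by (simp add: embed_one_mult)

lemma is_ideal_vimage:
  assumes "ideal I R"
  shows "is_ideal (proj R -` I)"
proof -
  interpret I: ideal I R by fact
  show ?thesis by (rule is_idealI) (simp_all add: proj_simps R I.I_l_closed)
qed

lemma kern_le_vimage: "ideal I R \<Longrightarrow> kern \<subseteq> proj R -` I"
  by (auto simp: kern_def additive_subgroup.zero_closed ideal.axioms(1))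

lemma ideal_image:
  assumes "is_ideal I"
  shows "ideal (proj R ` I) R"
proof (rule idealI)
  show "ring R" by (rule ring_axioms)
  show "subgroup (proj R ` I) (add_monoid R)"
  proof (unfold_locales)
    show "proj R ` I \<subseteq> carrier (add_monoid R)" by auto
    show "\<one>\<^bsub>add_monoid R\<^esub> \<in> proj R ` I"
      using is_ideal_zero[OF assms] by (auto simp: proj_simps R intro!: image_eqI[of _ _ 0])
  next
    fix x y assume "x \<in> proj R ` I" "y \<in> proj R ` I"
    then show "x \<otimes>\<^bsub>add_monoid R\<^esub> y \<in> proj R ` I"
      using is_ideal_add[OF assms] by (fastforce simp: proj_simps(3)[OF R, symmetric])
  next
    fix x assume "x \<in> proj R ` I"
    then obtain t where t: "t \<in> I" "x = proj R t" by blast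
    then have "inv\<^bsub>add_monoid R\<^esub> x = proj R (- t)" by (simp add: proj_simps R a_inv_def)
    then show "inv\<^bsub>add_monoid R\<^esub> x \<in> proj R ` I" using is_ideal_uminus[OF assms t(1)] by blast
  qed
next
  fix a x assume a: "a \<in> proj R ` I" and x: "x \<in> carrier R"
  then obtain t where t: "t \<in> I" "a = proj R t" by blast
  have "x \<otimes>\<^bsub>R\<^esub> a = proj R (embed_ring R x * t)" using x by (simp add: t proj_simps R)
  with t is_ideal_mult_left[OF assms] show "x \<otimes>\<^bsub>R\<^esub> a \<in> proj R ` I" by blast
  then show "a \<otimes>\<^bsub>R\<^esub> x \<in> proj R ` I" using x t by (simp add: m_comm)
qed

lemma proj_eq_iff: "proj R x = proj R y \<longleftrightarrow> x - y \<in> kern"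
proof -
  have "proj R x \<ominus>\<^bsub>R\<^esub> proj R y = \<zero>\<^bsub>R\<^esub> \<longleftrightarrow> proj R x = proj R y"
    using r_right_minus_eq by simp
  then show ?thesis by (simp add: kern_def proj_simps R)
qed

lemma vimage_image:
  assumes "is_ideal I" "kern \<subseteq> I"
  shows "proj R -` (proj R ` I) = I"
proof
  show "proj R -` (proj R ` I) \<subseteq> I"
  proof
    fix x assume "x \<in> proj R -` (proj R ` I)"
    then obtain y where "y \<in> I" "proj R x = proj R y" by auto
    then have "(x - y) + y \<in> I" using assms by (intro is_ideal_add) (auto simp: proj_eq_iff)
    then show "x \<in> I" by simp
  qed
qed auto

lemma is_prime_vimage:
  assumes "primeideal P R"
  shows "is_prime (proj R -` P)"
proof -
  interpret P: primeideal P R by fact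
  have "\<one>\<^bsub>R\<^esub> \<notin> P" using P.I_notcarr P.one_imp_carrier by blast
  then show ?thesis
    using is_ideal_vimage[OF P.is_ideal] P.I_prime by (auto simp: is_prime_def proj_simps R)
qed

end

section \<open>Noetherian induction and the local case for ring records\<close>

lemma (in noetherian_ring) exists_maximal_member:
  assumes "F \<noteq> {}" "\<And>I. I \<in> F \<Longrightarrow> ideal I R"
  shows "\<exists>M\<in>F. \<forall>I\<in>F. M \<subseteq> I \<longrightarrow> I = M"
proof (rule subset_Zorn_nonempty[OF assms(1)])
  fix C assume C: "C \<noteq> {}" "subset.chain F C"
  then have "subset.chain {I. ideal I R} C" using assms(2) by (auto simp: pred_on.chain_def)
  then have "\<Union>C \<in> C" by (rule ideal_chain_is_trivial[OF C(1)])
  then show "\<Union>C \<in> F" using C(2) unfolding pred_on.chain_def by blast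
qed

lemma noetherian_above_kern:
  assumes R: "cring R" and "noetherian_ring R"
  shows "noetherian_above (kern R)"
proof
  interpret noetherian_ring R by fact
  fix F :: "'a ring_product set set"
  assume F: "F \<noteq> {}" "\<And>I. I \<in> F \<Longrightarrow> is_ideal I \<and> kern R \<subseteq> I"
  have "\<exists>M\<in>(`) (proj R) ` F. \<forall>I\<in>(`) (proj R) ` F. M \<subseteq> I \<longrightarrow> I = M"
    by (rule exists_maximal_member) (use F ideal_image[OF R] in auto)
  then obtain M where M: "M \<in> F" "\<And>I. I \<in> F \<Longrightarrow> proj R ` M \<subseteq> proj R ` I \<Longrightarrow> proj R ` I = proj R ` M"
    by auto
  have "I = M" if "I \<in> F" "M \<subseteq> I" for I
    using M(2)[OF that(1) image_mono[OF that(2)]] vimage_image[OF R] F(2) that(1) M(1) by metis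
  with M(1) show "\<exists>M\<in>F. \<forall>I\<in>F. M \<subseteq> I \<longrightarrow> I = M" by blast
qed

lemma (in noetherian_ring) exists_maximal_ideal:
  assumes "ideal I R" "I \<noteq> carrier R"
  shows "\<exists>M. maximalideal M R \<and> I \<subseteq> M"
proof -
  define F where "F = {K. ideal K R \<and> I \<subseteq> K \<and> K \<noteq> carrier R}"
  have "\<exists>M\<in>F. \<forall>K\<in>F. M \<subseteq> K \<longrightarrow> K = M"
    by (rule exists_maximal_member) (use assms in \<open>auto simp: F_def\<close>)
  then obtain M where M: "M \<in> F" "\<And>K. K \<in> F \<Longrightarrow> M \<subseteq> K \<Longrightarrow> K = M" by blast
  have "maximalideal M R"
  proof (rule maximalidealI)
    show "ideal M R" "carrier R \<noteq> M" using M(1) by (auto simp: F_def)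
    show "K = M \<or> K = carrier R" if "ideal K R" "M \<subseteq> K" "K \<subseteq> carrier R" for K
      using M that by (auto simp: F_def)
  qed
  then show ?thesis using M(1) by (auto simp: F_def)
qed

text \<open>If \<open>d\<close> were missing, all members would be at most \<open>d - 1\<close>.
  This needs \<open>d\<close> positive: the empty set also has supremum 0.\<close>

lemma Sup_enat_attained:
  assumes "Sup A = enat d" "d > 0"
  shows "enat d \<in> A"
proof (rule ccontr)
  assume n: "enat d \<notin> A"
  have "a \<le> enat (d - 1)" if "a \<in> A" for a
  proof -
    have "a \<le> enat d" using Sup_upper[OF that] assms(1) by simp
    then have "a < enat d" using n that by (metis order_le_less)
    then show ?thesis by (cases a) auto
  qed
  then have "Sup A \<le> enat (d - 1)" by (rule Sup_least)
  with assms show False by simp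
qed

lemma prime_chain_of_seq:
  assumes "\<And>i. i \<le> n \<Longrightarrow> is_prime (C i)" "\<And>i. i < n \<Longrightarrow> C i \<subset> C (Suc i)"
  shows "prime_chain n (C 0) (C n)"
  using assms
proof (induction n)
  case (Suc n)
  then show ?case by (intro prime_chain_Suc[of n "C 0" "C n"]) auto
qed (simp add: prime_chain_0)

lemma (in ring) exists_min_num_gens:
  assumes "noetherian_ring R" "ideal I R"
  shows "\<exists>A. A \<subseteq> carrier R \<and> finite A \<and> card A = min_num_gens R I \<and> I = Idl A"
proof -
  obtain A where "A \<subseteq> carrier R" "finite A" "I = Idl A"
    using noetherian_ring.finetely_gen[OF assms] by blast
  then have "\<exists>n. \<exists>A\<subseteq>carrier R. finite A \<and> card A = n \<and> I = Idl A" by blast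
  from LeastI_ex[OF this] show ?thesis unfolding min_num_gens_def by blast
qed

text \<open>Instantiates the preceding theory at the kernel of the projection to \<open>R\<close>.
  The operator acts on the product ring and respects the kernel, so it can be read on
  \<open>R\<close> through \<open>embed_ring R\<close> and \<open>proj R\<close>.\<close>

lemma regular_local_diff_op:
  fixes R :: "'t ring" (structure) and G m :: "'t set" and F :: "nat \<Rightarrow> 't set" and p e n :: nat
  assumes reg: "regular_local_ring R" and m: "{M. maximalideal M R} = {m}"
    and p: "Factorial_Ring.prime p" "add_pow R p \<one>\<^bsub>R\<^esub> = \<zero>\<^bsub>R\<^esub>"
    and G: "finite G" "G \<subseteq> carrier R"
    and gen: "\<And>X. \<lbrakk>X \<subseteq> carrier R; \<zero>\<^bsub>R\<^esub> \<in> X; \<And>x y. x \<in> X \<Longrightarrow> y \<in> X \<Longrightarrow> x \<oplus>\<^bsub>R\<^esub> y \<in> X;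
        \<And>r g. r \<in> carrier R \<Longrightarrow> g \<in> G \<Longrightarrow> r [^]\<^bsub>R\<^esub> p \<otimes>\<^bsub>R\<^esub> g \<in> X\<rbrakk> \<Longrightarrow> X = carrier R"
    and F: "\<And>n. ideal (F n) R" "F 0 = carrier R"
      "\<And>n x s. x \<in> m \<Longrightarrow> s \<in> F n \<Longrightarrow> x \<otimes>\<^bsub>R\<^esub> s \<in> F (Suc n)"
      "\<And>n x. x \<in> m \<Longrightarrow> x [^]\<^bsub>R\<^esub> (p ^ e) \<in> F n"
    and s: "s \<in> carrier R" "s \<notin> F (Suc n)"
  shows "\<exists>\<delta>. diff_op n \<delta> \<and> (\<forall>r x. \<delta> (r ^ (p ^ e) * x) = r ^ (p ^ e) * \<delta> x) \<and>
    (\<forall>x y. proj R x = proj R y \<longrightarrow> \<delta> x = \<delta> y) \<and> proj R (\<delta> (embed_ring R s)) \<notin> m"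
proof -
  have R: "cring R" and noeth: "noetherian_ring R" using reg by (auto simp: regular_local_ring_def)
  interpret cring R by (rule R)
  interpret N: noetherian_ring R by (rule noeth)
  note [simp] = proj_in_carrier[OF R] proj_embed[OF R]
  have max_m: "maximalideal m R" using m by blast
  have prime_mR: "primeideal m R" by (rule maximalideal_prime[OF max_m])
  have ideal_mR: "ideal m R" using prime_mR by (rule primeideal.axioms)
  have dim: "enat (min_num_gens R m) = krull_dim R"
    using reg m unfolding regular_local_ring_def by auto
  define J where "J = kern R"
  define mm where "mm = proj R -` m"
  have ideal_J: "is_ideal J"
    using is_ideal_vimage[OF R zeroideal] by (simp add: J_def kern_def[OF R] vimage_def)
  have prime_mm: "is_prime mm" unfolding mm_def by (rule is_prime_vimage[OF R prime_mR])
  have J_mm: "J \<subseteq> mm" unfolding mm_def J_def by (rule kern_le_vimage[OF R ideal_mR])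
  interpret noetherian_above J unfolding J_def by (rule noetherian_above_kern[OF R noeth])
  have inv: "\<exists>v. u * v - 1 \<in> J" if "u \<notin> mm" for u
  proof -
    have "PIdl (proj R u) = carrier R"
    proof (rule ccontr)
      assume "PIdl (proj R u) \<noteq> carrier R"
      from N.exists_maximal_ideal[OF cgenideal_ideal this] obtain M
        where "maximalideal M R" "PIdl (proj R u) \<subseteq> M" by auto
      then have "proj R u \<in> m" using m cgenideal_self[of "proj R u"] by auto
      with that show False by (simp add: mm_def)
    qed
    then have "\<one> \<in> PIdl (proj R u)" by simp
    then obtain v where v: "v \<in> carrier R" "\<one> = v \<otimes> proj R u" by (auto simp: cgenideal_def)
    then have "proj R (u * embed_ring R v) = proj R 1" by (simp add: proj_simps R m_comm)
    then show ?thesis unfolding J_def proj_eq_iff[OF R] by blast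
  qed
  interpret local_above J mm
    by unfold_locales (use ideal_J prime_mm J_mm inv in auto)
  have "proj R (of_nat p) = \<zero>" using p by (simp add: proj_of_nat[OF R])
  then interpret char_p_above J mm p
    by unfold_locales (use p in \<open>auto simp: J_def kern_def[OF R]\<close>)
  have generation: "X = UNIV"
    if X: "J \<subseteq> X" "\<And>x y. x \<in> X \<Longrightarrow> y \<in> X \<Longrightarrow> x + y \<in> X" "\<And>r g. g \<in> embed_ring R ` G \<Longrightarrow> r ^ p * g \<in> X" for X
  proof -
    have "proj R ` X = carrier R"
    proof (rule gen)
      show "\<zero> \<in> proj R ` X"
        using X(1) is_ideal_zero[OF ideal_J] by (auto simp: proj_simps R intro!: image_eqI[of _ _ 0])
      show "x \<oplus> y \<in> proj R ` X" if "x \<in> proj R ` X" "y \<in> proj R ` X" for x y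
        using that X(2) by (auto simp: proj_simps(3)[OF R, symmetric])
      show "r [^] p \<otimes> g \<in> proj R ` X" if "r \<in> carrier R" "g \<in> G" for r g
        using X(3)[of "embed_ring R g" "embed_ring R r"] that G(2)
        by (intro image_eqI[of _ _ "embed_ring R r ^ p * embed_ring R g"]) (auto simp: proj_simps R proj_power)
    qed auto
    have "t \<in> X" for t
    proof -
      have "proj R t \<in> proj R ` X" using \<open>proj R ` X = carrier R\<close> by simp
      then obtain x where x: "x \<in> X" "proj R t = proj R x" by auto
      then have "t - x \<in> X" using X(1) by (auto simp: proj_eq_iff[OF R] J_def)
      from X(2)[OF x(1) this] show ?thesis by simp
    qed
    then show ?thesis by blast
  qed
  define d where "d = min_num_gens R m"
  obtain A where A: "A \<subseteq> carrier R" "finite A" "card A = d" "m = Idl A"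
    using exists_min_num_gens[OF noeth ideal_mR] by (auto simp: d_def)
  obtain h where h: "bij_betw h {0..<d} A" using ex_bij_betw_nat_finite[OF A(2)] A(3) by blast
  define x where "x i = embed_ring R (h i)" for i
  define I where "I k = ideal_gen (J \<union> x ` {k..<d})" for k
  have hA: "h i \<in> A" if "i < d" for i using h that by (auto simp: bij_betw_def)
  have sub_I: "J \<subseteq> I k" "i \<in> {k..<d} \<Longrightarrow> x i \<in> I k" for i k
    using subset_ideal_gen[of "J \<union> x ` {k..<d}"] by (auto simp: I_def)
  have II: "is_ideal (I k)" for k by (simp add: I_def is_ideal_gen)
  have I_0: "I 0 = mm"
  proof
    show "I 0 \<subseteq> mm"
      unfolding I_def
    proof (rule ideal_gen_least[OF ideal_m])
      have "x i \<in> mm" if "i < d" for i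
        using hA[OF that] A subsetD[OF A(1) hA[OF that]] genideal_self[OF A(1)] by (auto simp: x_def mm_def)
      then show "J \<union> x ` {0..<d} \<subseteq> mm" using J_mm by auto
    qed
    have "A \<subseteq> proj R ` I 0"
    proof
      fix a assume "a \<in> A"
      then obtain i where i: "i < d" "a = h i" using h by (auto simp: bij_betw_def)
      with A(1) \<open>a \<in> A\<close> show "a \<in> proj R ` I 0"
        using sub_I(2)[of i 0] by (intro image_eqI[of _ _ "x i"]) (auto simp: x_def)
    qed
    then have "m \<subseteq> proj R ` I 0" unfolding A(4) by (intro genideal_minimal ideal_image[OF R II])
    then have "mm \<subseteq> proj R -` (proj R ` I 0)" by (auto simp: mm_def)
    then show "mm \<subseteq> I 0" using vimage_image[OF R II] sub_I(1) J_def by blast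
  qed
  have I_d: "I d = J"
    using ideal_gen_least[OF ideal_J order_refl] sub_I(1)[of d] by (auto simp: I_def)
  have I_step: "I k = adjoin (I (Suc k)) (x k)" if "k < d" for k
  proof
    show "adjoin (I (Suc k)) (x k) \<subseteq> I k"
    proof (rule adjoin_least[OF II])
      show "I (Suc k) \<subseteq> I k" unfolding I_def[of "Suc k"]
        by (rule ideal_gen_least[OF II]) (use sub_I in auto)
    qed (use sub_I that in auto)
    show "I k \<subseteq> adjoin (I (Suc k)) (x k)"
      unfolding I_def[of k]
    proof (rule ideal_gen_least[OF is_ideal_adjoin[OF II]])
      have "{k..<d} = insert k {Suc k..<d}" using that by auto
      then show "J \<union> x ` {k..<d} \<subseteq> adjoin (I (Suc k)) (x k)"
        using subset_adjoin[of "I (Suc k)" "x k"] mem_adjoin[OF II, of "x k" "Suc k"]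
          sub_I(1)[of "Suc k"] sub_I(2)[of _ "Suc k"] by auto
    qed
  qed
  have prime_le: "P \<subseteq> m" if "primeideal P R" for P
  proof -
    have "ideal P R" "P \<noteq> carrier R" using that primeideal.axioms(1) primeideal.I_notcarr by blast+
    from N.exists_maximal_ideal[OF this] show ?thesis using m by blast
  qed
  \<comment> \<open>The Krull dimension supplies a chain of \<open>d\<close> steps, but its top need
    not be given as the maximal ideal. The top member is therefore replaced by \<open>mm\<close>,
    which contains it; for \<open>d = 0\<close> the chain is \<open>mm\<close> alone.\<close>
  have "\<exists>A0. prime_chain d A0 mm \<and> J \<subseteq> A0"
  proof (cases d)
    case 0
    then show ?thesis using prime_chain_0[OF prime_mm] J_mm by blast
  next
    case (Suc d')
    have "Sup {enat n | n. \<exists>C :: nat \<Rightarrow> 't set. (\<forall>i\<le>n. primeideal (C i) R) \<and> (\<forall>i<n. C i \<subset> C (Suc i))} = enat d"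
      using dim by (simp add: krull_dim_def d_def)
    from Sup_enat_attained[OF this] Suc obtain C :: "nat \<Rightarrow> 't set"
      where C: "\<And>i. i \<le> d \<Longrightarrow> primeideal (C i) R" "\<And>i. i < d \<Longrightarrow> C i \<subset> C (Suc i)" by auto
    define C' where "C' i = proj R -` (C i)" for i
    have strict: "proj R -` U \<subset> proj R -` V" if "U \<subset> V" "V \<subseteq> carrier R" for U V
    proof -
      obtain v where v: "v \<in> V" "v \<notin> U" using \<open>U \<subset> V\<close> by blast
      then have "proj R (embed_ring R v) = v" using \<open>V \<subseteq> carrier R\<close> by auto
      with v show ?thesis using \<open>U \<subset> V\<close> by (metis psubsetI psubset_imp_subset vimageI2 vimage_eq vimage_mono)
    qed
    have carr: "C i \<subseteq> carrier R" if "i \<le> d" for i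
      using prime_le[OF C(1)[OF that]] ideal.Icarr[OF ideal_mR] by blast
    have "prime_chain d' (C' 0) (C' d')"
      by (rule prime_chain_of_seq) (use C strict carr Suc in \<open>auto simp: C'_def intro!: is_prime_vimage[OF R]\<close>)
    moreover have "C d' \<subset> m" using C(2)[of d'] prime_le[OF C(1)[of d]] Suc by auto
    then have "C' d' \<subset> mm" unfolding C'_def mm_def
      using ideal.Icarr[OF ideal_mR] by (intro strict) auto
    ultimately have "prime_chain d (C' 0) mm" unfolding Suc by (rule prime_chain_Suc[OF _ prime_mm])
    moreover have "J \<subseteq> C' 0"
      unfolding C'_def J_def using C(1)[of 0] by (intro kern_le_vimage[OF R]) (auto intro: primeideal.axioms)
    ultimately show ?thesis by blast
  qed
  then obtain A0 where A0: "prime_chain d A0 mm" "J \<subseteq> A0" by blast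
  interpret regular_f_finite J mm d x I A0 p "embed_ring R ` G"
    by unfold_locales (use II I_0 I_d I_step A0 G generation in auto)
  obtain z M where z: "\<forall>i<d. z (M + i) \<in> mm" "indep z (p ^ e) M mm" "indep z (p ^ e) (M + d) J"
    "lin_span z (p ^ e) (M + d) J = UNIV"
    using exists_frobenius_basis[of e] by blast
  interpret B: factor_basis J mm p "embed_ring R \<one>" z M d e "p ^ e"
    by unfold_locales (use z embed_idem[OF R] kern_ann[OF R] in \<open>auto simp: J_def\<close>)
  have "\<exists>\<delta>. diff_op n \<delta> \<and> (\<forall>r x. \<delta> (r ^ (p ^ e) * x) = r ^ (p ^ e) * \<delta> x) \<and>
    (\<forall>x y. x - y \<in> J \<longrightarrow> \<delta> x = \<delta> y) \<and> \<delta> (embed_ring R s) \<notin> mm"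
  proof (rule B.exists_diff_op[of "\<lambda>n. proj R -` F n"])
    show "is_ideal (proj R -` F n)" "J \<subseteq> proj R -` F n" for n
      using F(1) is_ideal_vimage[OF R] kern_le_vimage[OF R] by (auto simp: J_def)
    show "embed_ring R s \<notin> proj R -` F (Suc n)" using s by simp
  qed (use F in \<open>auto simp: mm_def proj_simps R proj_power\<close>)
  then show ?thesis unfolding J_def proj_eq_iff[OF R, symmetric] by (simp add: mm_def)
qed

section \<open>Localization at a prime ideal\<close>

locale prime_localization = cring S + primeideal P S for S :: "('a, 'b) ring_scheme" (structure) and P
begin

abbreviation "U \<equiv> carrier S - P"
abbreviation "L \<equiv> localization S P"
abbreviation "\<phi> \<equiv> loc_map S P"
abbreviation "quot \<equiv> loc_frac S P"

lemma U_one: "\<one> \<in> U"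
  using I_notcarr one_imp_carrier by blast

lemma U_mult: "u \<in> U \<Longrightarrow> v \<in> U \<Longrightarrow> u \<otimes> v \<in> U"
  using I_prime by auto

lemma U_power: "u \<in> U \<Longrightarrow> u [^] (n::nat) \<in> U"
  by (induction n) (use U_one U_mult in auto)

lemma loc_rel_iff:
  assumes "a \<in> carrier S" "s \<in> U" "b \<in> carrier S" "t \<in> U"
  shows "((a, s), (b, t)) \<in> loc_rel S P \<longleftrightarrow> (\<exists>u\<in>U. u \<otimes> (t \<otimes> a) = u \<otimes> (s \<otimes> b))"
proof -
  have "u \<otimes> (t \<otimes> a \<ominus> s \<otimes> b) = \<zero> \<longleftrightarrow> u \<otimes> (t \<otimes> a) = u \<otimes> (s \<otimes> b)" if "u \<in> U" for u
  proof -
    have c: "u \<in> carrier S" "t \<otimes> a \<in> carrier S" "s \<otimes> b \<in> carrier S" using that assms by auto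
    then have "u \<otimes> (t \<otimes> a \<ominus> s \<otimes> b) = u \<otimes> (t \<otimes> a) \<ominus> u \<otimes> (s \<otimes> b)"
      by (simp add: minus_eq r_distr r_minus)
    then show ?thesis using c r_right_minus_eq[of "u \<otimes> (t \<otimes> a)" "u \<otimes> (s \<otimes> b)"] by simp
  qed
  then show ?thesis using assms unfolding loc_rel_def by auto
qed

lemma equiv_loc_rel: "equiv (carrier S \<times> U) (loc_rel S P)"
proof (rule equivI)
  show "loc_rel S P \<subseteq> (carrier S \<times> U) \<times> (carrier S \<times> U)" by (auto simp: loc_rel_def)
  show "refl_on (carrier S \<times> U) (loc_rel S P)"
    by (rule refl_onI) (use U_one in \<open>auto simp: loc_rel_iff intro!: bexI[of _ \<one>]\<close>)
  show "sym (loc_rel S P)"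
  proof (rule symI)
    fix x y assume xy: "(x, y) \<in> loc_rel S P"
    then obtain a s b t where e: "x = (a, s)" "y = (b, t)" "a \<in> carrier S" "s \<in> U" "b \<in> carrier S" "t \<in> U"
      by (auto simp: loc_rel_def)
    from xy show "(y, x) \<in> loc_rel S P" unfolding e(1,2) using e(3-) by (auto simp: loc_rel_iff intro: sym)
  qed
  show "trans (loc_rel S P)"
  proof (rule transI)
    fix x y z assume xy: "(x, y) \<in> loc_rel S P" and yz: "(y, z) \<in> loc_rel S P"
    then obtain a s b t c w where e: "x = (a, s)" "y = (b, t)" "z = (c, w)" "a \<in> carrier S" "s \<in> U"
      "b \<in> carrier S" "t \<in> U" "c \<in> carrier S" "w \<in> U"
      by (auto simp: loc_rel_def)
    obtain u where u: "u \<in> U" "u \<otimes> (t \<otimes> a) = u \<otimes> (s \<otimes> b)" using xy e by (auto simp: loc_rel_iff)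
    obtain v where v: "v \<in> U" "v \<otimes> (w \<otimes> b) = v \<otimes> (t \<otimes> c)" using yz e by (auto simp: loc_rel_iff)
    have car: "u \<in> carrier S" "v \<in> carrier S" "s \<in> carrier S" "t \<in> carrier S" "w \<in> carrier S"
      using u v e by auto
    have "(u \<otimes> v \<otimes> t) \<otimes> (w \<otimes> a) = (v \<otimes> w) \<otimes> (u \<otimes> (t \<otimes> a))" using car e by (simp add: m_ac)
    also have "\<dots> = (u \<otimes> s) \<otimes> (v \<otimes> (w \<otimes> b))" unfolding u using car e by (simp add: m_ac)
    also have "\<dots> = (u \<otimes> v \<otimes> t) \<otimes> (s \<otimes> c)" unfolding v using car e by (simp add: m_ac)
    finally show "(x, z) \<in> loc_rel S P"
      unfolding e using e u v U_mult by (subst loc_rel_iff) (auto intro!: bexI[of _ "u \<otimes> v \<otimes> t"])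
  qed
qed

lemma quot_eq_iff:
  assumes "a \<in> carrier S" "s \<in> U" "b \<in> carrier S" "t \<in> U"
  shows "quot a s = quot b t \<longleftrightarrow> (\<exists>u\<in>U. u \<otimes> (t \<otimes> a) = u \<otimes> (s \<otimes> b))"
  unfolding loc_frac_def using assms eq_equiv_class_iff[OF equiv_loc_rel, of "(a, s)" "(b, t)"]
  by (simp add: loc_rel_iff)

lemma mem_quot:
  assumes "a \<in> carrier S" "s \<in> U" "x \<in> quot a s"
  obtains b t where "x = (b, t)" "b \<in> carrier S" "t \<in> U" "quot a s = quot b t"
proof -
  have r: "((a, s), x) \<in> loc_rel S P" using assms by (simp add: loc_frac_def)
  then obtain b t where "x = (b, t)" "b \<in> carrier S" "t \<in> U" by (auto simp: loc_rel_def)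
  with r assms that show ?thesis by (auto simp: loc_rel_iff quot_eq_iff)
qed

lemma self_in_quot: "a \<in> carrier S \<Longrightarrow> s \<in> U \<Longrightarrow> (a, s) \<in> quot a s"
  unfolding loc_frac_def using equiv_class_self[OF equiv_loc_rel, of "(a, s)"] by simp

lemma carrier_L: "carrier L = {quot a s | a s. a \<in> carrier S \<and> s \<in> U}"
  by (auto simp: localization_def loc_frac_def quotient_def)

lemma quot_closed [simp]: "a \<in> carrier S \<Longrightarrow> s \<in> U \<Longrightarrow> quot a s \<in> carrier L"
  by (auto simp: carrier_L)

lemma L_cases:
  assumes "x \<in> carrier L"
  obtains a s where "a \<in> carrier S" "s \<in> U" "x = quot a s"
  using assms by (auto simp: carrier_L)

text \<open>Operations on fractions are unions over all representatives; such a union collapses to a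
  single class once the result is known to be independent of them.\<close>

lemma Union_quot:
  assumes "a \<in> carrier S" "s \<in> U" "b \<in> carrier S" "t \<in> U"
    and f: "\<And>a' s' b' t'. \<lbrakk>a' \<in> carrier S; s' \<in> U; b' \<in> carrier S; t' \<in> U; quot a s = quot a' s';
      quot b t = quot b' t'\<rbrakk> \<Longrightarrow> f a' s' b' t' = c"
  shows "(\<Union>(a, s)\<in>quot a s. \<Union>(b, t)\<in>quot b t. f a s b t) = c"
proof -
  have inner: "(\<Union>(b', t')\<in>quot b t. f a' s' b' t') = c"
    if "a' \<in> carrier S" "s' \<in> U" "quot a s = quot a' s'" for a' s'
  proof (rule UN_constant_eq[OF self_in_quot[OF assms(3,4)]], rule ballI)
    fix y assume "y \<in> quot b t"
    with assms(3,4) obtain b' t' where "y = (b', t')" "b' \<in> carrier S" "t' \<in> U" "quot b t = quot b' t'"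
      by (rule mem_quot)
    with that f show "(case y of (b', t') \<Rightarrow> f a' s' b' t') = c" by simp
  qed
  show ?thesis
  proof (rule UN_constant_eq[OF self_in_quot[OF assms(1,2)]], rule ballI)
    fix y assume "y \<in> quot a s"
    with assms(1,2) obtain a' s' where "y = (a', s')" "a' \<in> carrier S" "s' \<in> U" "quot a s = quot a' s'"
      by (rule mem_quot)
    with inner show "(case y of (a', s') \<Rightarrow> \<Union>(b', t')\<in>quot b t. f a' s' b' t') = c" by simp
  qed
qed

lemma quot_mult:
  assumes "a \<in> carrier S" "s \<in> U" "b \<in> carrier S" "t \<in> U"
  shows "quot a s \<otimes>\<^bsub>L\<^esub> quot b t = quot (a \<otimes> b) (s \<otimes> t)"
proof -
  have "(\<Union>(a, s)\<in>quot a s. \<Union>(b, t)\<in>quot b t. quot (a \<otimes> b) (s \<otimes> t)) = quot (a \<otimes> b) (s \<otimes> t)"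
  proof (rule Union_quot[OF assms])
    fix a' s' b' t'
    assume c: "a' \<in> carrier S" "s' \<in> U" "b' \<in> carrier S" "t' \<in> U" and "quot a s = quot a' s'" "quot b t = quot b' t'"
    then obtain u v where uv: "u \<in> U" "u \<otimes> (s' \<otimes> a) = u \<otimes> (s \<otimes> a')" "v \<in> U" "v \<otimes> (t' \<otimes> b) = v \<otimes> (t \<otimes> b')"
      using assms by (auto simp: quot_eq_iff)
    have car: "u \<in> carrier S" "v \<in> carrier S" "s \<in> carrier S" "t \<in> carrier S" "s' \<in> carrier S" "t' \<in> carrier S"
      using uv assms c by auto
    have "(u \<otimes> v) \<otimes> ((s' \<otimes> t') \<otimes> (a \<otimes> b)) = (u \<otimes> (s' \<otimes> a)) \<otimes> (v \<otimes> (t' \<otimes> b))"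
      using car assms by (simp add: m_ac)
    also have "\<dots> = (u \<otimes> v) \<otimes> ((s \<otimes> t) \<otimes> (a' \<otimes> b'))" unfolding uv using car c by (simp add: m_ac)
    finally show "quot (a' \<otimes> b') (s' \<otimes> t') = quot (a \<otimes> b) (s \<otimes> t)"
      using c assms uv U_mult by (subst eq_commute, subst quot_eq_iff) (auto intro!: bexI[of _ "u \<otimes> v"])
  qed
  then show ?thesis by (simp add: localization_def)
qed

lemma quot_add:
  assumes "a \<in> carrier S" "s \<in> U" "b \<in> carrier S" "t \<in> U"
  shows "quot a s \<oplus>\<^bsub>L\<^esub> quot b t = quot (t \<otimes> a \<oplus> s \<otimes> b) (s \<otimes> t)"
proof -
  have "(\<Union>(a, s)\<in>quot a s. \<Union>(b, t)\<in>quot b t. quot (t \<otimes> a \<oplus> s \<otimes> b) (s \<otimes> t)) = quot (t \<otimes> a \<oplus> s \<otimes> b) (s \<otimes> t)"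
  proof (rule Union_quot[OF assms])
    fix a' s' b' t'
    assume c: "a' \<in> carrier S" "s' \<in> U" "b' \<in> carrier S" "t' \<in> U" and "quot a s = quot a' s'" "quot b t = quot b' t'"
    then obtain u v where uv: "u \<in> U" "u \<otimes> (s' \<otimes> a) = u \<otimes> (s \<otimes> a')" "v \<in> U" "v \<otimes> (t' \<otimes> b) = v \<otimes> (t \<otimes> b')"
      using assms by (auto simp: quot_eq_iff)
    have car: "u \<in> carrier S" "v \<in> carrier S" "s \<in> carrier S" "t \<in> carrier S" "s' \<in> carrier S" "t' \<in> carrier S"
      using uv assms c by auto
    have "(u \<otimes> v) \<otimes> ((s' \<otimes> t') \<otimes> (t \<otimes> a \<oplus> s \<otimes> b))
        = (v \<otimes> t' \<otimes> t) \<otimes> (u \<otimes> (s' \<otimes> a)) \<oplus> (u \<otimes> s' \<otimes> s) \<otimes> (v \<otimes> (t' \<otimes> b))"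
      using car assms by (simp add: r_distr m_ac)
    also have "\<dots> = (u \<otimes> v) \<otimes> ((s \<otimes> t) \<otimes> (t' \<otimes> a' \<oplus> s' \<otimes> b'))"
      unfolding uv using car c by (simp add: r_distr m_ac)
    finally show "quot (t' \<otimes> a' \<oplus> s' \<otimes> b') (s' \<otimes> t') = quot (t \<otimes> a \<oplus> s \<otimes> b) (s \<otimes> t)"
      using c assms uv U_mult by (subst eq_commute, subst quot_eq_iff) (auto intro!: bexI[of _ "u \<otimes> v"])
  qed
  then show ?thesis by (simp add: localization_def)
qed

lemma map_closed [simp]: "a \<in> carrier S \<Longrightarrow> \<phi> a \<in> carrier L"
  unfolding loc_map_def by (rule quot_closed[OF _ U_one])

lemma map_one [simp]: "\<phi> \<one> = \<one>\<^bsub>L\<^esub>" and map_zero [simp]: "\<phi> \<zero> = \<zero>\<^bsub>L\<^esub>"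
  by (simp_all add: loc_map_def localization_def)

lemma map_mult: "a \<in> carrier S \<Longrightarrow> b \<in> carrier S \<Longrightarrow> \<phi> (a \<otimes> b) = \<phi> a \<otimes>\<^bsub>L\<^esub> \<phi> b"
  using U_one by (simp add: loc_map_def quot_mult)

lemma map_add: "a \<in> carrier S \<Longrightarrow> b \<in> carrier S \<Longrightarrow> \<phi> (a \<oplus> b) = \<phi> a \<oplus>\<^bsub>L\<^esub> \<phi> b"
  using U_one by (simp add: loc_map_def quot_add)

lemma map_eq_iff: "a \<in> carrier S \<Longrightarrow> b \<in> carrier S \<Longrightarrow> \<phi> a = \<phi> b \<longleftrightarrow> (\<exists>u\<in>U. u \<otimes> a = u \<otimes> b)"
  using U_one by (simp add: loc_map_def quot_eq_iff)

lemma map_denominator: "a \<in> carrier S \<Longrightarrow> s \<in> U \<Longrightarrow> \<phi> s \<otimes>\<^bsub>L\<^esub> quot a s = \<phi> a"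
  using U_one by (auto simp: loc_map_def quot_mult quot_eq_iff U_mult intro!: bexI[of _ \<one>])

lemma map_unit: "s \<in> U \<Longrightarrow> \<phi> s \<otimes>\<^bsub>L\<^esub> quot \<one> s = \<one>\<^bsub>L\<^esub>"
  using map_denominator[of \<one> s] by simp

text \<open>The extended ideal described by clearing denominators, which is convenient for
  computation; \<open>Idl_map_image\<close> identifies it with the generated ideal.\<close>

definition extension :: "'a set \<Rightarrow> ('a \<times> 'a) set set" where
  "extension I = {r \<in> carrier L. \<exists>u\<in>U. \<exists>i\<in>I. \<phi> u \<otimes>\<^bsub>L\<^esub> r = \<phi> i}"

end

text \<open>The ring axioms of the localization are part of its being a regular local ring, which
  supplies the assumption.\<close>

locale prime_localization_ring = prime_localization +
  assumes cring_L: "cring (localization S P)"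
begin

sublocale L: cring "localization S P"
  by (rule cring_L)

lemma map_minus:
  assumes "a \<in> carrier S" "b \<in> carrier S"
  shows "\<phi> (a \<ominus> b) = \<phi> a \<ominus>\<^bsub>L\<^esub> \<phi> b"
proof -
  have "\<phi> (\<ominus> b) \<oplus>\<^bsub>L\<^esub> \<phi> b = \<zero>\<^bsub>L\<^esub>" using assms by (simp add: map_add[symmetric] l_neg)
  then have "\<phi> (\<ominus> b) = \<ominus>\<^bsub>L\<^esub> \<phi> b" using assms by (intro L.minus_equality[symmetric]) simp_all
  then show ?thesis using assms by (simp add: minus_eq L.minus_eq map_add)
qed

lemma malin_span_closed: "a \<in> carrier S \<Longrightarrow> \<phi> (a [^] (n::nat)) = \<phi> a [^]\<^bsub>L\<^esub> n"
  by (induction n) (simp_all add: map_mult)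

lemma map_add_pow: "a \<in> carrier S \<Longrightarrow> \<phi> (add_pow S (n::nat) a) = add_pow L n (\<phi> a)"
  by (induction n) (simp_all add: map_add)

lemma ideal_extension:
  assumes "ideal I S"
  shows "ideal (extension I) L"
proof -
  interpret I: ideal I S by fact
  have car: "u \<in> U \<Longrightarrow> u \<in> carrier S" for u by auto
  have add: "r \<oplus>\<^bsub>L\<^esub> r' \<in> extension I" if r: "r \<in> extension I" "r' \<in> extension I" for r r'
  proof -
    obtain u i v j where e: "r \<in> carrier L" "u \<in> U" "i \<in> I" "\<phi> u \<otimes>\<^bsub>L\<^esub> r = \<phi> i"
      "r' \<in> carrier L" "v \<in> U" "j \<in> I" "\<phi> v \<otimes>\<^bsub>L\<^esub> r' = \<phi> j"
      using r by (auto simp: extension_def)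
    then have c: "u \<in> carrier S" "v \<in> carrier S" "i \<in> carrier S" "j \<in> carrier S" using I.Icarr by auto
    have "\<phi> (u \<otimes> v) \<otimes>\<^bsub>L\<^esub> (r \<oplus>\<^bsub>L\<^esub> r') = \<phi> v \<otimes>\<^bsub>L\<^esub> (\<phi> u \<otimes>\<^bsub>L\<^esub> r) \<oplus>\<^bsub>L\<^esub> \<phi> u \<otimes>\<^bsub>L\<^esub> (\<phi> v \<otimes>\<^bsub>L\<^esub> r')"
      using c e(1,5) by (simp add: map_mult L.r_distr L.m_ac)
    also have "\<dots> = \<phi> (v \<otimes> i \<oplus> u \<otimes> j)" unfolding e using c by (simp add: map_mult map_add)
    finally have "\<phi> (u \<otimes> v) \<otimes>\<^bsub>L\<^esub> (r \<oplus>\<^bsub>L\<^esub> r') = \<phi> (v \<otimes> i \<oplus> u \<otimes> j)" .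
    moreover have "v \<otimes> i \<oplus> u \<otimes> j \<in> I" using c e by (simp add: I.I_l_closed)
    ultimately show ?thesis
      unfolding extension_def using U_mult[OF e(2,6)] e(1,5) by blast
  qed
  have mult: "x \<otimes>\<^bsub>L\<^esub> r \<in> extension I" if r: "r \<in> extension I" and x: "x \<in> carrier L" for r x
  proof -
    obtain u i where e: "r \<in> carrier L" "u \<in> U" "i \<in> I" "\<phi> u \<otimes>\<^bsub>L\<^esub> r = \<phi> i"
      using r by (auto simp: extension_def)
    obtain a s where a: "a \<in> carrier S" "s \<in> U" "x = quot a s" using L_cases[OF x] .
    have c: "u \<in> carrier S" "s \<in> carrier S" "i \<in> carrier S" using e a I.Icarr by auto
    have "\<phi> (s \<otimes> u) \<otimes>\<^bsub>L\<^esub> (x \<otimes>\<^bsub>L\<^esub> r) = (\<phi> s \<otimes>\<^bsub>L\<^esub> x) \<otimes>\<^bsub>L\<^esub> (\<phi> u \<otimes>\<^bsub>L\<^esub> r)"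
      using c e(1) x by (simp add: map_mult L.m_ac)
    also have "\<dots> = \<phi> (a \<otimes> i)" unfolding e a(3) map_denominator[OF a(1,2)] using a c by (simp add: map_mult)
    finally show ?thesis
      unfolding extension_def using U_mult[OF a(2) e(2)] e(1) x I.I_l_closed[OF e(3) a(1)] by blast
  qed
  have zero: "\<zero>\<^bsub>L\<^esub> \<in> extension I"
    unfolding extension_def using U_one I.zero_closed by (auto intro!: bexI[of _ \<one>] bexI[of _ \<zero>])
  show ?thesis
  proof (rule idealI[OF L.ring_axioms])
    show "subgroup (extension I) (add_monoid L)"
    proof
      fix r assume r: "r \<in> extension I"
      then have rc: "r \<in> carrier L" by (simp add: extension_def)
      have "(\<ominus>\<^bsub>L\<^esub> \<one>\<^bsub>L\<^esub>) \<otimes>\<^bsub>L\<^esub> r \<in> extension I" by (rule mult[OF r]) simp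
      then have "\<ominus>\<^bsub>L\<^esub> r \<in> extension I" using rc by (simp add: L.l_minus)
      then show "inv\<^bsub>add_monoid L\<^esub> r \<in> extension I" unfolding a_inv_def .
    qed (use add zero in \<open>auto simp: extension_def\<close>)
    show "x \<otimes>\<^bsub>L\<^esub> r \<in> extension I" "r \<otimes>\<^bsub>L\<^esub> x \<in> extension I" if "r \<in> extension I" "x \<in> carrier L" for r x
      using mult[OF that] that L.m_comm[of r x] by (auto simp: extension_def)
  qed
qed

lemma map_in_extension:
  assumes "ideal I S" "x \<in> carrier S"
  shows "\<phi> x \<in> extension I \<longleftrightarrow> (\<exists>u\<in>U. u \<otimes> x \<in> I)"
proof
  interpret I: ideal I S by fact
  assume "\<phi> x \<in> extension I"
  then obtain u i where e: "u \<in> U" "i \<in> I" "\<phi> u \<otimes>\<^bsub>L\<^esub> \<phi> x = \<phi> i" by (auto simp: extension_def)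
  then have "\<phi> (u \<otimes> x) = \<phi> i" using assms by (simp add: map_mult)
  then obtain v where v: "v \<in> U" "v \<otimes> (u \<otimes> x) = v \<otimes> i"
    using e assms I.Icarr by (auto simp: map_eq_iff)
  then have "(v \<otimes> u) \<otimes> x = v \<otimes> i" using e assms by (simp add: m_assoc)
  also have "\<dots> \<in> I" using v e by (simp add: I.I_l_closed)
  finally show "\<exists>u\<in>U. u \<otimes> x \<in> I" using U_mult[OF v(1) e(1)] by blast
next
  assume "\<exists>u\<in>U. u \<otimes> x \<in> I"
  then obtain u where u: "u \<in> U" "u \<otimes> x \<in> I" by blast
  then have "\<phi> u \<otimes>\<^bsub>L\<^esub> \<phi> x = \<phi> (u \<otimes> x)" using assms by (simp add: map_mult)
  with u assms show "\<phi> x \<in> extension I" unfolding extension_def by auto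
qed

lemma Idl_map_image:
  assumes I: "ideal I S"
  shows "Idl\<^bsub>L\<^esub> (\<phi> ` I) = extension I"
proof
  interpret I: ideal I S by fact
  have sub: "\<phi> ` I \<subseteq> carrier L" using I.Icarr by auto
  have "\<phi> i \<in> extension I" if "i \<in> I" for i
    using that I.Icarr U_one by (subst map_in_extension[OF I]) (auto intro!: bexI[of _ \<one>])
  then show "Idl\<^bsub>L\<^esub> (\<phi> ` I) \<subseteq> extension I"
    by (intro L.genideal_minimal ideal_extension I) auto
  show "extension I \<subseteq> Idl\<^bsub>L\<^esub> (\<phi> ` I)"
  proof
    fix r assume "r \<in> extension I"
    then obtain u i where e: "r \<in> carrier L" "u \<in> U" "i \<in> I" "\<phi> u \<otimes>\<^bsub>L\<^esub> r = \<phi> i" by (auto simp: extension_def)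
    have "r = (\<phi> u \<otimes>\<^bsub>L\<^esub> quot \<one> u) \<otimes>\<^bsub>L\<^esub> r" using e by (simp add: map_unit)
    also have "\<dots> = quot \<one> u \<otimes>\<^bsub>L\<^esub> (\<phi> u \<otimes>\<^bsub>L\<^esub> r)"
    proof -
      have "\<phi> u \<in> carrier L" "quot \<one> u \<in> carrier L" using e(2) by auto
      then show ?thesis using e(1) by (simp add: L.m_ac)
    qed
    also have "\<dots> \<in> Idl\<^bsub>L\<^esub> (\<phi> ` I)"
      unfolding e(4) using e(2,3) L.genideal_self[OF sub]
      by (intro ideal.I_l_closed[OF L.genideal_ideal[OF sub]]) auto
    finally show "r \<in> Idl\<^bsub>L\<^esub> (\<phi> ` I)" .
  qed
qed

lemma loc_contraction_iff:
  assumes "ideal I S"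
  shows "x \<in> loc_contraction S P I \<longleftrightarrow> x \<in> carrier S \<and> (\<exists>u\<in>U. u \<otimes> x \<in> I)"
  by (auto simp: loc_contraction_def Idl_map_image[OF assms] map_in_extension[OF assms])

lemma maximalideal_extension: "maximalideal (extension P) L"
proof (rule maximalidealI)
  show "ideal (extension P) L" by (rule ideal_extension[OF is_ideal])
  have "\<phi> \<one> \<notin> extension P"
    using map_in_extension[OF is_ideal, of \<one>] by auto
  then show "carrier L \<noteq> extension P" using map_closed[of \<one>] by auto
  fix K assume K: "ideal K L" "extension P \<subseteq> K" "K \<subseteq> carrier L"
  interpret K: ideal K L by fact
  show "K = extension P \<or> K = carrier L"
  proof (rule disjCI)
    assume "K \<noteq> carrier L"
    have "x \<in> extension P" if x: "x \<in> K" for x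
    proof (rule ccontr)
      assume n: "x \<notin> extension P"
      obtain a s where a: "a \<in> carrier S" "s \<in> U" "x = quot a s" using L_cases[of x] x K.Icarr by blast
      have "a \<notin> P"
      proof
        assume "a \<in> P"
        then have "x \<in> extension P"
          unfolding extension_def using map_denominator[OF a(1,2)] a by auto
        with n show False by simp
      qed
      then have aU: "a \<in> U" using a by simp
      have "\<phi> s \<otimes>\<^bsub>L\<^esub> x \<in> K" using a x by (intro K.I_l_closed) auto
      then have "\<phi> a \<in> K" unfolding a(3) using a by (simp add: map_denominator)
      then have "\<phi> a \<otimes>\<^bsub>L\<^esub> quot \<one> a \<in> K" using aU by (intro K.I_r_closed) auto
      then have "\<one>\<^bsub>L\<^esub> \<in> K" using aU by (simp add: map_unit)
      then show False using K.one_imp_carrier \<open>K \<noteq> carrier L\<close> by simp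
    qed
    with K(2) show "K = extension P" by blast
  qed
qed

end

section \<open>Lifting operators from the localization\<close>

lemma add_pow_ring_char:
  assumes "ring_char R = p" "p > 0"
  shows "add_pow R p \<one>\<^bsub>R\<^esub> = \<zero>\<^bsub>R\<^esub>"
proof -
  define Q where "Q = (\<lambda>k::nat. k > 0 \<and> add_pow R k \<one>\<^bsub>R\<^esub> = \<zero>\<^bsub>R\<^esub>)"
  have c: "(if \<exists>k. Q k then LEAST k. Q k else 0) = p"
    using assms(1) unfolding ring_char_def Q_def .
  then have "\<exists>k. Q k" using assms(2) by (auto split: if_splits)
  from LeastI_ex[OF this] c \<open>\<exists>k. Q k\<close> have "Q p" by simp
  then show ?thesis by (simp add: Q_def)
qed

lemma (in cring) frobenius_add:
  fixes p :: nat
  assumes p: "Factorial_Ring.prime p" "add_pow R p \<one> = \<zero>" and ab: "a \<in> carrier R" "b \<in> carrier R"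
  shows "(a \<oplus> b) [^] p = a [^] p \<oplus> b [^] p"
proof -
  \<comment> \<open>The product type is indexed by plain ring records, so the additional fields of
    \<open>R\<close> are stripped first.\<close>
  define T :: "'a ring" where
    "T = \<lparr>carrier = carrier R, monoid.mult = monoid.mult R, one = one R, zero = ring.zero R, add = ring.add R\<rparr>"
  have T: "carrier T = carrier R" "monoid.mult T = monoid.mult R" "one T = one R" "ring.zero T = ring.zero R" "ring.add T = ring.add R"
    by (simp_all add: T_def)
  have "\<exists>y\<in>carrier R. y \<oplus> x = \<zero>" if "x \<in> carrier R" for x
    by (rule bexI[of _ "\<ominus> x"]) (simp_all add: that l_neg)
  then have "abelian_group T"
    by (intro abelian_groupI) (auto simp: T a_ac)
  moreover have "comm_monoid T"
    by (rule comm_monoidI) (auto simp: T m_ac)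
  ultimately have cT: "cring T"
    by (rule cringI) (simp add: T l_distr)
  have pow: "x [^]\<^bsub>T\<^esub> (n::nat) = x [^] n" for x n
    by (simp add: nat_pow_def T)
  have addpow: "add_pow T (n::nat) x = add_pow R n x" for x n
    by (simp add: add_pow_def nat_pow_def T)
  obtain w where "(embed_ring T a + embed_ring T b) ^ p
      = embed_ring T a ^ p + embed_ring T b ^ p + of_nat p * w"
    using freshmans_dream_mod[OF p(1)] by blast
  then have "proj T ((embed_ring T a + embed_ring T b) ^ p)
      = proj T (embed_ring T a ^ p + embed_ring T b ^ p + of_nat p * w)" by simp
  then show ?thesis
    using ab p(2) proj_in_carrier[OF cT, of w]
    by (simp add: proj_simps[OF cT] proj_power[OF cT] proj_of_nat[OF cT] proj_embed[OF cT] T pow addpow)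
qed

text \<open>Finiteness over the \<open>p ^ e\<close>-th powers, phrased as a closure principle so
  that later uses avoid finite sums. The generators of the next level are products of a
  \<open>p\<close>-th power of an old generator with a generator for the Frobenius map.\<close>

lemma (in cring) frobenius_power_generation:
  assumes p: "Factorial_Ring.prime p" "add_pow R p \<one> = \<zero>" and F: "F_finite p R"
  shows "\<exists>G\<subseteq>carrier R. finite G \<and> (\<forall>X\<subseteq>carrier R. \<zero> \<in> X \<longrightarrow> (\<forall>x\<in>X. \<forall>y\<in>X. x \<oplus> y \<in> X) \<longrightarrow>
    (\<forall>r\<in>carrier R. \<forall>g\<in>G. r [^] (p ^ e) \<otimes> g \<in> X) \<longrightarrow> X = carrier R)"
proof (induction e)
  case 0
  show ?case by (rule exI[of _ "{\<one>}"]) auto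
next
  case (Suc e)
  then obtain G where G: "G \<subseteq> carrier R" "finite G"
    and gen: "\<And>X. \<lbrakk>X \<subseteq> carrier R; \<zero> \<in> X; \<forall>x\<in>X. \<forall>y\<in>X. x \<oplus> y \<in> X;
      \<forall>r\<in>carrier R. \<forall>g\<in>G. r [^] (p ^ e) \<otimes> g \<in> X\<rbrakk> \<Longrightarrow> X = carrier R" by metis
  obtain A where A: "A \<subseteq> carrier R" "finite A"
    and span: "\<And>x. x \<in> carrier R \<Longrightarrow> \<exists>c\<in>A \<rightarrow> carrier R. x = (\<Oplus>a\<in>A. c a [^] p \<otimes> a)"
    using F by (auto simp: F_finite_def finite_ring_map_def)
  define G' where "G' = (\<lambda>(h, a). h [^] p \<otimes> a) ` (G \<times> A)"
  have p0: "p > 0" using p(1) prime_gt_0_nat by blast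
  have "X = carrier R" if X: "X \<subseteq> carrier R" "\<zero> \<in> X" "\<forall>x\<in>X. \<forall>y\<in>X. x \<oplus> y \<in> X"
    "\<forall>r\<in>carrier R. \<forall>g\<in>G'. r [^] (p ^ Suc e) \<otimes> g \<in> X" for X
  proof -
    have step: "c [^] p \<otimes> a \<in> X" if c: "c \<in> carrier R" and a: "a \<in> A" for c a
    proof -
      have ac: "a \<in> carrier R" using a A by auto
      \<comment> \<open>Additivity of Frobenius makes this set closed under addition, so the
        principle of level \<open>e\<close> applies to it.\<close>
      define Y where "Y = {c \<in> carrier R. c [^] p \<otimes> a \<in> X}"
      have "Y = carrier R"
      proof (rule gen)
        show "\<zero> \<in> Y" using X(2) p0 ac by (simp add: Y_def nat_pow_zero)
        show "\<forall>x\<in>Y. \<forall>y\<in>Y. x \<oplus> y \<in> Y"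
          using X(3) ac by (auto simp: Y_def frobenius_add[OF p] l_distr)
        show "\<forall>r\<in>carrier R. \<forall>g\<in>G. r [^] (p ^ e) \<otimes> g \<in> Y"
        proof (intro ballI)
          fix r g assume r: "r \<in> carrier R" and g: "g \<in> G"
          have gc: "g \<in> carrier R" using g G by auto
          have "(r [^] (p ^ e) \<otimes> g) [^] p \<otimes> a = r [^] (p ^ Suc e) \<otimes> (g [^] p \<otimes> a)"
            using r gc ac by (simp add: nat_pow_distrib nat_pow_pow m_assoc mult.commute)
          also have "\<dots> \<in> X" using X(4) r g a by (auto simp: G'_def)
          finally show "r [^] (p ^ e) \<otimes> g \<in> Y" using r gc by (simp add: Y_def)
        qed
      qed (auto simp: Y_def)
      with c show ?thesis by (auto simp: Y_def)
    qed
    have "x \<in> X" if x: "x \<in> carrier R" for x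
    proof -
      obtain c where c: "c \<in> A \<rightarrow> carrier R" "x = (\<Oplus>a\<in>A. c a [^] p \<otimes> a)" using span[OF x] by blast
      have "(\<Oplus>a\<in>B. c a [^] p \<otimes> a) \<in> X" if "B \<subseteq> A" for B
        using finite_subset[OF that A(2)] that
      proof (induction B)
        case empty
        then show ?case using X(2) by simp
      next
        case (insert b B)
        have "(\<lambda>a. c a [^] p \<otimes> a) \<in> insert b B \<rightarrow> carrier R"
          using insert.prems c(1) A(1) by (auto simp: Pi_iff subset_iff)
        then have "(\<Oplus>a\<in>insert b B. c a [^] p \<otimes> a) = c b [^] p \<otimes> b \<oplus> (\<Oplus>a\<in>B. c a [^] p \<otimes> a)"
          using insert.hyps by (intro finsum_insert) auto
        moreover have "c b [^] p \<otimes> b \<in> X" using insert.prems c(1) by (intro step) auto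
        ultimately show ?case using X(3) insert by auto
      qed
      from this[of A] c(2) show ?thesis by simp
    qed
    with X(1) show ?thesis by blast
  qed
  moreover have "G' \<subseteq> carrier R" using G A by (auto simp: G'_def subset_iff)
  moreover have "finite G'" using G A by (simp add: G'_def)
  ultimately show ?case by (intro exI[of _ G']) blast
qed

text \<open>Each equality of fractions comes with its own witness \<open>v\<close>. An element
  \<open>u\<close> with maximal annihilator serves uniformly, because multiplying it by
  \<open>v\<close> cannot enlarge the annihilator.\<close>

lemma (in prime_localization) exists_kernel_annihilator:
  assumes "noetherian_ring S"
  shows "\<exists>u\<in>U. \<forall>a\<in>carrier S. \<forall>b\<in>carrier S. \<phi> a = \<phi> b \<longrightarrow> u \<otimes> a = u \<otimes> b"
proof -
  interpret N: noetherian_ring S by fact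
  define Ann where "Ann v = {x \<in> carrier S. v \<otimes> x = \<zero>}" for v
  have "ideal (Ann v) S" if "v \<in> U" for v
  proof (rule idealI[OF ring_axioms])
    show "subgroup (Ann v) (add_monoid S)"
      by (rule add.subgroupI)
        (use that in \<open>auto simp: Ann_def r_distr r_minus a_inv_def[symmetric] intro!: exI[of _ \<zero>]\<close>)
    show "x \<otimes> a \<in> Ann v" "a \<otimes> x \<in> Ann v" if "a \<in> Ann v" "x \<in> carrier S" for a x
    proof -
      have "a \<in> carrier S" "v \<in> carrier S" using that \<open>v \<in> U\<close> by (auto simp: Ann_def)
      then have "v \<otimes> (x \<otimes> a) = x \<otimes> (v \<otimes> a)" using that(2) by (simp add: m_lcomm)
      then show "x \<otimes> a \<in> Ann v" using that by (simp add: Ann_def)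
      then show "a \<otimes> x \<in> Ann v" using that by (simp add: Ann_def m_comm)
    qed
  qed
  then have "\<exists>M\<in>Ann ` U. \<forall>K\<in>Ann ` U. M \<subseteq> K \<longrightarrow> K = M"
    using U_one by (intro N.exists_maximal_member) auto
  then obtain u where u: "u \<in> U" "\<And>v. v \<in> U \<Longrightarrow> Ann u \<subseteq> Ann v \<Longrightarrow> Ann v = Ann u" by blast
  have "u \<otimes> a = u \<otimes> b" if ab: "a \<in> carrier S" "b \<in> carrier S" "\<phi> a = \<phi> b" for a b
  proof -
    obtain v where v: "v \<in> U" "v \<otimes> a = v \<otimes> b" using ab by (auto simp: map_eq_iff)
    have c: "u \<in> carrier S" "v \<in> carrier S" using u v by auto
    have "Ann u \<subseteq> Ann (v \<otimes> u)" using c by (auto simp: Ann_def m_assoc)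
    then have eq: "Ann (v \<otimes> u) = Ann u" using u(2)[OF U_mult[OF v(1) u(1)]] by simp
    have "v \<otimes> (a \<ominus> b) = \<zero>" using v c ab by (simp add: minus_eq r_distr r_minus r_neg)
    moreover have "(v \<otimes> u) \<otimes> (a \<ominus> b) = u \<otimes> (v \<otimes> (a \<ominus> b))" using c ab by (simp add: m_ac)
    ultimately have "a \<ominus> b \<in> Ann u" unfolding eq[symmetric] using c ab by (simp add: Ann_def)
    then have "u \<otimes> a \<ominus> u \<otimes> b = \<zero>" using c ab by (simp add: Ann_def minus_eq r_distr r_minus)
    then show ?thesis using c ab by (simp add: r_right_minus_eq)
  qed
  with u(1) show ?thesis by blast
qed

context prime_localization_ring
begin

abbreviation lift :: "'a \<Rightarrow> ('a \<times> 'a) set ring_product" where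
  "lift s \<equiv> embed_ring L (\<phi> s)"

lemmas L_proj = proj_simps[OF cring_L] proj_in_carrier[OF cring_L] proj_embed[OF cring_L] proj_power[OF cring_L]

text \<open>An operator on the localization whose values have a common denominator \<open>w\<close> is lifted to \<open>S\<close>
  after multiplication by an element \<open>u\<close> that annihilates the kernel of the localization map.\<close>

lemma diff_ops_transfer:
  assumes u: "u \<in> U" "\<And>a b. a \<in> carrier S \<Longrightarrow> b \<in> carrier S \<Longrightarrow> \<phi> a = \<phi> b \<Longrightarrow> u \<otimes> a = u \<otimes> b"
    and w: "w \<in> U" and d: "diff_op n d"
    and cong: "\<And>x y. proj L x = proj L y \<Longrightarrow> proj L (d x) = proj L (d y)"
    and \<delta>: "\<And>s. s \<in> carrier S \<Longrightarrow> \<exists>t\<in>carrier S. \<delta> s = u \<otimes> t \<and> \<phi> t = \<phi> w \<otimes>\<^bsub>L\<^esub> proj L (d (lift s))"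
  shows "\<delta> \<in> diff_ops S n"
  using d cong \<delta>
proof (induction n arbitrary: d \<delta>)
  note [simp] = L_proj
  have uc: "u \<in> carrier S" and wc: "w \<in> carrier S" using u w by auto
  have hom: "\<delta> \<in> hom (add_monoid S) (add_monoid S)"
    if d: "diff_op n d" and cong: "\<And>x y. proj L x = proj L y \<Longrightarrow> proj L (d x) = proj L (d y)"
      and \<delta>: "\<And>s. s \<in> carrier S \<Longrightarrow> \<exists>t\<in>carrier S. \<delta> s = u \<otimes> t \<and> \<phi> t = \<phi> w \<otimes>\<^bsub>L\<^esub> proj L (d (lift s))"
    for n d \<delta>
  proof (rule homI)
    show "\<delta> x \<in> carrier (add_monoid S)" if "x \<in> carrier (add_monoid S)" for x
      using \<delta>[of x] that uc by auto
    show "\<delta> (x \<otimes>\<^bsub>add_monoid S\<^esub> y) = \<delta> x \<otimes>\<^bsub>add_monoid S\<^esub> \<delta> y"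
      if "x \<in> carrier (add_monoid S)" "y \<in> carrier (add_monoid S)" for x y
    proof -
      have xy: "x \<in> carrier S" "y \<in> carrier S" using that by auto
      obtain tx ty tz where t: "tx \<in> carrier S" "\<delta> x = u \<otimes> tx" "\<phi> tx = \<phi> w \<otimes>\<^bsub>L\<^esub> proj L (d (lift x))"
        "ty \<in> carrier S" "\<delta> y = u \<otimes> ty" "\<phi> ty = \<phi> w \<otimes>\<^bsub>L\<^esub> proj L (d (lift y))"
        "tz \<in> carrier S" "\<delta> (x \<oplus> y) = u \<otimes> tz" "\<phi> tz = \<phi> w \<otimes>\<^bsub>L\<^esub> proj L (d (lift (x \<oplus> y)))"
        using \<delta>[OF xy(1)] \<delta>[OF xy(2)] \<delta>[of "x \<oplus> y"] add.m_closed[of x y] xy by auto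
      have "proj L (lift (x \<oplus> y)) = proj L (lift x + lift y)" using xy by (simp add: map_add)
      then have "proj L (d (lift (x \<oplus> y))) = proj L (d (lift x + lift y))" by (rule cong)
      also have "d (lift x + lift y) = d (lift x) + d (lift y)"
        using diff_op_additive[OF d] by (simp add: additive_map_def)
      finally have "\<phi> tz = \<phi> (tx \<oplus> ty)" using t wc by (simp add: map_add L.r_distr)
      then have "u \<otimes> tz = u \<otimes> (tx \<oplus> ty)" using t by (intro u(2)) auto
      then show ?thesis using t uc by (simp add: r_distr)
    qed
  qed
  {
    case 0
    have "\<delta> (a \<otimes> x) = a \<otimes> \<delta> x" if ax: "a \<in> carrier S" "x \<in> carrier S" for a x
    proof -
      obtain t t' where t: "t \<in> carrier S" "\<delta> x = u \<otimes> t" "\<phi> t = \<phi> w \<otimes>\<^bsub>L\<^esub> proj L (d (lift x))"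
        "t' \<in> carrier S" "\<delta> (a \<otimes> x) = u \<otimes> t'" "\<phi> t' = \<phi> w \<otimes>\<^bsub>L\<^esub> proj L (d (lift (a \<otimes> x)))"
        using 0(3)[OF ax(2)] 0(3)[OF m_closed[OF ax]] by blast
      have "proj L (lift (a \<otimes> x)) = proj L (lift a * lift x)" using ax by (simp add: map_mult)
      then have "proj L (d (lift (a \<otimes> x))) = proj L (d (lift a * lift x))" by (rule 0(2))
      also have "d (lift a * lift x) = lift a * d (lift x)" using 0(1) by simp
      finally have "\<phi> t' = \<phi> (a \<otimes> t)" using t wc ax by (simp add: map_mult L.m_lcomm)
      then have "u \<otimes> t' = u \<otimes> (a \<otimes> t)" using t ax by (intro u(2)) auto
      then show ?thesis using t uc ax by (simp add: m_lcomm)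
    qed
    then show ?case using hom[OF 0] by (simp add: hom_over_def)
  next
    case (Suc n)
    \<comment> \<open>The commutator is related to the commutator of \<open>d\<close> with
      \<open>lift s\<close> by the same \<open>u\<close> and \<open>w\<close>, so the induction
      hypothesis applies without changing denominators.\<close>
    have "commutator S \<delta> s \<in> diff_ops S n" if s: "s \<in> carrier S" for s
    proof (rule Suc.IH)
      define d' where "d' = (\<lambda>x. d (lift s * x) - lift s * d x)"
      show "diff_op n (\<lambda>x. d (lift s * x) - lift s * d x)" using Suc.prems(1) by simp
      show "proj L (d (lift s * x) - lift s * d x) = proj L (d (lift s * y) - lift s * d y)"
        if xy: "proj L x = proj L y" for x y
      proof -
        have "proj L (d (lift s * x)) = proj L (d (lift s * y))"
          using xy by (intro Suc.prems(2)) simp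
        then show ?thesis using Suc.prems(2)[OF xy] by simp
      qed
      fix x assume x: "x \<in> carrier S"
      obtain t t' where t: "t \<in> carrier S" "\<delta> x = u \<otimes> t" "\<phi> t = \<phi> w \<otimes>\<^bsub>L\<^esub> proj L (d (lift x))"
        "t' \<in> carrier S" "\<delta> (s \<otimes> x) = u \<otimes> t'" "\<phi> t' = \<phi> w \<otimes>\<^bsub>L\<^esub> proj L (d (lift (s \<otimes> x)))"
        using Suc.prems(3)[OF x] Suc.prems(3)[OF m_closed[OF s x]] by blast
      have "proj L (lift (s \<otimes> x)) = proj L (lift s * lift x)" using s x by (simp add: map_mult)
      then have e: "proj L (d (lift (s \<otimes> x))) = proj L (d (lift s * lift x))" by (rule Suc.prems(2))
      have "\<phi> (t' \<ominus> s \<otimes> t) = \<phi> w \<otimes>\<^bsub>L\<^esub> proj L (d (lift s * lift x) - lift s * d (lift x))"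
        using t s wc e by (simp add: map_minus map_mult L.minus_eq L.r_distr L.r_minus L.m_lcomm)
      moreover have "commutator S \<delta> s x = u \<otimes> (t' \<ominus> s \<otimes> t)"
        using t s uc by (simp add: commutator_def minus_eq r_distr r_minus m_lcomm)
      ultimately show "\<exists>t\<in>carrier S. commutator S \<delta> s x = u \<otimes> t \<and>
          \<phi> t = \<phi> w \<otimes>\<^bsub>L\<^esub> proj L (d (lift s * lift x) - lift s * d (lift x))"
        using t s by (intro bexI[of _ "t' \<ominus> s \<otimes> t"]) auto
    qed
    then show ?case using hom[OF Suc.prems] by simp
  }
qed

lemma diff_ops_level_transfer:
  assumes u: "u \<in> U" "\<And>a b. a \<in> carrier S \<Longrightarrow> b \<in> carrier S \<Longrightarrow> \<phi> a = \<phi> b \<Longrightarrow> u \<otimes> a = u \<otimes> b"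
    and w: "w \<in> U" and lin: "\<And>r x. d (r ^ (p ^ e) * x) = r ^ (p ^ e) * d x"
    and cong: "\<And>x y. proj L x = proj L y \<Longrightarrow> proj L (d x) = proj L (d y)"
    and hom: "\<delta> \<in> hom (add_monoid S) (add_monoid S)"
    and \<delta>: "\<And>s. s \<in> carrier S \<Longrightarrow> \<exists>t\<in>carrier S. \<delta> s = u \<otimes> t \<and> \<phi> t = \<phi> w \<otimes>\<^bsub>L\<^esub> proj L (d (lift s))"
  shows "\<delta> \<in> diff_ops_level S p e"
proof -
  note [simp] = L_proj
  have uc: "u \<in> carrier S" and wc: "w \<in> carrier S" using u w by auto
  have "\<delta> (r [^] (p ^ e) \<otimes> x) = r [^] (p ^ e) \<otimes> \<delta> x" if rx: "r \<in> carrier S" "x \<in> carrier S" for r x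
  proof -
    define a where "a = r [^] (p ^ e)"
    have a: "a \<in> carrier S" using rx by (simp add: a_def)
    obtain t t' where t: "t \<in> carrier S" "\<delta> x = u \<otimes> t" "\<phi> t = \<phi> w \<otimes>\<^bsub>L\<^esub> proj L (d (lift x))"
      "t' \<in> carrier S" "\<delta> (a \<otimes> x) = u \<otimes> t'" "\<phi> t' = \<phi> w \<otimes>\<^bsub>L\<^esub> proj L (d (lift (a \<otimes> x)))"
      using \<delta>[OF rx(2)] \<delta>[OF m_closed[OF a rx(2)]] by blast
    have "proj L (lift (a \<otimes> x)) = proj L (lift r ^ (p ^ e) * lift x)"
      using rx a by (simp add: map_mult a_def malin_span_closed)
    then have "proj L (d (lift (a \<otimes> x))) = proj L (d (lift r ^ (p ^ e) * lift x))" by (rule cong)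
    also have "d (lift r ^ (p ^ e) * lift x) = lift r ^ (p ^ e) * d (lift x)" by (rule lin)
    also have "proj L (lift r ^ (p ^ e) * d (lift x)) = \<phi> a \<otimes>\<^bsub>L\<^esub> proj L (d (lift x))"
      using rx by (simp add: a_def malin_span_closed)
    finally have "\<phi> t' = \<phi> (a \<otimes> t)" using t wc a by (simp add: map_mult L.m_lcomm)
    then have "u \<otimes> t' = u \<otimes> (a \<otimes> t)" using t a by (intro u(2)) auto
    then show ?thesis using t uc a by (simp add: m_lcomm a_def)
  qed
  then show ?thesis using hom by (auto simp: diff_ops_level_def hom_over_def)
qed

text \<open>As \<open>d\<close> is linear over \<open>q\<close>-th powers and \<open>S\<close> is
  finite over its own, only the values on finitely many generators matter; the product of their
  denominators works for all.\<close>

lemma common_denominator: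
  assumes p: "Factorial_Ring.prime p" "add_pow S p \<one> = \<zero>" and F: "F_finite p S"
    and add: "additive_map d" and lin: "\<And>r x. d (r ^ (p ^ e) * x) = r ^ (p ^ e) * d x"
    and cong: "\<And>x y. proj L x = proj L y \<Longrightarrow> proj L (d x) = proj L (d y)"
  shows "\<exists>w\<in>U. \<forall>s\<in>carrier S. \<exists>t\<in>carrier S. \<phi> t = \<phi> w \<otimes>\<^bsub>L\<^esub> proj L (d (lift s))"
proof -
  note [simp] = L_proj
  obtain G where G: "G \<subseteq> carrier S" "finite G"
    and gen: "\<And>X. \<lbrakk>X \<subseteq> carrier S; \<zero> \<in> X; \<forall>x\<in>X. \<forall>y\<in>X. x \<oplus> y \<in> X;
      \<forall>r\<in>carrier S. \<forall>g\<in>G. r [^] (p ^ e) \<otimes> g \<in> X\<rbrakk> \<Longrightarrow> X = carrier S"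
    using frobenius_power_generation[OF p F] by metis
  have "\<exists>w\<in>U. \<forall>g\<in>B. \<exists>t\<in>carrier S. \<phi> t = \<phi> w \<otimes>\<^bsub>L\<^esub> proj L (d (lift g))" if "finite B" for B
    using that
  proof (induction B)
    case empty
    then show ?case using U_one by auto
  next
    case (insert g B)
    then obtain w where w: "w \<in> U" "\<forall>g\<in>B. \<exists>t\<in>carrier S. \<phi> t = \<phi> w \<otimes>\<^bsub>L\<^esub> proj L (d (lift g))" by blast
    obtain a v where a: "a \<in> carrier S" "v \<in> U" "proj L (d (lift g)) = quot a v"
      using L_cases[of "proj L (d (lift g))"] by auto
    have c: "w \<in> carrier S" "v \<in> carrier S" using w a by auto
    have "\<exists>t\<in>carrier S. \<phi> t = \<phi> (v \<otimes> w) \<otimes>\<^bsub>L\<^esub> proj L (d (lift h))" if h: "h \<in> insert g B" for h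
    proof (cases "h = g")
      case True
      have "\<phi> (w \<otimes> a) = \<phi> w \<otimes>\<^bsub>L\<^esub> (\<phi> v \<otimes>\<^bsub>L\<^esub> quot a v)" using a c by (simp add: map_mult map_denominator)
      also have "\<dots> = \<phi> (v \<otimes> w) \<otimes>\<^bsub>L\<^esub> quot a v"
        using c quot_closed[OF a(1,2)] by (simp add: map_mult L.m_ac)
      finally show ?thesis unfolding True a(3) using a c by blast
    next
      case False
      then obtain t where t: "t \<in> carrier S" "\<phi> t = \<phi> w \<otimes>\<^bsub>L\<^esub> proj L (d (lift h))" using w h by blast
      then have "\<phi> (v \<otimes> t) = \<phi> (v \<otimes> w) \<otimes>\<^bsub>L\<^esub> proj L (d (lift h))"
        using c by (simp add: map_mult L.m_assoc)
      then show ?thesis using t c by blast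
    qed
    then show ?case using U_mult[OF a(2) w(1)] by blast
  qed
  from this[OF G(2)] obtain w where w: "w \<in> U"
    "\<And>g. g \<in> G \<Longrightarrow> \<exists>t\<in>carrier S. \<phi> t = \<phi> w \<otimes>\<^bsub>L\<^esub> proj L (d (lift g))" by blast
  have wc: "w \<in> carrier S" using w by simp
  define X where "X = {s \<in> carrier S. \<exists>t\<in>carrier S. \<phi> t = \<phi> w \<otimes>\<^bsub>L\<^esub> proj L (d (lift s))}"
  have "X = carrier S"
  proof (rule gen)
    have d0: "d 0 = 0" using add unfolding additive_map_def by (metis add_cancel_right_right)
    have "proj L (d (lift \<zero>)) = proj L (d 0)" by (rule cong) simp
    also have "\<dots> = \<zero>\<^bsub>L\<^esub>" unfolding d0 by simp
    finally have "\<phi> \<zero> = \<phi> w \<otimes>\<^bsub>L\<^esub> proj L (d (lift \<zero>))" using map_closed[OF wc] by simp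
    then show "\<zero> \<in> X" unfolding X_def by blast
    show "\<forall>x\<in>X. \<forall>y\<in>X. x \<oplus> y \<in> X"
    proof (intro ballI)
      fix x y assume xy: "x \<in> X" "y \<in> X"
      then obtain t t' where t: "t \<in> carrier S" "\<phi> t = \<phi> w \<otimes>\<^bsub>L\<^esub> proj L (d (lift x))"
        "t' \<in> carrier S" "\<phi> t' = \<phi> w \<otimes>\<^bsub>L\<^esub> proj L (d (lift y))" by (auto simp: X_def)
      have c: "x \<in> carrier S" "y \<in> carrier S" using xy by (auto simp: X_def)
      have "proj L (d (lift (x \<oplus> y))) = proj L (d (lift x + lift y))"
        by (rule cong) (use c in \<open>simp add: map_add\<close>)
      also have "d (lift x + lift y) = d (lift x) + d (lift y)" using add by (simp add: additive_map_def)
      finally have "\<phi> (t \<oplus> t') = \<phi> w \<otimes>\<^bsub>L\<^esub> proj L (d (lift (x \<oplus> y)))"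
        using t wc by (simp add: map_add L.r_distr)
      then show "x \<oplus> y \<in> X" using c t by (auto simp: X_def intro!: bexI[of _ "t \<oplus> t'"])
    qed
    show "\<forall>r\<in>carrier S. \<forall>g\<in>G. r [^] (p ^ e) \<otimes> g \<in> X"
    proof (intro ballI)
      fix r g assume r: "r \<in> carrier S" and g: "g \<in> G"
      then have gc: "g \<in> carrier S" using G by auto
      obtain t where t: "t \<in> carrier S" "\<phi> t = \<phi> w \<otimes>\<^bsub>L\<^esub> proj L (d (lift g))" using w(2)[OF g] by blast
      have "proj L (d (lift (r [^] (p ^ e) \<otimes> g))) = proj L (d (lift r ^ (p ^ e) * lift g))"
        by (rule cong) (use r gc in \<open>simp add: map_mult malin_span_closed\<close>)
      also have "\<dots> = \<phi> (r [^] (p ^ e)) \<otimes>\<^bsub>L\<^esub> proj L (d (lift g))" using r by (simp add: lin malin_span_closed)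
      finally have "\<phi> (r [^] (p ^ e) \<otimes> t) = \<phi> w \<otimes>\<^bsub>L\<^esub> proj L (d (lift (r [^] (p ^ e) \<otimes> g)))"
        using t wc r by (simp add: map_mult L.m_lcomm)
      then show "r [^] (p ^ e) \<otimes> g \<in> X" using r gc t by (auto simp: X_def)
    qed
  qed (auto simp: X_def)
  then show ?thesis using w(1) unfolding X_def by blast
qed

end

section \<open>Primary decomposition\<close>

lemma (in cring) primary_ideal_Int:
  assumes Q: "primary_ideal R Q" "primary_ideal R Q'" "ideal_radical R Q = ideal_radical R Q'"
  shows "primary_ideal R (Q \<inter> Q')"
proof -
  interpret Q: ideal Q R using Q(1) by (simp add: primary_ideal_def)
  interpret Q': ideal Q' R using Q(2) by (simp add: primary_ideal_def)
  have rad: "b \<in> ideal_radical R (Q \<inter> Q')" if bQ: "b \<in> ideal_radical R Q" for b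
  proof -
    have "b \<in> ideal_radical R Q'" using bQ unfolding Q(3) .
    then obtain l :: nat where l: "b [^] l \<in> Q'" unfolding ideal_radical_def by blast
    obtain k :: nat where b: "b \<in> carrier R" "b [^] k \<in> Q"
      using bQ unfolding ideal_radical_def by blast
    have "b [^] k \<otimes> b [^] l \<in> Q \<inter> Q'" using b l by (simp add: Q.I_r_closed Q'.I_l_closed)
    then have "b [^] (k + l) \<in> Q \<inter> Q'" using b(1) by (simp add: nat_pow_mult)
    then show ?thesis using b(1) unfolding ideal_radical_def by blast
  qed
  have "ideal (Q \<inter> Q') R" by (rule i_intersect[OF Q.is_ideal Q'.is_ideal])
  moreover have "Q \<inter> Q' \<noteq> carrier R" using Q(1) Q.Icarr by (auto simp: primary_ideal_def)
  moreover have "a \<in> Q \<inter> Q' \<or> b \<in> ideal_radical R (Q \<inter> Q')"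
    if ab: "a \<in> carrier R" "b \<in> carrier R" "a \<otimes> b \<in> Q \<inter> Q'" for a b
  proof -
    have "a \<in> Q \<or> b \<in> ideal_radical R Q" "a \<in> Q' \<or> b \<in> ideal_radical R Q'"
      using Q(1,2) ab unfolding primary_ideal_def by blast+
    then show ?thesis using rad Q(3) by blast
  qed
  ultimately show ?thesis unfolding primary_ideal_def by blast
qed

text \<open>Noether's argument: a maximal ideal among those without a decomposition is not primary,
  and the failing pair \<open>a\<close>, \<open>b\<close> writes it as the intersection of the
  larger ideals generated over it by \<open>a\<close> and by a power of \<open>b\<close>.\<close>

lemma (in noetherian_ring) exists_primary_decomposition:
  assumes cring: "cring R" and I: "ideal I R"
  shows "\<exists>D. finite D \<and> (\<forall>Q\<in>D. primary_ideal R Q) \<and> I = carrier R \<inter> \<Inter>D"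
proof (rule ccontr)
  interpret cring R by fact
  define dec where "dec I D \<longleftrightarrow> finite D \<and> (\<forall>Q\<in>D. primary_ideal R Q) \<and> I = carrier R \<inter> \<Inter>D" for I D
  define F where "F = {I. ideal I R \<and> (\<forall>D. \<not> dec I D)}"
  assume "\<not> ?thesis"
  then have "I \<in> F" using I by (simp add: F_def dec_def)
  then have "\<exists>M\<in>F. \<forall>K\<in>F. M \<subseteq> K \<longrightarrow> K = M"
    by (intro exists_maximal_member) (auto simp: F_def)
  then obtain M where "M \<in> F" and max: "\<And>K. K \<in> F \<Longrightarrow> M \<subseteq> K \<Longrightarrow> K = M" by blast
  then have M: "ideal M R" "\<And>D. \<not> dec M D" by (auto simp: F_def)
  interpret M: ideal M R by (rule M)
  have "\<not> primary_ideal R M"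
    using M(2)[of "{M}"] M.Icarr by (auto simp: dec_def)
  moreover have "M \<noteq> carrier R" using M(2)[of "{}"] by (auto simp: dec_def)
  ultimately obtain a b where ab: "a \<in> carrier R" "b \<in> carrier R" "a \<otimes> b \<in> M" "a \<notin> M"
    "b \<notin> ideal_radical R M" using M(1) by (auto simp: primary_ideal_def)
  then have bk: "b [^] (k::nat) \<notin> M" for k by (auto simp: ideal_radical_def)
  \<comment> \<open>Colon ideals of \<open>M\<close> by powers of \<open>b\<close>. They increase,
    so a maximal one gives an exponent \<open>k\<close> from which the next step adds
    nothing.\<close>
  define A where "A k = {r \<in> carrier R. r \<otimes> b [^] (k::nat) \<in> M}" for k
  have idA: "ideal (A k) R" for k
  proof (rule idealI[OF ring_axioms])
    have bkc: "b [^] k \<in> carrier R" using ab by simp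
    show "subgroup (A k) (add_monoid R)"
      by (rule add.subgroupI)
        (use bkc in \<open>auto simp: A_def l_distr l_minus a_inv_def[symmetric] intro!: exI[of _ \<zero>]\<close>)
    show "x \<otimes> r \<in> A k" "r \<otimes> x \<in> A k" if "r \<in> A k" "x \<in> carrier R" for r x
    proof -
      have r: "r \<in> carrier R" "r \<otimes> b [^] k \<in> M" using that by (auto simp: A_def)
      have "(x \<otimes> r) \<otimes> b [^] k = x \<otimes> (r \<otimes> b [^] k)" using r(1) that bkc by (simp add: m_assoc)
      then show "x \<otimes> r \<in> A k" using r that M.I_l_closed by (simp add: A_def)
      then show "r \<otimes> x \<in> A k" using r that by (simp add: m_comm)
    qed
  qed
  have "\<exists>B\<in>range A. \<forall>K\<in>range A. B \<subseteq> K \<longrightarrow> K = B"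
    by (rule exists_maximal_member) (use idA in auto)
  then obtain B where B: "B \<in> range A" "\<forall>K\<in>range A. B \<subseteq> K \<longrightarrow> K = B" by (rule bexE)
  then obtain k where "B = A k" by (elim rangeE)
  with B(2) have k: "A l = A k" if "A k \<subseteq> A l" for l using that by simp
  have "A k \<subseteq> A (Suc k)"
  proof
    fix r assume r: "r \<in> A k"
    then have rc: "r \<in> carrier R" by (simp add: A_def)
    have "r \<otimes> b [^] Suc k = (r \<otimes> b [^] k) \<otimes> b" using rc ab by (simp add: m_assoc)
    also have "\<dots> \<in> M" by (rule M.I_r_closed) (use r ab in \<open>auto simp: A_def\<close>)
    finally show "r \<in> A (Suc k)" using rc by (simp add: A_def)
  qed
  then have stable: "A (Suc k) = A k" by (rule k)
  define M1 where "M1 = M <+>\<^bsub>R\<^esub> PIdl (b [^] k)"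
  define M2 where "M2 = M <+>\<^bsub>R\<^esub> PIdl a"
  have mem: "x \<in> M <+>\<^bsub>R\<^esub> PIdl c \<longleftrightarrow> (\<exists>i\<in>M. \<exists>r\<in>carrier R. x = i \<oplus> r \<otimes> c)" for x c
    unfolding set_add_def' cgenideal_def by blast
  have bigger: "ideal (M <+>\<^bsub>R\<^esub> PIdl c) R" "M \<subseteq> M <+>\<^bsub>R\<^esub> PIdl c" "c \<in> M <+>\<^bsub>R\<^esub> PIdl c" if "c \<in> carrier R" for c
  proof -
    show "ideal (M <+>\<^bsub>R\<^esub> PIdl c) R" by (rule add_ideals[OF M(1) cgenideal_ideal[OF that]])
    have "y = y \<oplus> \<zero> \<otimes> c" if "y \<in> M" for y using M.Icarr[OF that] \<open>c \<in> carrier R\<close> by simp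
    then show "M \<subseteq> M <+>\<^bsub>R\<^esub> PIdl c" unfolding mem subset_iff by (metis zero_closed)
    have "c = \<zero> \<oplus> \<one> \<otimes> c" using that by simp
    then show "c \<in> M <+>\<^bsub>R\<^esub> PIdl c" unfolding mem using M.zero_closed by blast
  qed
  have ex: "\<exists>D. dec (M <+>\<^bsub>R\<^esub> PIdl c) D" if "c \<in> carrier R" "c \<notin> M" for c
  proof (rule ccontr)
    assume "\<not> ?thesis"
    then have "M <+>\<^bsub>R\<^esub> PIdl c \<in> F" using bigger[OF that(1)] by (simp add: F_def)
    then show False using max bigger[OF that(1)] that(2) by blast
  qed
  obtain D1 D2 where D: "dec M1 D1" "dec M2 D2"
    using ex[of "b [^] k"] ex[of a] ab bk by (auto simp: M1_def M2_def)
  \<comment> \<open>For \<open>y = i + r b^k = j + s a\<close>, the second form puts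
    \<open>b y\<close> into \<open>M\<close> since \<open>a b\<close> is there. The first form then
    puts \<open>r b^(k+1)\<close> into \<open>M\<close>, and stability lowers the exponent to
    \<open>k\<close>.\<close>
  have "M1 \<inter> M2 \<subseteq> M"
  proof
    fix y assume "y \<in> M1 \<inter> M2"
    then obtain i r j s where y: "i \<in> M" "r \<in> carrier R" "y = i \<oplus> r \<otimes> b [^] k"
      "j \<in> M" "s \<in> carrier R" "y = j \<oplus> s \<otimes> a" by (auto simp: M1_def M2_def mem)
    have c: "i \<in> carrier R" "j \<in> carrier R" "b [^] k \<in> carrier R" using y M.Icarr ab by auto
    have "b \<otimes> y = b \<otimes> j \<oplus> s \<otimes> (a \<otimes> b)"
      unfolding y(6) using c y(5) ab by (simp add: r_distr m_ac)
    then have "b \<otimes> y \<in> M" using y ab by (simp add: M.I_l_closed)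
    moreover have "b \<otimes> y = r \<otimes> b [^] Suc k \<oplus> b \<otimes> i"
      unfolding y(3) using c y(2) ab by (simp add: r_distr m_ac a_comm)
    ultimately have "r \<otimes> b [^] Suc k \<oplus> b \<otimes> i \<in> M" by simp
    moreover have "\<ominus> (b \<otimes> i) \<in> M" using y(1) ab by (simp add: M.I_l_closed)
    ultimately have "(r \<otimes> b [^] Suc k \<oplus> b \<otimes> i) \<oplus> \<ominus> (b \<otimes> i) \<in> M"
      by (rule M.a_closed)
    moreover have "(r \<otimes> b [^] Suc k \<oplus> b \<otimes> i) \<oplus> \<ominus> (b \<otimes> i) = r \<otimes> b [^] Suc k"
      using c y(2) ab by (simp add: a_assoc r_neg del: nat_pow_Suc)
    ultimately have "r \<in> A (Suc k)" using y(2) by (simp add: A_def del: nat_pow_Suc)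
    then have "r \<otimes> b [^] k \<in> M" unfolding stable by (simp add: A_def)
    then show "y \<in> M" unfolding y(3) using y(1) by simp
  qed
  moreover have "M \<subseteq> M1 \<inter> M2" using bigger ab by (simp add: M1_def M2_def)
  ultimately have "dec M (D1 \<union> D2)"
    using D by (auto simp: dec_def)
  with M(2) show False by blast
qed

text \<open>Least cardinality gives both requirements: a redundant member could be dropped, and two
  members with equal radical could be merged by \<open>primary_ideal_Int\<close>.\<close>

lemma (in noetherian_ring) exists_minimal_primary_decomposition:
  assumes cring: "cring R" and I: "ideal I R"
  shows "\<exists>D. minimal_primary_decomposition R I D"
proof -
  interpret cring R by fact
  define dec where "dec D \<longleftrightarrow> finite D \<and> (\<forall>Q\<in>D. primary_ideal R Q) \<and> I = carrier R \<inter> \<Inter>D" for D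
  have "\<exists>D. dec D" unfolding dec_def by (rule exists_primary_decomposition[OF assms])
  then obtain D where D: "dec D" "\<And>D'. dec D' \<Longrightarrow> card D \<le> card D'"
    using ex_has_least_nat[of dec _ card] by blast
  have fin: "finite D" and prim: "\<And>Q. Q \<in> D \<Longrightarrow> primary_ideal R Q" and IntD: "I = carrier R \<inter> \<Inter>D"
    using D(1) by (auto simp: dec_def)
  have "\<not> carrier R \<inter> \<Inter>(D - {Q}) \<subseteq> Q" if "Q \<in> D" for Q
  proof
    assume "carrier R \<inter> \<Inter>(D - {Q}) \<subseteq> Q"
    then have "I = carrier R \<inter> \<Inter>(D - {Q})" using that unfolding IntD by blast
    then have "dec (D - {Q})" using fin prim by (simp add: dec_def)
    then have "card D \<le> card (D - {Q})" by (rule D(2))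
    moreover have "card (D - {Q}) < card D" by (rule card_Diff1_less[OF fin that])
    ultimately show False by simp
  qed
  moreover have "inj_on (ideal_radical R) D"
  proof (rule inj_onI, rule ccontr)
    fix Q Q' assume Q: "Q \<in> D" "Q' \<in> D" "ideal_radical R Q = ideal_radical R Q'" "Q \<noteq> Q'"
    define D' where "D' = insert (Q \<inter> Q') (D - {Q} - {Q'})"
    have "primary_ideal R (Q \<inter> Q')" using Q prim by (intro primary_ideal_Int) auto
    moreover have "I = carrier R \<inter> \<Inter>D'" using Q unfolding IntD D'_def by blast
    ultimately have "dec D'" using fin prim by (auto simp: dec_def D'_def)
    then have "card D \<le> card D'" by (rule D(2))
    also have "card D' \<le> Suc (card (D - {Q} - {Q'}))"
      unfolding D'_def using fin by (simp add: card_insert_if)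
    also have "\<dots> = card (D - {Q})" using Q fin by (intro card_Suc_Diff1) auto
    also have "\<dots> < card D" by (rule card_Diff1_less[OF fin Q(1)])
    finally show False by simp
  qed
  ultimately show ?thesis using fin prim IntD unfolding minimal_primary_decomposition_def by blast
qed

section \<open>Differential powers\<close>

context prime_localization
begin

text \<open>Each member contains a power of an element outside \<open>P\<close>, and the product of
  these powers stays outside \<open>P\<close>. It clears all components that disappear in the
  localization.\<close>

lemma unit_in_all:
  assumes "finite B" "\<And>Q. Q \<in> B \<Longrightarrow> ideal Q S \<and> \<not> ideal_radical S Q \<subseteq> P"
  shows "\<exists>u\<in>U. \<forall>Q\<in>B. u \<in> Q"
  using assms
proof (induction B)
  case empty
  then show ?case using U_one by auto
next
  case (insert Q B)
  then obtain u where u: "u \<in> U" "\<forall>Q\<in>B. u \<in> Q" by blast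
  obtain b k where b: "b \<in> carrier S" "b \<notin> P" "b [^] (k::nat) \<in> Q"
    using insert.prems[of Q] by (auto simp: ideal_radical_def)
  have bk: "b [^] k \<in> U" using b by (intro U_power) auto
  have "b [^] k \<otimes> u \<in> K" if "K \<in> insert Q B" for K
  proof -
    interpret K: ideal K S using insert.prems that by blast
    show ?thesis
    proof (cases "K = Q")
      case True
      then show ?thesis using b(3) u(1) K.I_r_closed by auto
    next
      case False
      then show ?thesis using that u(2) bk K.I_l_closed by auto
    qed
  qed
  with U_mult[OF bk u(1)] show ?case by blast
qed

text \<open>Powers of elements of \<open>P\<close> lie in \<open>I\<close>, so \<open>P\<close> is
  contained in every radical. Some radical equals \<open>P\<close>, since otherwise
  \<open>unit_in_all\<close> would give an element of \<open>I\<close> outside \<open>P\<close>; a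
  second use of \<open>unit_in_all\<close> clears the remaining components.\<close>

lemma primary_component_unique:
  assumes I: "ideal I S" "I \<subseteq> P" and rad: "\<And>a. a \<in> P \<Longrightarrow> \<exists>k::nat. a [^] k \<in> I"
    and D: "minimal_primary_decomposition S I D"
  shows "{Q \<in> D. ideal_radical S Q = P} = {{x \<in> carrier S. \<exists>u\<in>U. u \<otimes> x \<in> I}}"
proof -
  have fin: "finite D" and prim: "\<And>Q. Q \<in> D \<Longrightarrow> primary_ideal S Q" and IntD: "I = carrier S \<inter> \<Inter>D"
    and inj: "inj_on (ideal_radical S) D"
    using D by (auto simp: minimal_primary_decomposition_def)
  have idl: "ideal Q S" if "Q \<in> D" for Q using prim[OF that] by (simp add: primary_ideal_def)
  have P_le: "P \<subseteq> ideal_radical S Q" if "Q \<in> D" for Q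
    using rad IntD that Icarr unfolding ideal_radical_def by blast
  obtain Q0 where Q0: "Q0 \<in> D" "ideal_radical S Q0 \<subseteq> P"
  proof (rule ccontr)
    assume "\<not> thesis"
    with that have "\<not> ideal_radical S Q \<subseteq> P" if "Q \<in> D" for Q using \<open>Q \<in> D\<close> by blast
    then obtain u where "u \<in> U" "\<forall>Q\<in>D. u \<in> Q" using unit_in_all[OF fin] idl by blast
    then show False using IntD I(2) by blast
  qed
  then have rad0: "ideal_radical S Q0 = P" using P_le by blast
  have "\<not> ideal_radical S Q \<subseteq> P" if "Q \<in> D - {Q0}" for Q
  proof
    assume "ideal_radical S Q \<subseteq> P"
    then have "ideal_radical S Q = ideal_radical S Q0" using P_le[of Q] that rad0 by blast
    with inj that Q0(1) show False by (auto dest: inj_onD)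
  qed
  then obtain u where u: "u \<in> U" "\<forall>Q\<in>D - {Q0}. u \<in> Q"
    using unit_in_all[of "D - {Q0}"] fin idl by blast
  interpret Q0: ideal Q0 S by (rule idl[OF Q0(1)])
  have Q0_eq: "Q0 = {x \<in> carrier S. \<exists>u\<in>U. u \<otimes> x \<in> I}"
  proof (intro equalityI subsetI)
    fix x assume x: "x \<in> Q0"
    have xc: "x \<in> carrier S" using Q0.Icarr[OF x] .
    have "u \<otimes> x \<in> Q" if "Q \<in> D" for Q
    proof (cases "Q = Q0")
      case True
      then show ?thesis using x u(1) Q0.I_l_closed by auto
    next
      case False
      then show ?thesis using that u xc ideal.I_r_closed[OF idl[OF that]] by auto
    qed
    then have "u \<otimes> x \<in> I" using IntD u(1) xc by auto
    then show "x \<in> {x \<in> carrier S. \<exists>u\<in>U. u \<otimes> x \<in> I}" using u(1) xc by blast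
  next
    fix x assume "x \<in> {x \<in> carrier S. \<exists>u\<in>U. u \<otimes> x \<in> I}"
    then obtain v where v: "x \<in> carrier S" "v \<in> U" "v \<otimes> x \<in> I" by blast
    then have "x \<otimes> v \<in> Q0" using IntD Q0(1) by (auto simp: m_comm)
    then show "x \<in> Q0" using prim[OF Q0(1)] v rad0 by (auto simp: primary_ideal_def)
  qed
  have "Q = Q0" if "Q \<in> D" "ideal_radical S Q = P" for Q
    using inj_onD[OF inj _ that(1) Q0(1)] that(2) rad0 by blast
  then have "{Q \<in> D. ideal_radical S Q = P} = {Q0}" using Q0(1) rad0 by blast
  also have "\<dots> = {{x \<in> carrier S. \<exists>u\<in>U. u \<otimes> x \<in> I}}"
    by (rule arg_cong[OF Q0_eq])
  finally show ?thesis .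
qed

section \<open>Operators on powers of the prime and the first inclusion\<close>

definition ideal_pow :: "nat \<Rightarrow> 'a set" where
  "ideal_pow k = P [^]\<^bsub>ideals_set S\<^esub> k"

lemma ideal_pow_0: "ideal_pow 0 = carrier S"
  and ideal_pow_Suc: "ideal_pow (Suc k) = ideal_prod S (ideal_pow k) P"
  by (simp_all add: ideal_pow_def nat_pow_def ideals_set_def)

lemma ideal_ideal_pow: "ideal (ideal_pow k) S"
proof (induction k)
  case 0
  show ?case unfolding ideal_pow_0 by (rule oneideal)
next
  case (Suc k)
  show ?case unfolding ideal_pow_Suc by (rule ideal_prod_is_ideal[OF Suc is_ideal])
qed

lemma ideal_pow_le: "ideal_pow (Suc k) \<subseteq> P"
  unfolding ideal_pow_Suc using ideal_prod_inter[OF ideal_ideal_pow is_ideal] by blast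

lemma power_in_ideal_pow: "a \<in> P \<Longrightarrow> a [^] k \<in> ideal_pow k"
proof (induction k)
  case 0
  then show ?case unfolding ideal_pow_0 by simp
next
  case (Suc k)
  then show ?case unfolding ideal_pow_Suc by (simp add: ideal_prod.prod)
qed

lemma hom_values:
  assumes "\<delta> \<in> hom (add_monoid S) (add_monoid S)"
  shows "x \<in> carrier S \<Longrightarrow> \<delta> x \<in> carrier S"
    "x \<in> carrier S \<Longrightarrow> y \<in> carrier S \<Longrightarrow> \<delta> (x \<oplus> y) = \<delta> x \<oplus> \<delta> y" "\<delta> \<zero> = \<zero>"
proof -
  show c: "x \<in> carrier S \<Longrightarrow> \<delta> x \<in> carrier S" for x using hom_in_carrier[OF assms] by simp
  show a: "x \<in> carrier S \<Longrightarrow> y \<in> carrier S \<Longrightarrow> \<delta> (x \<oplus> y) = \<delta> x \<oplus> \<delta> y" for x y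
    using hom_mult[OF assms] by simp
  have "\<delta> \<zero> \<oplus> \<delta> \<zero> = \<delta> \<zero> \<oplus> \<zero>" using a[of \<zero> \<zero>] c[of \<zero>] by simp
  moreover have "\<delta> \<zero> \<in> carrier S" using c[of \<zero>] by simp
  ultimately show "\<delta> \<zero> = \<zero>" by simp
qed

lemma diff_ops_hom: "\<delta> \<in> diff_ops S n \<Longrightarrow> \<delta> \<in> hom (add_monoid S) (add_monoid S)"
  by (cases n) (auto simp: hom_over_def)

text \<open>A product satisfies \<open>\<delta> (i j) = [\<delta>, j] i + j \<delta> i\<close>,
  where the commutator has order one less. So each order uses up one factor of \<open>P\<close>, and
  one factor is left.\<close>

lemma diff_ops_ideal_pow:
  "\<delta> \<in> diff_ops S n \<Longrightarrow> y \<in> ideal_pow (Suc n) \<Longrightarrow> \<delta> y \<in> P"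
proof (induction n arbitrary: \<delta> y)
  case 0
  then have y: "y \<in> P" using ideal_pow_le by blast
  then have "\<delta> (y \<otimes> \<one>) = y \<otimes> \<delta> \<one>"
    using 0(1) Icarr[OF y] one_closed unfolding diff_ops.simps hom_over_def by blast
  moreover have "\<delta> \<one> \<in> carrier S" using hom_values(1)[OF diff_ops_hom[OF 0(1)]] by simp
  ultimately show ?case using y Icarr I_r_closed by auto
next
  case (Suc n)
  note h = hom_values[OF diff_ops_hom[OF Suc.prems(1)]]
  from Suc.prems(2) have "y \<in> ideal_prod S (ideal_pow (Suc n)) P" by (simp only: ideal_pow_Suc)
  then have "y \<in> carrier S \<and> \<delta> y \<in> P"
  proof (induction rule: ideal_prod.induct)
    case (prod i j)
    have c: "i \<in> carrier S" "j \<in> carrier S"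
      using prod ideal.Icarr[OF ideal_ideal_pow] Icarr by auto
    have "commutator S \<delta> j i \<in> P" using Suc.IH prod(1) Suc.prems(1) c by simp
    moreover have "j \<otimes> \<delta> i \<in> P" using prod(2) h(1)[OF c(1)] I_r_closed by simp
    ultimately have "commutator S \<delta> j i \<oplus> j \<otimes> \<delta> i \<in> P" by simp
    moreover have "commutator S \<delta> j i \<oplus> j \<otimes> \<delta> i = \<delta> (i \<otimes> j)"
      using c h(1) by (simp add: commutator_def minus_eq a_assoc l_neg m_comm)
    ultimately show ?case using c by simp
  next
    case (sum s t)
    then show ?case using h(2) by simp
  qed
  then show ?case by simp
qed

lemma ideal_frobenius_power: "ideal (frobenius_power S P p e) S"
  unfolding frobenius_power_def by (rule genideal_ideal) (use Icarr in auto)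

lemma frobenius_power_mem: "a \<in> P \<Longrightarrow> a [^] (p ^ e) \<in> frobenius_power S P p e"
proof -
  assume "a \<in> P"
  have "(\<lambda>x. x [^] (p ^ e)) ` P \<subseteq> carrier S" using Icarr by auto
  from genideal_self[OF this] \<open>a \<in> P\<close> show ?thesis unfolding frobenius_power_def by blast
qed

lemma frobenius_power_le:
  assumes "ideal K S" "\<And>a. a \<in> P \<Longrightarrow> a [^] (p ^ e) \<in> K"
  shows "frobenius_power S P p e \<subseteq> K"
  unfolding frobenius_power_def by (rule genideal_minimal) (use assms in auto)

lemma diff_ops_frobenius_power:
  assumes "\<delta> \<in> diff_ops_level S p e" "p > 0" "y \<in> frobenius_power S P p e"
  shows "\<delta> y \<in> P"
proof -
  have hom: "\<delta> \<in> hom (add_monoid S) (add_monoid S)"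
    and lin: "\<And>r x. r \<in> carrier S \<Longrightarrow> x \<in> carrier S \<Longrightarrow> \<delta> (r [^] (p ^ e) \<otimes> x) = r [^] (p ^ e) \<otimes> \<delta> x"
    using assms(1) by (auto simp: diff_ops_level_def hom_over_def)
  note h = hom_values[OF hom]
  \<comment> \<open>The quantifier over \<open>t\<close> makes \<open>K\<close> an ideal, so only
    the generating \<open>q\<close>-th powers remain to be checked.\<close>
  define K where "K = {y \<in> carrier S. \<forall>t\<in>carrier S. \<delta> (y \<otimes> t) \<in> P}"
  have mult: "y \<otimes> x \<in> K" if "y \<in> K" "x \<in> carrier S" for x y
    using that by (auto simp: K_def m_assoc)
  have "ideal K S"
  proof (rule idealI[OF ring_axioms])
    show "subgroup K (add_monoid S)"
    proof (rule add.subgroupI)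
      show "K \<noteq> {}" using h(3) zero_closed by (auto simp: K_def intro!: exI[of _ \<zero>])
      show "\<ominus> y \<in> K" if "y \<in> K" for y
      proof -
        have "y \<otimes> (\<ominus> \<one>) \<in> K" by (rule mult[OF that]) simp
        then show ?thesis using that by (simp add: K_def r_minus)
      qed
    qed (auto simp: K_def l_distr h)
    show "x \<otimes> y \<in> K" "y \<otimes> x \<in> K" if "y \<in> K" "x \<in> carrier S" for x y
      using mult[OF that] that m_comm[of x y] by (auto simp: K_def)
  qed
  moreover have "a [^] (p ^ e) \<in> K" if a: "a \<in> P" for a
  proof -
    have ac: "a \<in> carrier S" using Icarr[OF a] .
    have "a [^] (p ^ e) \<in> P"
    proof -
      obtain m where "p ^ e = Suc m" using assms(2) by (cases "p ^ e") auto
      then show ?thesis using a ac I_l_closed by simp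
    qed
    then show ?thesis using ac h(1) lin I_r_closed by (simp add: K_def)
  qed
  ultimately have "frobenius_power S P p e \<subseteq> K" by (rule frobenius_power_le)
  then have "y \<otimes> \<one> \<in> carrier S \<and> \<delta> (y \<otimes> \<one>) \<in> P" using assms(3) unfolding K_def by fastforce
  then show ?thesis using assms(3) \<open>frobenius_power S P p e \<subseteq> K\<close> by (auto simp: K_def)
qed

definition sum_ideal :: "nat \<Rightarrow> nat \<Rightarrow> nat \<Rightarrow> 'a set" where
  "sum_ideal p e k = ideal_pow k <+>\<^bsub>S\<^esub> frobenius_power S P p e"

lemma ideal_sum_ideal: "ideal (sum_ideal p e k) S"
  unfolding sum_ideal_def by (rule add_ideals[OF ideal_ideal_pow ideal_frobenius_power])

lemma mem_sum_ideal:
  "x \<in> sum_ideal p e k \<longleftrightarrow> (\<exists>y\<in>ideal_pow k. \<exists>z\<in>frobenius_power S P p e. x = y \<oplus> z)"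
  by (auto simp: sum_ideal_def set_add_def')

lemma le_sum_ideal:
  "y \<in> ideal_pow k \<Longrightarrow> y \<in> sum_ideal p e k"
  "z \<in> frobenius_power S P p e \<Longrightarrow> z \<in> sum_ideal p e k"
proof -
  interpret A: ideal "ideal_pow k" S by (rule ideal_ideal_pow)
  interpret B: ideal "frobenius_power S P p e" S by (rule ideal_frobenius_power)
  show "y \<in> sum_ideal p e k" if "y \<in> ideal_pow k"
  proof -
    have "y = y \<oplus> \<zero>" using A.Icarr[OF that] by simp
    with that B.zero_closed show ?thesis unfolding mem_sum_ideal by blast
  qed
  show "z \<in> sum_ideal p e k" if "z \<in> frobenius_power S P p e"
  proof -
    have "z = \<zero> \<oplus> z" using B.Icarr[OF that] by simp
    with that A.zero_closed show ?thesis unfolding mem_sum_ideal by blast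
  qed
qed

lemma sum_ideal_mult:
  assumes "a \<in> P" "x \<in> sum_ideal p e k"
  shows "a \<otimes> x \<in> sum_ideal p e (Suc k)"
proof -
  obtain y z where yz: "y \<in> ideal_pow k" "z \<in> frobenius_power S P p e" "x = y \<oplus> z"
    using assms(2) by (auto simp: mem_sum_ideal)
  interpret B: ideal "frobenius_power S P p e" S by (rule ideal_frobenius_power)
  have c: "a \<in> carrier S" "y \<in> carrier S" "z \<in> carrier S"
    using assms yz Icarr B.Icarr ideal.Icarr[OF ideal_ideal_pow] by auto
  have "a \<otimes> x = y \<otimes> a \<oplus> a \<otimes> z" unfolding yz(3) using c by (simp add: r_distr m_comm)
  moreover have "y \<otimes> a \<in> ideal_pow (Suc k)"
    unfolding ideal_pow_Suc by (rule ideal_prod.prod[OF yz(1) assms(1)])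
  moreover have "a \<otimes> z \<in> frobenius_power S P p e" using c yz(2) B.I_l_closed by simp
  ultimately show ?thesis unfolding mem_sum_ideal by blast
qed

lemma sum_ideal_le_P:
  assumes "p > 0"
  shows "sum_ideal p e (Suc k) \<subseteq> P"
proof -
  have "a [^] (p ^ e) \<in> P" if a: "a \<in> P" for a
  proof -
    obtain m where "p ^ e = Suc m" using assms by (cases "p ^ e") auto
    then show ?thesis using a Icarr[OF a] I_l_closed by simp
  qed
  then have "frobenius_power S P p e \<subseteq> P" by (rule frobenius_power_le[OF is_ideal])
  then show ?thesis using ideal_pow_le by (fastforce simp: mem_sum_ideal)
qed

lemma saturation_le_diff_power:
  assumes "p > 0" "u \<in> U" "x \<in> carrier S" "u \<otimes> x \<in> sum_ideal p e (Suc n)"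
  shows "x \<in> diff_power S P (Suc n) p e"
proof -
  have "\<delta> x \<in> P" if \<delta>: "\<delta> \<in> diff_ops S n" "\<delta> \<in> diff_ops_level S p e" for \<delta>
  proof -
    note h = hom_values[OF diff_ops_hom[OF \<delta>(1)]]
    obtain m where m: "p ^ e = Suc m" using assms(1) by (cases "p ^ e") auto
    have uc: "u \<in> carrier S" using assms(2) by simp
    \<comment> \<open>The multiplier \<open>u\<close> is replaced by its \<open>q\<close>-th power,
      which stays outside \<open>P\<close>, still moves \<open>x\<close> into the ideal and, unlike
      \<open>u\<close>, commutes with \<open>\<delta>\<close>.\<close>
    have "u [^] (p ^ e) \<otimes> x = u [^] m \<otimes> (u \<otimes> x)" using uc assms(3) by (simp add: m m_assoc)
    also have "\<dots> \<in> sum_ideal p e (Suc n)"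
      using ideal.I_l_closed[OF ideal_sum_ideal assms(4)] uc by simp
    finally obtain y z where yz: "y \<in> ideal_pow (Suc n)" "z \<in> frobenius_power S P p e"
      "u [^] (p ^ e) \<otimes> x = y \<oplus> z" by (auto simp: mem_sum_ideal)
    have c: "y \<in> carrier S" "z \<in> carrier S"
      using yz ideal.Icarr[OF ideal_ideal_pow] ideal.Icarr[OF ideal_frobenius_power] by auto
    have "u [^] (p ^ e) \<otimes> \<delta> x = \<delta> (y \<oplus> z)"
      using \<delta>(2) uc assms(3) unfolding yz(3)[symmetric] by (simp add: diff_ops_level_def hom_over_def)
    also have "\<dots> \<in> P"
      using h(2)[OF c] diff_ops_ideal_pow[OF \<delta>(1) yz(1)] diff_ops_frobenius_power[OF \<delta>(2) assms(1) yz(2)]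
      by simp
    finally have "u [^] (p ^ e) \<otimes> \<delta> x \<in> P" .
    moreover have "u [^] (p ^ e) \<notin> P" using U_power[OF assms(2)] by simp
    ultimately show ?thesis using I_prime[of "u [^] (p ^ e)" "\<delta> x"] uc h(1)[OF assms(3)] by simp
  qed
  then show ?thesis using assms(3) by (simp add: diff_power_def)
qed

end

section \<open>The separating operator and the primary component\<close>

context prime_localization_ring
begin

lemma localization_generation:
  assumes p: "Factorial_Ring.prime p" "add_pow S p \<one> = \<zero>" and F: "F_finite p S"
  shows "\<exists>G\<subseteq>carrier L. finite G \<and> (\<forall>X. X \<subseteq> carrier L \<longrightarrow> \<zero>\<^bsub>L\<^esub> \<in> X \<longrightarrow>
    (\<forall>x\<in>X. \<forall>y\<in>X. x \<oplus>\<^bsub>L\<^esub> y \<in> X) \<longrightarrow>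
    (\<forall>r\<in>carrier L. \<forall>g\<in>G. r [^]\<^bsub>L\<^esub> p \<otimes>\<^bsub>L\<^esub> g \<in> X) \<longrightarrow> X = carrier L)"
proof -
  obtain G where G: "G \<subseteq> carrier S" "finite G"
    and gen: "\<And>X. \<lbrakk>X \<subseteq> carrier S; \<zero> \<in> X; \<forall>x\<in>X. \<forall>y\<in>X. x \<oplus> y \<in> X;
      \<forall>r\<in>carrier S. \<forall>g\<in>G. r [^] p \<otimes> g \<in> X\<rbrakk> \<Longrightarrow> X = carrier S"
    using frobenius_power_generation[OF p F, of 1] by (auto simp: subset_iff)
  have p0: "p > 0" using p(1) prime_gt_0_nat by blast
  have "X = carrier L" if X: "X \<subseteq> carrier L" "\<zero>\<^bsub>L\<^esub> \<in> X" "\<forall>x\<in>X. \<forall>y\<in>X. x \<oplus>\<^bsub>L\<^esub> y \<in> X"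
    "\<forall>r\<in>carrier L. \<forall>g\<in>\<phi> ` G. r [^]\<^bsub>L\<^esub> p \<otimes>\<^bsub>L\<^esub> g \<in> X" for X
  proof -
    have "x \<in> X" if x: "x \<in> carrier L" for x
    proof -
      obtain a s where a: "a \<in> carrier S" "s \<in> U" "x = quot a s" using L_cases[OF x] .
      define v where "v = quot \<one> s"
      have v: "v \<in> carrier L" using a(2) unfolding v_def by (intro quot_closed) auto
      have vs: "\<phi> s \<otimes>\<^bsub>L\<^esub> v = \<one>\<^bsub>L\<^esub>" unfolding v_def by (rule map_unit[OF a(2)])
      have sc: "s \<in> carrier S" using a by simp
      \<comment> \<open>A fraction \<open>a / s\<close> equals \<open>(1/s)^p\<close> times the
        image of \<open>a s^(p-1)\<close>. With the denominator thus absorbed into a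
        \<open>p\<close>-th power, generation of \<open>S\<close> can be applied to the
        numerators.\<close>
      define Y where "Y = {y \<in> carrier S. v [^]\<^bsub>L\<^esub> p \<otimes>\<^bsub>L\<^esub> \<phi> y \<in> X}"
      have "Y = carrier S"
      proof (rule gen)
        show "\<zero> \<in> Y" using X(2) v by (simp add: Y_def)
        show "\<forall>x\<in>Y. \<forall>y\<in>Y. x \<oplus> y \<in> Y" using X(3) v by (simp add: Y_def map_add L.r_distr)
        show "\<forall>r\<in>carrier S. \<forall>g\<in>G. r [^] p \<otimes> g \<in> Y"
        proof (intro ballI)
          fix r g assume r: "r \<in> carrier S" and g: "g \<in> G"
          have gc: "g \<in> carrier S" using g G by auto
          have "v [^]\<^bsub>L\<^esub> p \<otimes>\<^bsub>L\<^esub> \<phi> (r [^] p \<otimes> g) = (v \<otimes>\<^bsub>L\<^esub> \<phi> r) [^]\<^bsub>L\<^esub> p \<otimes>\<^bsub>L\<^esub> \<phi> g"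
            using v r gc by (simp add: map_mult malin_span_closed L.nat_pow_distrib L.m_assoc)
          also have "\<dots> \<in> X" using X(4) v r g by simp
          finally show "r [^] p \<otimes> g \<in> Y" using r gc by (simp add: Y_def)
        qed
      qed (auto simp: Y_def)
      obtain p' where p': "p = Suc p'" using p0 by (cases p) auto
      have "a \<otimes> s [^] p' \<in> Y" unfolding \<open>Y = carrier S\<close> using a sc by simp
      then have "v [^]\<^bsub>L\<^esub> p \<otimes>\<^bsub>L\<^esub> \<phi> (a \<otimes> s [^] p') \<in> X" by (simp add: Y_def)
      also have "v [^]\<^bsub>L\<^esub> p \<otimes>\<^bsub>L\<^esub> \<phi> (a \<otimes> s [^] p') = (\<phi> s \<otimes>\<^bsub>L\<^esub> v) [^]\<^bsub>L\<^esub> p' \<otimes>\<^bsub>L\<^esub> (v \<otimes>\<^bsub>L\<^esub> \<phi> a)"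
        using v sc a(1) by (simp add: p' map_mult malin_span_closed L.nat_pow_distrib L.m_ac)
      also have "\<dots> = v \<otimes>\<^bsub>L\<^esub> (\<phi> s \<otimes>\<^bsub>L\<^esub> x)"
        using v a x unfolding vs by (simp add: map_denominator)
      also have "\<dots> = (\<phi> s \<otimes>\<^bsub>L\<^esub> v) \<otimes>\<^bsub>L\<^esub> x" using v sc x by (simp add: L.m_ac)
      also have "\<dots> = x" using x by (simp add: vs)
      finally show ?thesis .
    qed
    with X(1) show ?thesis by blast
  qed
  moreover have "\<phi> ` G \<subseteq> carrier L" "finite (\<phi> ` G)" using G by auto
  ultimately show ?thesis by (intro exI[of _ "\<phi> ` G"]) blast
qed

text \<open>The second inclusion in contrapositive form. Clearing denominators multiplies the local
  operator by an element outside \<open>P\<close>, so its value at \<open>s\<close> stays outside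
  the maximal ideal.\<close>

lemma exists_separating_operator:
  assumes p: "Factorial_Ring.prime p" "add_pow S p \<one> = \<zero>" and F: "F_finite p S"
    and noeth: "noetherian_ring S" and reg: "regular_local_ring L"
    and s: "s \<in> carrier S" "\<phi> s \<notin> extension (sum_ideal p e (Suc n))"
  shows "\<exists>\<delta>\<in>diff_ops S n \<inter> diff_ops_level S p e. \<delta> s \<notin> P"
proof -
  note [simp] = L_proj
  obtain m where "{M. maximalideal M L} = {m}" using reg by (auto simp: regular_local_ring_def)
  then have max: "{M. maximalideal M L} = {extension P}" using maximalideal_extension by auto
  obtain G where G: "G \<subseteq> carrier L" "finite G" and gen: "\<And>X. \<lbrakk>X \<subseteq> carrier L; \<zero>\<^bsub>L\<^esub> \<in> X;
      \<forall>x\<in>X. \<forall>y\<in>X. x \<oplus>\<^bsub>L\<^esub> y \<in> X; \<forall>r\<in>carrier L. \<forall>g\<in>G. r [^]\<^bsub>L\<^esub> p \<otimes>\<^bsub>L\<^esub> g \<in> X\<rbrakk> \<Longrightarrow> X = carrier L"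
    using localization_generation[OF p F] by metis
  have pL: "add_pow L p \<one>\<^bsub>L\<^esub> = \<zero>\<^bsub>L\<^esub>"
    using map_add_pow[of \<one> p] p(2) by simp
  define E where "E k = extension (sum_ideal p e k)" for k
  have E0: "E 0 = carrier L"
  proof
    show "carrier L \<subseteq> E 0"
    proof
      fix r assume r: "r \<in> carrier L"
      then obtain a t where a: "a \<in> carrier S" "t \<in> U" "r = quot a t" using L_cases by blast
      then have "a \<in> sum_ideal p e 0" by (intro le_sum_ideal(1)) (simp add: ideal_pow_0)
      then show "r \<in> E 0" unfolding E_def extension_def using r a map_denominator[OF a(1,2)] by blast
    qed
  qed (auto simp: E_def extension_def)
  have E_mult: "x \<otimes>\<^bsub>L\<^esub> r \<in> E (Suc k)" if xr: "x \<in> extension P" "r \<in> E k" for x r k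
  proof -
    obtain u a v i where e: "x \<in> carrier L" "u \<in> U" "a \<in> P" "\<phi> u \<otimes>\<^bsub>L\<^esub> x = \<phi> a"
      "r \<in> carrier L" "v \<in> U" "i \<in> sum_ideal p e k" "\<phi> v \<otimes>\<^bsub>L\<^esub> r = \<phi> i"
      using xr by (auto simp: E_def extension_def)
    have c: "u \<in> carrier S" "v \<in> carrier S" "a \<in> carrier S" "i \<in> carrier S"
      using e Icarr ideal.Icarr[OF ideal_sum_ideal e(7)] by auto
    have "\<phi> (u \<otimes> v) \<otimes>\<^bsub>L\<^esub> (x \<otimes>\<^bsub>L\<^esub> r) = (\<phi> u \<otimes>\<^bsub>L\<^esub> x) \<otimes>\<^bsub>L\<^esub> (\<phi> v \<otimes>\<^bsub>L\<^esub> r)"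
      using c e(1,5) by (simp add: map_mult L.m_ac)
    also have "\<dots> = \<phi> (a \<otimes> i)" unfolding e(4,8) using c by (simp add: map_mult)
    finally show ?thesis
      unfolding E_def extension_def using U_mult[OF e(2,6)] sum_ideal_mult[OF e(3,7)] e(1,5) by blast
  qed
  have E_power: "x [^]\<^bsub>L\<^esub> (p ^ e) \<in> E k" if x: "x \<in> extension P" for x k
  proof -
    obtain u a where e: "x \<in> carrier L" "u \<in> U" "a \<in> P" "\<phi> u \<otimes>\<^bsub>L\<^esub> x = \<phi> a"
      using x by (auto simp: extension_def)
    have c: "u \<in> carrier S" "a \<in> carrier S" using e Icarr by auto
    have "\<phi> (u [^] (p ^ e)) \<otimes>\<^bsub>L\<^esub> x [^]\<^bsub>L\<^esub> (p ^ e) = (\<phi> u \<otimes>\<^bsub>L\<^esub> x) [^]\<^bsub>L\<^esub> (p ^ e)"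
      using c e(1) by (simp add: malin_span_closed L.nat_pow_distrib)
    also have "\<dots> = \<phi> (a [^] (p ^ e))" unfolding e(4) using c by (simp add: malin_span_closed)
    finally show ?thesis
      unfolding E_def extension_def
      using U_power[OF e(2)] le_sum_ideal(2)[OF frobenius_power_mem[OF e(3)]] e(1) by blast
  qed
  have gen': "X = carrier L" if "X \<subseteq> carrier L" "\<zero>\<^bsub>L\<^esub> \<in> X"
    "\<And>x y. x \<in> X \<Longrightarrow> y \<in> X \<Longrightarrow> x \<oplus>\<^bsub>L\<^esub> y \<in> X"
    "\<And>r g. r \<in> carrier L \<Longrightarrow> g \<in> G \<Longrightarrow> r [^]\<^bsub>L\<^esub> p \<otimes>\<^bsub>L\<^esub> g \<in> X" for X
    using gen[OF that(1,2)] that(3,4) by blast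
  have E_ideal: "ideal (E k) L" for k
    unfolding E_def by (rule ideal_extension[OF ideal_sum_ideal])
  have "\<exists>\<delta>. diff_op n \<delta> \<and> (\<forall>r x. \<delta> (r ^ (p ^ e) * x) = r ^ (p ^ e) * \<delta> x) \<and>
    (\<forall>x y. proj L x = proj L y \<longrightarrow> \<delta> x = \<delta> y) \<and> proj L (\<delta> (lift s)) \<notin> extension P"
  proof (rule regular_local_diff_op[OF reg max p(1) pL G(2,1)])
    show "\<phi> s \<in> carrier L" using s(1) by simp
    show "\<phi> s \<notin> E (Suc n)" using s(2) by (simp add: E_def)
  qed (fact gen' E_ideal E0 E_mult E_power)+
  then obtain d where d: "diff_op n d" "\<And>r x. d (r ^ (p ^ e) * x) = r ^ (p ^ e) * d x"
    "\<And>x y. proj L x = proj L y \<Longrightarrow> d x = d y" "proj L (d (lift s)) \<notin> extension P"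
    by blast
  have cong: "proj L (d x) = proj L (d y)" if "proj L x = proj L y" for x y
    using d(3)[OF that] by simp
  obtain u where u: "u \<in> U" "\<And>a b. a \<in> carrier S \<Longrightarrow> b \<in> carrier S \<Longrightarrow> \<phi> a = \<phi> b \<Longrightarrow> u \<otimes> a = u \<otimes> b"
    using exists_kernel_annihilator[OF noeth] by blast
  obtain w where w: "w \<in> U" "\<And>s. s \<in> carrier S \<Longrightarrow> \<exists>t\<in>carrier S. \<phi> t = \<phi> w \<otimes>\<^bsub>L\<^esub> proj L (d (lift s))"
    using common_denominator[OF p F diff_op_additive[OF d(1)] d(2) cong] by blast
  define \<tau> where "\<tau> s = (SOME t. t \<in> carrier S \<and> \<phi> t = \<phi> w \<otimes>\<^bsub>L\<^esub> proj L (d (lift s)))" for s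
  have \<tau>: "\<tau> s \<in> carrier S" "\<phi> (\<tau> s) = \<phi> w \<otimes>\<^bsub>L\<^esub> proj L (d (lift s))" if "s \<in> carrier S" for s
  proof -
    have "\<exists>t. t \<in> carrier S \<and> \<phi> t = \<phi> w \<otimes>\<^bsub>L\<^esub> proj L (d (lift s))" using w(2)[OF that] by blast
    from someI_ex[OF this] show "\<tau> s \<in> carrier S" "\<phi> (\<tau> s) = \<phi> w \<otimes>\<^bsub>L\<^esub> proj L (d (lift s))"
      by (auto simp: \<tau>_def)
  qed
  \<comment> \<open>The numerator \<open>\<tau> s\<close> is determined only up to the kernel of
    \<open>\<phi>\<close>. The factor \<open>u\<close> makes the value independent of the choice,
    which is what additivity and linearity of \<open>\<delta>\<close> rest on.\<close>
  define \<delta> where "\<delta> s = u \<otimes> \<tau> s" for s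
  have \<delta>: "\<exists>t\<in>carrier S. \<delta> s = u \<otimes> t \<and> \<phi> t = \<phi> w \<otimes>\<^bsub>L\<^esub> proj L (d (lift s))" if "s \<in> carrier S" for s
    using \<tau>[OF that] by (auto simp: \<delta>_def)
  have D: "\<delta> \<in> diff_ops S n" by (rule diff_ops_transfer[OF u w(1) d(1) cong \<delta>])
  have "\<delta> \<in> diff_ops_level S p e"
    by (rule diff_ops_level_transfer[OF u w(1) d(2) cong diff_ops_hom[OF D] \<delta>])
  moreover have "\<delta> s \<notin> P"
  proof -
    have "\<tau> s \<notin> P"
    proof
      assume "\<tau> s \<in> P"
      then have "proj L (d (lift s)) \<in> extension P"
        unfolding extension_def using w(1) \<tau>(2)[OF s(1)] by auto
      with d(4) show False by simp
    qed
    then show ?thesis unfolding \<delta>_def using U_mult[of u "\<tau> s"] u(1) \<tau>(1)[OF s(1)] by auto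
  qed
  ultimately show ?thesis using D by blast
qed

end

theorem proposition3p17:
  fixes S :: "('a, 'b) ring_scheme" and P :: "'a set" and p n e :: nat
  assumes "Factorial_Ring.prime p"
    and "regular_ring S"
    and "ring_char S = p"
    and "F_finite p S"
    and "primeideal P S"
    and "n \<ge> 1"
  shows "is_primary_component S P
           (P [^]\<^bsub>ideals_set S\<^esub> n <+>\<^bsub>S\<^esub> frobenius_power S P p e) (diff_power S P n p e)
       \<and> diff_power S P n p e =
           loc_contraction S P (P [^]\<^bsub>ideals_set S\<^esub> n <+>\<^bsub>S\<^esub> frobenius_power S P p e)"
proof -
  have cring: "cring S" and noeth: "noetherian_ring S" and reg: "regular_local_ring (localization S P)"
    using assms(2,5) by (auto simp: regular_ring_def)
  have cring_L: "cring (localization S P)" using reg by (simp add: regular_local_ring_def)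
  interpret prime_localization_ring S P
    using cring assms(5) cring_L
    by (intro prime_localization_ring.intro prime_localization.intro prime_localization_ring_axioms.intro)
  have p0: "p > 0" using assms(1) prime_gt_0_nat by blast
  have char: "add_pow S p \<one>\<^bsub>S\<^esub> = \<zero>\<^bsub>S\<^esub>" by (rule add_pow_ring_char[OF assms(3) p0])
  \<comment> \<open>The operators in \<open>diff_power\<close> have order \<open>n - 1\<close>; the
    successor form turns this truncated difference into \<open>n'\<close>.\<close>
  obtain n' where n: "n = Suc n'" using assms(6) by (cases n) auto
  define I where "I = sum_ideal p e n"
  have I: "ideal I S" unfolding I_def by (rule ideal_sum_ideal)
  have eq: "diff_power S P n p e = loc_contraction S P I"
  proof (intro equalityI subsetI)
    fix x assume x: "x \<in> diff_power S P n p e"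
    then have xc: "x \<in> carrier S" by (simp add: diff_power_def)
    show "x \<in> loc_contraction S P I"
    proof (rule ccontr)
      assume "x \<notin> loc_contraction S P I"
      then have "\<phi> x \<notin> extension (sum_ideal p e (Suc n'))"
        using xc map_in_extension[OF I xc] loc_contraction_iff[OF I] by (auto simp: I_def n)
      from exists_separating_operator[OF assms(1) char assms(4) noeth reg xc this]
      show False using x by (auto simp: diff_power_def n)
    qed
  next
    fix x assume "x \<in> loc_contraction S P I"
    then show "x \<in> diff_power S P n p e"
      using saturation_le_diff_power[OF p0] loc_contraction_iff[OF I] by (auto simp: I_def n)
  qed
  have "is_primary_component S P I (diff_power S P n p e)"
    unfolding is_primary_component_def
  proof (intro conjI allI impI)
    show "\<exists>D. minimal_primary_decomposition S I D"
      by (rule noetherian_ring.exists_minimal_primary_decomposition[OF noeth cring I])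
    fix D assume D: "minimal_primary_decomposition S I D"
    have "diff_power S P n p e = {x \<in> carrier S. \<exists>u\<in>carrier S - P. u \<otimes>\<^bsub>S\<^esub> x \<in> I}"
      unfolding eq by (auto simp: loc_contraction_iff[OF I])
    moreover have "I \<subseteq> P" unfolding I_def n by (rule sum_ideal_le_P[OF p0])
    moreover have "\<exists>k::nat. a [^]\<^bsub>S\<^esub> k \<in> I" if "a \<in> P" for a
      using le_sum_ideal(1)[OF power_in_ideal_pow[OF that]] by (auto simp: I_def)
    ultimately show "{Q \<in> D. ideal_radical S Q = P} = {diff_power S P n p e}"
      using primary_component_unique[OF I _ _ D] by simp
  qed
  with eq show ?thesis by (simp add: I_def sum_ideal_def ideal_pow_def)
qed

end
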